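(* Let $G$ be a noncompact connected Lie group with left Haar measure $\lambda$, let $p\in[1,\infty)$, let $\mathfrak{X}=\{X_1,\dots,X_\nu\}$ be a family of linearly independent left-invariant vector fields on $G$, and let $\mathcal{P}=(\mathcal{P}_{ij})\colon C^\infty(G)^{\mathfrak{n}}\to C^\infty(G)^{\mathfrak{m}}$ be a matrix-valued differential operator of degree $m\ge 1$ along derivatives of $\mathfrak{X}$. Assume that 1. the principal part $\mathcal{P}_m$ is left invariant; 2. the lower order part $\mathcal{P}_{<m}$ has coefficients in $L^\infty(G,\lambda)$. If $\mathcal{P}$ is $\mathfrak{X}$-maximal hypoelliptic in $L^p(\Omega)$ for some nonempty open set $\Omega\subseteq G$, then $\mathcal{P}$ is $\mathfrak{X}$-maximal hypoelliptic in $L^p(G)$; that is, there is a constant $C$ such that $$\sum_{\ell=0}^m|\alpha|^{\mathfrak{X}}_{\ell,p}\leq C\,(\|\mathcal{P}\alpha\|_p+\|\alpha\|_p)\qquad\forall\,\alpha\in C_c^{\infty}(G)^{\mathfrak{n}}.$$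
   Context: Setting. $G$ is a noncompact connected Lie group, its Lie algebra $\mathfrak{g}$ is identified with the left-invariant vector fields on $G$, and $\lambda$ is a left Haar measure. All $L^p$ spaces are with respect to $\lambda$. Functions are real-valued. $\mathfrak{n},\mathfrak{m}$ are positive integers. For $\alpha=(\alpha_1,\dots,\alpha_k)$ set $\|\alpha\|_p=\sum_{i=1}^k\|\alpha_i\|_{L^p(\lambda)}$. $C_c^{\infty}(\Omega)^{\mathfrak{n}}$ denotes the $\mathfrak{n}$-vectors of smooth functions with compact support in the open set $\Omega$. Operators. $\mathfrak{X}=\{X_1,\dots,X_\nu\}\subset\mathfrak{g}$ is a finite linearly independent family (no Hörmander condition is assumed). For a multi-index $I=(I_1,\dots,I_k)\in\{1,\dots,\nu\}^k$, $|I|=k$, put $X_I=X_{I_1}\cdots X_{I_k}$ (with $X_I=\mathrm{id}$ for $|I|=0$). A differential operator along derivatives of $\mathfrak{X}$ is given by $$\mathcal{P}(\alpha_1,\dots,\alpha_{\mathfrak{n}})=\Big(\sum_{i=1}^{\mathfrak{n}}\mathcal{P}_{i1}\alpha_i,\dots,\sum_{i=1}^{\mathfrak{n}}\mathcal{P}_{i\mathfrak{m}}\alpha_i\Big),\qquad \mathcal{P}_{ij}=\sum_{0\le|I|\le m}a^I_{ij}X_I,$$ with measurable coefficients $a^I_{ij}$ on $G$. It has degree (order) $m\geq1$ if all $\mathcal{P}_{ij}$ have order $\le m$ and at least one has order exactly $m$. Its principal part is $\mathcal{P}_m=\big(\sum_{|I|=m}a^I_{ij}X_I\big)_{ij}$,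 and its lower order part is $\mathcal{P}_{<m}=\mathcal{P}-\mathcal{P}_m$, with coefficients $a_{ij}^I$, $|I|<m$. A matrix-valued operator is left invariant if each of its entries commutes with all left translations $(\tau_x^*u)(y)=u(x^{-1}y)$, $x\in G$. Seminorms. For $u\in C_c^\infty(G)$ and $\ell\ge 0$, $|u|^{\mathfrak{X}}_{\ell,p}=\sum_{|I|=\ell}\|X_Iu\|_p$, the sum running over all $I\in\{1,\dots,\nu\}^\ell$ (so $|u|^{\mathfrak{X}}_{0,p}=\|u\|_p$); for $\alpha\in C_c^\infty(G)^{\mathfrak{n}}$, $|\alpha|^{\mathfrak{X}}_{\ell,p}=\sum_{i=1}^{\mathfrak{n}}|\alpha_i|^{\mathfrak{X}}_{\ell,p}$. Maximal hypoellipticity. For $\Omega\subseteq G$ open, $\mathcal{P}$ of degree $m$ is $\mathfrak{X}$-maximal hypoelliptic in $L^p(\Omega)$ if there is a constant $C(\Omega)$ such that $$\sum_{\ell=0}^m|\alpha|^{\mathfrak{X}}_{\ell,p}\le C(\Omega)\,(\|\mathcal{P}\alpha\|_p+\|\alpha\|_p)\qquad\forall\,\alpha\in C_c^\infty(\Omega)^{\mathfrak{n}}.$$ *)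

theory Defs
  imports "HOL-Analysis.Analysis" "HOL-Algebra.Group"
begin

section \<open>Smooth manifolds and smooth maps\<close>

text \<open>
  \<open>Ck_on k S f\<close> is meant for open \<open>S\<close> only: all iterated directional derivatives of \<open>f\<close> up to
  order \<open>k\<close> exist and are continuous on \<open>S\<close>.
\<close>

primrec Ck_on ::
    "nat \<Rightarrow> 'a::euclidean_space set \<Rightarrow> ('a \<Rightarrow> 'b::euclidean_space) \<Rightarrow> bool" where
  "Ck_on 0 S f \<longleftrightarrow> continuous_on S f"
| "Ck_on (Suc k) S f \<longleftrightarrow>
     (\<forall>x\<in>S. f differentiable (at x)) \<and> (\<forall>v. Ck_on k S (\<lambda>x. frechet_derivative f (at x) v))"

definition smooth_on :: "'a::euclidean_space set \<Rightarrow> ('a \<Rightarrow> 'b::euclidean_space) \<Rightarrow> bool" where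
  "smooth_on S f \<longleftrightarrow> open S \<and> (\<forall>k. Ck_on k S f)"

text \<open>
  A chart \<open>(U, \<phi>)\<close> consists of its domain and its coordinate map. The values of \<open>\<phi>\<close> outside
  \<open>U\<close> are irrelevant. The model space \<open>'e\<close> has positive dimension, which only excludes discrete
  manifolds.
\<close>

type_synonym ('x, 'e) chart = "'x set \<times> ('x \<Rightarrow> 'e)"

definition is_chart :: "('x::topological_space, 'e::euclidean_space) chart \<Rightarrow> bool" where
  "is_chart = (\<lambda>(U, \<phi>). open U \<and> open (\<phi> ` U) \<and> inj_on \<phi> U \<and>
     homeomorphism U (\<phi> ` U) \<phi> (inv_into U \<phi>))"

definition smooth_atlas :: "('x::topological_space, 'e::euclidean_space) chart set \<Rightarrow> bool" where
  "smooth_atlas A \<longleftrightarrow>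
     (\<Union>(U, \<phi>)\<in>A. U) = UNIV \<and> (\<forall>c\<in>A. is_chart c) \<and>
     (\<forall>(U, \<phi>)\<in>A. \<forall>(V, \<psi>)\<in>A. smooth_on (\<phi> ` (U \<inter> V)) (\<psi> \<circ> inv_into U \<phi>))"

definition prod_atlas :: "('x, 'e) chart set \<Rightarrow> ('y, 'f) chart set \<Rightarrow> ('x \<times> 'y, 'e \<times> 'f) chart set" where
  "prod_atlas A B = {(U \<times> V, map_prod \<phi> \<psi>) |U \<phi> V \<psi>. (U, \<phi>) \<in> A \<and> (V, \<psi>) \<in> B}"

definition smooth_map ::
    "('x::topological_space, 'e::euclidean_space) chart set \<Rightarrow>
     ('y::topological_space, 'f::euclidean_space) chart set \<Rightarrow> ('x \<Rightarrow> 'y) \<Rightarrow> bool" where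
  "smooth_map A B f \<longleftrightarrow> continuous_on UNIV f \<and>
     (\<forall>(U, \<phi>)\<in>A. \<forall>(V, \<psi>)\<in>B. smooth_on (\<phi> ` (U \<inter> f -` V)) (\<psi> \<circ> f \<circ> inv_into U \<phi>))"

definition smooth_functions ::
    "('x::topological_space, 'e::euclidean_space) chart set \<Rightarrow> ('x \<Rightarrow> real) set" where
  "smooth_functions A = {u. smooth_map A {(UNIV, id :: real \<Rightarrow> real)} u}"

text \<open>The space \<open>C\<^sub>c\<^sup>\<infinity>(\<Omega>)\<close>, its elements being extended by zero to the whole manifold.\<close>

definition test_functions ::
    "('x::topological_space, 'e::euclidean_space) chart set \<Rightarrow> 'x set \<Rightarrow> ('x \<Rightarrow> real) set" where
  "test_functions A \<Omega> =
     {u \<in> smooth_functions A. compact (closure {x. u x \<noteq> 0}) \<and> closure {x. u x \<noteq> 0} \<subseteq> \<Omega>}"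


section \<open>Lie groups, left Haar measures, left-invariant vector fields\<close>

text \<open>
  The underlying set of the Lie group is a whole type. Second countability is automatic for
  connected Lie groups.
\<close>

definition lie_group ::
    "'g::{second_countable_topology, t2_space} monoid \<Rightarrow> ('g, 'e::euclidean_space) chart set \<Rightarrow> bool" where
  "lie_group G A \<longleftrightarrow>
     group G \<and> carrier G = UNIV \<and> smooth_atlas A \<and>
     smooth_map (prod_atlas A A) A (\<lambda>(x, y). x \<otimes>\<^bsub>G\<^esub> y) \<and>
     smooth_map A A (\<lambda>x. inv\<^bsub>G\<^esub> x)"

text \<open>
  Regularity is not listed: on a second countable locally compact Hausdorff space every Borel
  measure that is finite on compact sets is regular.
\<close>

definition left_haar_measure ::
    "'g::{second_countable_topology, t2_space} monoid \<Rightarrow> 'g measure \<Rightarrow> bool" where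
  "left_haar_measure G \<mu> \<longleftrightarrow>
     sets \<mu> = sets borel \<and> emeasure \<mu> UNIV \<noteq> 0 \<and>
     (\<forall>K. compact K \<longrightarrow> emeasure \<mu> K < \<infinity>) \<and>
     (\<forall>x. distr \<mu> borel (\<lambda>y. x \<otimes>\<^bsub>G\<^esub> y) = \<mu>)"

definition left_transl :: "'g monoid \<Rightarrow> 'g \<Rightarrow> ('g \<Rightarrow> real) \<Rightarrow> ('g \<Rightarrow> real)" where
  "left_transl G x u = (\<lambda>y. u (inv\<^bsub>G\<^esub> x \<otimes>\<^bsub>G\<^esub> y))"

text \<open>
  Vector fields are derivations of the algebra of smooth functions. As HOL functions are total,
  such an operator carries irrelevant values on functions that are not smooth.
\<close>

type_synonym 'g operator = "('g \<Rightarrow> real) \<Rightarrow> ('g \<Rightarrow> real)"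

definition vector_field ::
    "('x::topological_space, 'e::euclidean_space) chart set \<Rightarrow> 'x operator \<Rightarrow> bool" where
  "vector_field A X \<longleftrightarrow>
     (\<forall>u\<in>smooth_functions A. X u \<in> smooth_functions A) \<and>
     (\<forall>u\<in>smooth_functions A. \<forall>v\<in>smooth_functions A.
        X (\<lambda>x. u x + v x) = (\<lambda>x. X u x + X v x)) \<and>
     (\<forall>c. \<forall>u\<in>smooth_functions A. X (\<lambda>x. c * u x) = (\<lambda>x. c * X u x)) \<and>
     (\<forall>u\<in>smooth_functions A. \<forall>v\<in>smooth_functions A.
        X (\<lambda>x. u x * v x) = (\<lambda>x. u x * X v x + v x * X u x))"

definition lie_algebra ::
    "'g::{second_countable_topology, t2_space} monoid \<Rightarrow> ('g, 'e::euclidean_space) chart set \<Rightarrow>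
     'g operator set" where
  "lie_algebra G A =
     {X. vector_field A X \<and>
         (\<forall>x. \<forall>u\<in>smooth_functions A. X (left_transl G x u) = left_transl G x (X u))}"

text \<open>Families \<open>X\<^sub>1, \<dots>, X\<^sub>\<nu>\<close> are functions on \<open>nat\<close> of which only the values on \<open>{1..\<nu>}\<close> matter.\<close>

definition lin_indep_fields ::
    "('x::topological_space, 'e::euclidean_space) chart set \<Rightarrow> nat \<Rightarrow> (nat \<Rightarrow> 'x operator) \<Rightarrow> bool" where
  "lin_indep_fields A \<nu> X \<longleftrightarrow>
     (\<forall>c::nat \<Rightarrow> real.
        (\<forall>u\<in>smooth_functions A. \<forall>x. (\<Sum>i=1..\<nu>. c i * X i u x) = 0) \<longrightarrow> (\<forall>i\<in>{1..\<nu>}. c i = 0))"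


section \<open>Differential operators along the derivatives of a family\<close>

definition multi_indices :: "nat \<Rightarrow> nat \<Rightarrow> nat list set" where
  "multi_indices \<nu> k = {I. length I = k \<and> set I \<subseteq> {1..\<nu>}}"

text \<open>\<open>word_op X [i\<^sub>1, \<dots>, i\<^sub>k] u = X\<^bsub>i\<^sub>1\<^esub> (\<dots> (X\<^bsub>i\<^sub>k\<^esub> u))\<close>\<close>

definition word_op :: "(nat \<Rightarrow> 'g operator) \<Rightarrow> nat list \<Rightarrow> 'g operator" where
  "word_op X I = foldr X I"

text \<open>
  The coefficients \<open>a\<^sub>i\<^sub>j\<^sup>I\<close> are given as \<open>a i j I\<close>, with \<open>1 \<le> i \<le> n\<close> and \<open>1 \<le> j \<le> q\<close>.
  \<open>scalar_op\<close> and \<open>principal_part\<close> take the coefficients \<open>b I\<close> of a single matrix entry.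
\<close>

definition scalar_op ::
    "nat \<Rightarrow> (nat \<Rightarrow> 'g operator) \<Rightarrow> nat \<Rightarrow> (nat list \<Rightarrow> 'g \<Rightarrow> real) \<Rightarrow> 'g operator" where
  "scalar_op \<nu> X m b u = (\<lambda>x. \<Sum>k=0..m. \<Sum>I\<in>multi_indices \<nu> k. b I x * word_op X I u x)"

definition principal_part ::
    "nat \<Rightarrow> (nat \<Rightarrow> 'g operator) \<Rightarrow> nat \<Rightarrow> (nat list \<Rightarrow> 'g \<Rightarrow> real) \<Rightarrow> 'g operator" where
  "principal_part \<nu> X m b u = (\<lambda>x. \<Sum>I\<in>multi_indices \<nu> m. b I x * word_op X I u x)"

definition matrix_op ::
    "nat \<Rightarrow> (nat \<Rightarrow> 'g operator) \<Rightarrow> nat \<Rightarrow> nat \<Rightarrow> (nat \<Rightarrow> nat \<Rightarrow> nat list \<Rightarrow> 'g \<Rightarrow> real) \<Rightarrow>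
     (nat \<Rightarrow> 'g \<Rightarrow> real) \<Rightarrow> (nat \<Rightarrow> 'g \<Rightarrow> real)" where
  "matrix_op \<nu> X m n a \<alpha> = (\<lambda>j x. \<Sum>i=1..n. scalar_op \<nu> X m (a i j) (\<alpha> i) x)"

text \<open>
  Coefficients are identified when they agree almost everywhere. The order is that of the given
  expression: exact order \<open>m\<close> means that some coefficient of length \<open>m\<close> is not a null function.
\<close>

definition has_degree ::
    "'g measure \<Rightarrow> nat \<Rightarrow> nat \<Rightarrow> nat \<Rightarrow> nat \<Rightarrow> (nat \<Rightarrow> nat \<Rightarrow> nat list \<Rightarrow> 'g \<Rightarrow> real) \<Rightarrow> bool" where
  "has_degree \<mu> \<nu> m n q a \<longleftrightarrow>
     (\<forall>i\<in>{1..n}. \<forall>j\<in>{1..q}. \<forall>k\<le>m. \<forall>I\<in>multi_indices \<nu> k. a i j I \<in> borel_measurable \<mu>) \<and>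
     (\<exists>i\<in>{1..n}. \<exists>j\<in>{1..q}. \<exists>I\<in>multi_indices \<nu> m. \<not> (AE x in \<mu>. a i j I x = 0))"

text \<open>
  Since the coefficients are only measurable, two operators are considered equal when they give
  almost everywhere equal functions.
\<close>

definition left_invariant_op ::
    "'g::{second_countable_topology, t2_space} monoid \<Rightarrow> ('g, 'e::euclidean_space) chart set \<Rightarrow>
     'g measure \<Rightarrow> 'g operator \<Rightarrow> bool" where
  "left_invariant_op G A \<mu> T \<longleftrightarrow>
     (\<forall>x. \<forall>u\<in>smooth_functions A.
        AE y in \<mu>. T (left_transl G x u) y = left_transl G x (T u) y)"

definition L_infty :: "'g measure \<Rightarrow> ('g \<Rightarrow> real) set" where
  "L_infty \<mu> = {f \<in> borel_measurable \<mu>. \<exists>B. AE x in \<mu>. \<bar>f x\<bar> \<le> B}"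


section \<open>Seminorms and maximal hypoellipticity\<close>

text \<open>The norms take values in \<open>[0,\<infinity>]\<close>, as \<open>\<P>\<alpha>\<close> need not be in \<open>L\<^sup>p\<close>.\<close>

definition Lp_norm :: "'g measure \<Rightarrow> real \<Rightarrow> ('g \<Rightarrow> real) \<Rightarrow> ennreal" where
  "Lp_norm \<mu> p u =
     (let J = (\<integral>\<^sup>+ x. ennreal (\<bar>u x\<bar> powr p) \<partial>\<mu>)
      in if J = \<infinity> then \<infinity> else ennreal (enn2real J powr (1 / p)))"

definition Lp_norm_vec :: "'g measure \<Rightarrow> real \<Rightarrow> nat \<Rightarrow> (nat \<Rightarrow> 'g \<Rightarrow> real) \<Rightarrow> ennreal" where
  "Lp_norm_vec \<mu> p k \<alpha> = (\<Sum>i=1..k. Lp_norm \<mu> p (\<alpha> i))"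

definition seminorm ::
    "'g measure \<Rightarrow> real \<Rightarrow> nat \<Rightarrow> (nat \<Rightarrow> 'g operator) \<Rightarrow> nat \<Rightarrow> ('g \<Rightarrow> real) \<Rightarrow> ennreal" where
  "seminorm \<mu> p \<nu> X l u = (\<Sum>I\<in>multi_indices \<nu> l. Lp_norm \<mu> p (word_op X I u))"

definition seminorm_vec ::
    "'g measure \<Rightarrow> real \<Rightarrow> nat \<Rightarrow> (nat \<Rightarrow> 'g operator) \<Rightarrow> nat \<Rightarrow> nat \<Rightarrow> (nat \<Rightarrow> 'g \<Rightarrow> real) \<Rightarrow> ennreal" where
  "seminorm_vec \<mu> p \<nu> X n l \<alpha> = (\<Sum>i=1..n. seminorm \<mu> p \<nu> X l (\<alpha> i))"

definition maximal_hypoelliptic ::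
    "('g::topological_space, 'e::euclidean_space) chart set \<Rightarrow> 'g measure \<Rightarrow> real \<Rightarrow>
     nat \<Rightarrow> (nat \<Rightarrow> 'g operator) \<Rightarrow> nat \<Rightarrow> nat \<Rightarrow> nat \<Rightarrow>
     (nat \<Rightarrow> nat \<Rightarrow> nat list \<Rightarrow> 'g \<Rightarrow> real) \<Rightarrow> 'g set \<Rightarrow> bool" where
  "maximal_hypoelliptic A \<mu> p \<nu> X m n q a \<Omega> \<longleftrightarrow>
     (\<exists>C::real. 0 < C \<and>
        (\<forall>\<alpha>. (\<forall>i\<in>{1..n}. \<alpha> i \<in> test_functions A \<Omega>) \<longrightarrow>
           (\<Sum>l=0..m. seminorm_vec \<mu> p \<nu> X n l \<alpha>)
             \<le> ennreal C * (Lp_norm_vec \<mu> p q (matrix_op \<nu> X m n a \<alpha>) + Lp_norm_vec \<mu> p n \<alpha>)))"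

end

theory Submission
  imports Defs
begin

text \<open>
  Let \<open>\<phi> \<ge> 0\<close> be a bump function supported in \<open>\<Omega>\<close>. For \<open>z \<in> G\<close> the hypothesis is applied to
  \<open>\<beta> g = \<phi> g * \<alpha> (z g)\<close>. As the principal part is left invariant, \<open>\<P>\<beta> g\<close> is \<open>\<phi> g * \<P>\<alpha> (z g)\<close>
  up to terms in the derivatives of \<open>\<alpha>\<close> at \<open>z g\<close> of order less than \<open>m\<close>, with factors that are
  bounded and supported in \<open>supp \<phi>\<close>. Taking \<open>p\<close>-th powers and integrating over all \<open>z\<close> with
  respect to \<open>\<mu>\<close> (which replaces a locally finite covering by translates) turns the local
  estimates into a global one, in which only the derivatives of order less than \<open>m\<close> appear on the
  right besides \<open>\<P>\<alpha>\<close>. These are absorbed by the interpolation inequality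
  \<open>\<integral>\<bar>X u\<bar>\<^sup>p \<le> \<epsilon> \<integral>\<bar>X (X u)\<bar>\<^sup>p + C \<integral>\<bar>u\<bar>\<^sup>p\<close>, which follows from \<open>\<integral> X F = \<kappa> \<integral> F\<close> for a suitable
  nonlinear expression \<open>F\<close> in \<open>u\<close> and \<open>X u\<close>.
\<close>

section \<open>Calculus of iterated differentiability\<close>

text \<open>Averaging is done with \<open>p\<close>-th powers because Tonelli's theorem splits the
  double integral of \<open>h g * k (z g)\<close> into the integral of \<open>h (inv z)\<close>
  times that of \<open>k\<close>: one local constant serves all translates, and no overlaps have to
  be counted. Left translations are used since the fields and the principal part commute with them;
  the lower order part is only bounded and is an error term both at \<open>g\<close> and at
  \<open>z g\<close>. A left-invariant field, on the other hand, differentiates along right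
  translations, and these multiply \<open>\<mu>\<close> by a constant, whose derivative is
  \<open>\<kappa>\<close>. In the interpolation inequality the expression \<open>F\<close> is small
  compared with the quantity to be estimated, so that \<open>\<kappa> \<integral> F\<close> is
  absorbed too. Absorption subtracts top order terms from both sides, which is legitimate because
  they are finite: words in the fields send test functions to test functions. Only
  \<open>\<P>\<alpha>\<close> may have infinite norm, and then the estimate is trivial.\<close>

lemma frechet_derivative_cong_open:
  assumes "open S" "x \<in> S" "\<And>y. y \<in> S \<Longrightarrow> f y = g y"
  shows "frechet_derivative f (at x) = frechet_derivative g (at x)"
proof -
  have "(f has_derivative D) (at x) \<longleftrightarrow> (g has_derivative D) (at x)" for D
    using assms by (metis has_derivative_transform_within_open)
  then show ?thesis
    by (simp add: frechet_derivative_def)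
qed

lemma differentiable_cong_open:
  assumes "open S" "x \<in> S" "\<And>y. y \<in> S \<Longrightarrow> f y = g y"
  shows "f differentiable (at x) \<longleftrightarrow> g differentiable (at x)"
  using assms by (metis differentiable_def has_derivative_transform_within_open)

lemma Ck_on_cong:
  assumes "open S" "\<And>x. x \<in> S \<Longrightarrow> f x = g x"
  shows "Ck_on k S f \<longleftrightarrow> Ck_on k S g"
  using assms(2)
proof (induction k arbitrary: f g)
  case 0
  then show ?case by (simp cong: continuous_on_cong)
next
  case (Suc k)
  have "Ck_on k S (\<lambda>x. frechet_derivative f (at x) v) \<longleftrightarrow>
        Ck_on k S (\<lambda>x. frechet_derivative g (at x) v)" for v
    using frechet_derivative_cong_open[OF assms(1), of _ f g] Suc.prems
    by (intro Suc.IH) auto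
  moreover have "f differentiable (at x) \<longleftrightarrow> g differentiable (at x)" if "x \<in> S" for x
    using differentiable_cong_open[OF assms(1) that, of f g] Suc.prems by auto
  ultimately show ?case by simp
qed

lemma Ck_on_subset: "Ck_on k S f \<Longrightarrow> T \<subseteq> S \<Longrightarrow> Ck_on k T f"
  by (induction k arbitrary: f) (auto intro: continuous_on_subset)

lemma Ck_on_local:
  assumes "\<And>x. x \<in> S \<Longrightarrow> \<exists>T. open T \<and> x \<in> T \<and> Ck_on k T f"
  shows "Ck_on k S f"
  using assms
proof (induction k arbitrary: f)
  case 0
  have "continuous (at x) f" if "x \<in> S" for x
    using 0[OF that] continuous_on_eq_continuous_at by (metis Ck_on.simps(1))
  then show ?case
    by (simp add: continuous_at_imp_continuous_on)
next
  case (Suc k)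
  have "Ck_on k S (\<lambda>x. frechet_derivative f (at x) v)" for v
    by (rule Suc.IH) (use Suc.prems in \<open>auto; blast\<close>)
  then show ?case using Suc.prems by (auto; blast)
qed

text \<open>Derivatives at a point of an open set are unique, so the choice hidden in
  \<open>frechet_derivative\<close> may be replaced by any explicit candidate
  \<open>f'\<close>.\<close>

lemma Ck_on_SucI:
  assumes "open S" "\<And>x. x \<in> S \<Longrightarrow> (f has_derivative f' x) (at x)"
    "\<And>v. Ck_on k S (\<lambda>x. f' x v)"
  shows "Ck_on (Suc k) S f"
proof -
  have "frechet_derivative f (at x) = f' x" if "x \<in> S" for x
    using assms(2)[OF that] by (metis frechet_derivative_at)
  then have "Ck_on k S (\<lambda>x. frechet_derivative f (at x) v)" for v
    using assms(3)[of v] by (subst Ck_on_cong[OF assms(1), where g = "\<lambda>x. f' x v"]) auto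
  then show ?thesis
    using assms(2) by (auto simp: differentiable_def)
qed

lemma Ck_on_Suc_has_derivative:
  "Ck_on (Suc k) S f \<Longrightarrow> x \<in> S \<Longrightarrow> (f has_derivative frechet_derivative f (at x)) (at x)"
  by (simp add: frechet_derivative_works[symmetric])

lemma Ck_on_imp_continuous_on: "Ck_on k S f \<Longrightarrow> continuous_on S f"
  by (cases k) (auto simp: continuous_on_eq_continuous_within differentiable_imp_continuous_within
    intro: continuous_at_imp_continuous_within)

lemma Ck_on_Suc_D: "Ck_on (Suc k) S f \<Longrightarrow> Ck_on k S f"
proof (induction k arbitrary: f)
  case 0
  then show ?case using Ck_on_imp_continuous_on[of "Suc 0" S f] by simp
qed simp

lemma Ck_on_const: "open S \<Longrightarrow> Ck_on k S (\<lambda>x. c)"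
proof (induction k arbitrary: c)
  case (Suc k)
  show ?case by (rule Ck_on_SucI[where f' = "\<lambda>x v. 0"]) (use Suc in auto)
qed simp

lemma Ck_on_add: "open S \<Longrightarrow> Ck_on k S f \<Longrightarrow> Ck_on k S g \<Longrightarrow> Ck_on k S (\<lambda>x. f x + g x)"
proof (induction k arbitrary: f g)
  case (Suc k)
  show ?case
    by (rule Ck_on_SucI[where f' = "\<lambda>x v. frechet_derivative f (at x) v + frechet_derivative g (at x) v"])
      (use Suc in \<open>auto intro!: has_derivative_add Ck_on_Suc_has_derivative simp del: Ck_on.simps(2)\<close>, auto)
qed (auto intro!: continuous_intros)

lemma Ck_on_bounded_linear:
  assumes "bounded_linear L"
  shows "open S \<Longrightarrow> Ck_on k S f \<Longrightarrow> Ck_on k S (\<lambda>x. L (f x))"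
proof (induction k arbitrary: f)
  case 0
  then show ?case using bounded_linear.continuous_on[OF assms] by simp
next
  case (Suc k)
  show ?case
    by (rule Ck_on_SucI[where f' = "\<lambda>x v. L (frechet_derivative f (at x) v)"])
      (use Suc in \<open>auto intro!: bounded_linear.has_derivative[OF assms] Ck_on_Suc_has_derivative
        simp del: Ck_on.simps(2)\<close>, auto)
qed

lemma Ck_on_scaleR:
  fixes f :: "'a::euclidean_space \<Rightarrow> real"
  shows "open S \<Longrightarrow> Ck_on k S f \<Longrightarrow> Ck_on k S g \<Longrightarrow> Ck_on k S (\<lambda>x. f x *\<^sub>R g x)"
proof (induction k arbitrary: f g)
  case (Suc k)
  show ?case
  proof (rule Ck_on_SucI[where f' = "\<lambda>x v. f x *\<^sub>R frechet_derivative g (at x) v +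
        frechet_derivative f (at x) v *\<^sub>R g x"])
    show "((\<lambda>x. f x *\<^sub>R g x) has_derivative (\<lambda>v. f x *\<^sub>R frechet_derivative g (at x) v +
        frechet_derivative f (at x) v *\<^sub>R g x)) (at x)" if "x \<in> S" for x
      using has_derivative_scaleR[OF Ck_on_Suc_has_derivative[OF Suc.prems(2) that]
          Ck_on_Suc_has_derivative[OF Suc.prems(3) that]] .
    show "Ck_on k S (\<lambda>x. f x *\<^sub>R frechet_derivative g (at x) v +
        frechet_derivative f (at x) v *\<^sub>R g x)" for v
      using Suc.prems by (intro Ck_on_add Suc.IH Ck_on_Suc_D[of k S f] Ck_on_Suc_D[of k S g]) auto
  qed (use Suc in auto)
qed (auto intro!: continuous_intros)

lemma Ck_on_mult:
  fixes f g :: "'a::euclidean_space \<Rightarrow> real"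
  shows "open S \<Longrightarrow> Ck_on k S f \<Longrightarrow> Ck_on k S g \<Longrightarrow> Ck_on k S (\<lambda>x. f x * g x)"
  using Ck_on_scaleR[of S k f g] by simp

lemma Ck_on_sum:
  assumes "open S"
  shows "(\<And>i. i \<in> I \<Longrightarrow> Ck_on k S (f i)) \<Longrightarrow> Ck_on k S (\<lambda>x. \<Sum>i\<in>I. f i x)"
  by (induction I rule: infinite_finite_induct) (auto intro: Ck_on_const Ck_on_add assms)

lemma linear_expand_Basis:
  assumes "linear L"
  shows "L v = (\<Sum>b\<in>Basis. (v \<bullet> b) *\<^sub>R L b)"
  by (metis (no_types, lifting) assms euclidean_representation linear_sum linear_cmul sum.cong)

text \<open>The chain rule differentiates \<open>g\<close> in the direction
  \<open>frechet_derivative f (at x) v\<close>, which varies with \<open>x\<close>, while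
  \<open>Ck_on\<close> speaks of fixed directions only. Expanding this direction in the basis leaves
  derivatives of \<open>g\<close> along basis vectors, to which the induction hypothesis
  applies.\<close>

lemma Ck_on_compose:
  fixes f :: "'a::euclidean_space \<Rightarrow> 'b::euclidean_space"
    and g :: "'b \<Rightarrow> 'c::euclidean_space"
  assumes "open S" "open T" "f ` S \<subseteq> T"
  shows "Ck_on k S f \<Longrightarrow> Ck_on k T g \<Longrightarrow> Ck_on k S (\<lambda>x. g (f x))"
proof (induction k arbitrary: g)
  case 0
  then show ?case using assms by (auto intro: continuous_on_compose2)
next
  case (Suc k)
  have g: "(g has_derivative frechet_derivative g (at (f x))) (at (f x))" if "x \<in> S" for x
    using Suc.prems(2) assms(3) that by (auto intro: Ck_on_Suc_has_derivative simp del: Ck_on.simps(2))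
  show ?case
  proof (rule Ck_on_SucI[where f' = "\<lambda>x v. \<Sum>b\<in>Basis. (frechet_derivative f (at x) v \<bullet> b) *\<^sub>R
      frechet_derivative g (at (f x)) b"])
    fix x assume x: "x \<in> S"
    have "((\<lambda>x. g (f x)) has_derivative
        (\<lambda>v. frechet_derivative g (at (f x)) (frechet_derivative f (at x) v))) (at x)"
      using has_derivative_compose[OF Ck_on_Suc_has_derivative[OF Suc.prems(1) x] g[OF x]] .
    moreover have "frechet_derivative g (at (f x)) (frechet_derivative f (at x) v) =
        (\<Sum>b\<in>Basis. (frechet_derivative f (at x) v \<bullet> b) *\<^sub>R
          frechet_derivative g (at (f x)) b)" for v
      by (rule linear_expand_Basis[OF has_derivative_linear[OF g[OF x]]])
    ultimately show "((\<lambda>x. g (f x)) has_derivative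
        (\<lambda>v. \<Sum>b\<in>Basis. (frechet_derivative f (at x) v \<bullet> b) *\<^sub>R
          frechet_derivative g (at (f x)) b)) (at x)"
      by (simp only:)
  next
    fix v
    show "Ck_on k S (\<lambda>x. \<Sum>b\<in>Basis. (frechet_derivative f (at x) v \<bullet> b) *\<^sub>R
          frechet_derivative g (at (f x)) b)"
    proof (intro Ck_on_sum Ck_on_scaleR Ck_on_bounded_linear[OF bounded_linear_inner_left] assms(1))
      show "Ck_on k S (\<lambda>x. frechet_derivative g (at (f x)) b)" for b
        by (rule Suc.IH[where g = "\<lambda>y. frechet_derivative g (at y) b", OF Ck_on_Suc_D])
          (use Suc.prems in auto)
    qed (use Suc.prems in simp)
  qed (rule assms)
qed

section \<open>Closure properties of smooth maps on open sets\<close>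

lemma smooth_on_open: "smooth_on S f \<Longrightarrow> open S"
  by (simp add: smooth_on_def)

lemma smooth_on_cong: "(\<And>x. x \<in> S \<Longrightarrow> f x = g x) \<Longrightarrow> smooth_on S f \<longleftrightarrow> smooth_on S g"
  unfolding smooth_on_def using Ck_on_cong[of S f g] by auto

lemma smooth_on_subset: "smooth_on S f \<Longrightarrow> open T \<Longrightarrow> T \<subseteq> S \<Longrightarrow> smooth_on T f"
  using Ck_on_subset[of _ S f T] by (auto simp: smooth_on_def)

lemma smooth_on_local:
  assumes "open S" "\<And>x. x \<in> S \<Longrightarrow> \<exists>T. x \<in> T \<and> smooth_on T f"
  shows "smooth_on S f"
  unfolding smooth_on_def
proof (intro conjI allI assms(1))
  show "Ck_on k S f" for k
    by (rule Ck_on_local) (use assms(2) in \<open>auto simp: smooth_on_def\<close>)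
qed

lemma smooth_on_const: "open S \<Longrightarrow> smooth_on S (\<lambda>x. c)"
  by (simp add: smooth_on_def Ck_on_const)

lemma smooth_on_add: "smooth_on S f \<Longrightarrow> smooth_on S g \<Longrightarrow> smooth_on S (\<lambda>x. f x + g x)"
  by (simp add: smooth_on_def Ck_on_add)

lemma smooth_on_mult:
  fixes f g :: "'a::euclidean_space \<Rightarrow> real"
  shows "smooth_on S f \<Longrightarrow> smooth_on S g \<Longrightarrow> smooth_on S (\<lambda>x. f x * g x)"
  by (simp add: smooth_on_def Ck_on_mult)

lemma smooth_on_compose:
  assumes "smooth_on S f" "smooth_on T g" "f ` S \<subseteq> T"
  shows "smooth_on S (\<lambda>x. g (f x))"
  using assms Ck_on_compose[of S T f _ g] by (simp add: smooth_on_def)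

lemma smooth_on_bounded_linear:
  assumes "bounded_linear L" "open S"
  shows "smooth_on S L"
proof -
  have "Ck_on k S L" for k
  proof (cases k)
    case 0
    then show ?thesis using linear_continuous_on[OF assms(1)] by simp
  next
    case (Suc k)
    show ?thesis unfolding Suc
      by (rule Ck_on_SucI[where f' = "\<lambda>x. L"])
        (auto intro: assms Ck_on_const bounded_linear_imp_has_derivative)
  qed
  then show ?thesis by (simp add: smooth_on_def assms)
qed

lemma smooth_on_imp_continuous_on: "smooth_on S f \<Longrightarrow> continuous_on S f"
  using Ck_on_imp_continuous_on[of 0 S f] by (auto simp: smooth_on_def)

lemma smooth_on_has_derivative:
  "smooth_on S f \<Longrightarrow> x \<in> S \<Longrightarrow> (f has_derivative frechet_derivative f (at x)) (at x)"
  using Ck_on_Suc_has_derivative[of 0 S f x] by (auto simp: smooth_on_def simp del: Ck_on.simps)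

lemma smooth_on_frechet_derivative:
  assumes "smooth_on S f" shows "smooth_on S (\<lambda>x. frechet_derivative f (at x) v)"
  unfolding smooth_on_def
proof (intro conjI allI)
  show "Ck_on k S (\<lambda>x. frechet_derivative f (at x) v)" for k
    using assms[unfolded smooth_on_def, THEN conjunct2, rule_format, of "Suc k"] by simp
qed (rule smooth_on_open[OF assms])

section \<open>Bump functions and Hadamard's lemma\<close>

text \<open>For \<open>k = 0\<close> this is the usual function that is flat at the origin. The
  factor \<open>1 / s ^ k\<close> makes the family closed under differentiation, so that smoothness
  follows by induction for all \<open>k\<close> at once.\<close>

definition flat_fun :: "nat \<Rightarrow> real \<Rightarrow> real" where
  "flat_fun k s = (if s > 0 then exp (- (1 / s)) / s ^ k else 0)"

text \<open>Substitute \<open>1/s\<close>: the exponential dominates every power at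
  infinity.\<close>

lemma flat_fun_tendsto_0: "(flat_fun k \<longlongrightarrow> 0) (at 0)"
proof -
  have "((\<lambda>x. x ^ k / exp x) \<longlongrightarrow> (0::real)) at_top"
    by (rule tendsto_power_div_exp_0)
  then have "((\<lambda>s. (1/s) ^ k / exp (1/s)) \<longlongrightarrow> (0::real)) (at_right 0)"
    using filterlim_compose filterlim_inverse_at_top_right by (auto simp: inverse_eq_divide)
  then have "(flat_fun k \<longlongrightarrow> 0) (at_right 0)"
  proof (rule Lim_transform_eventually)
    show "\<forall>\<^sub>F s in at_right 0. (1/s) ^ k / exp (1/s) = flat_fun k s"
      unfolding eventually_at_right_field
      by (rule exI[of _ 1]) (auto simp: flat_fun_def exp_minus field_simps)
  qed
  moreover have "(flat_fun k \<longlongrightarrow> 0) (at_left 0)"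
    by (rule tendsto_eventually) (auto simp: flat_fun_def eventually_at_left_field intro!: exI[of _ "-1"])
  ultimately show ?thesis by (simp add: filterlim_split_at_real)
qed

lemma flat_fun_has_derivative:
  "(flat_fun k has_real_derivative (flat_fun (k + 2) s - k * flat_fun (k + 1) s)) (at s)"
proof -
  consider "s > 0" | "s < 0" | "s = 0" by linarith
  then show ?thesis
  proof cases
    case 1
    have "((\<lambda>s. exp (- (1 / s)) / s ^ k) has_real_derivative
        (flat_fun (k + 2) s - k * flat_fun (k + 1) s)) (at s)"
      using 1 by (auto intro!: derivative_eq_intros)
        (cases k; auto simp: flat_fun_def field_simps power2_eq_square)
    then show ?thesis
      by (rule has_field_derivative_transform_within_open[where S = "{0<..}"])
        (use 1 in \<open>auto simp: flat_fun_def\<close>)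
  next
    case 2
    have "((\<lambda>s. 0) has_real_derivative 0) (at s)" by simp
    then have "(flat_fun k has_real_derivative 0) (at s)"
      by (rule has_field_derivative_transform_within_open[where S = "{..<0}"])
        (use 2 in \<open>auto simp: flat_fun_def\<close>)
    then show ?thesis using 2 by (simp add: flat_fun_def)
  next
    case 3
    \<comment> \<open>The difference quotient of \<open>flat_fun k\<close> at 0 is
      \<open>flat_fun (Suc k)\<close>.\<close>
    have "((\<lambda>h. (flat_fun k (0 + h) - flat_fun k 0) / h) \<longlongrightarrow> 0) (at 0)"
    proof (rule Lim_transform_eventually[OF flat_fun_tendsto_0[of "Suc k"]])
      show "\<forall>\<^sub>F h in at 0. flat_fun (Suc k) h = (flat_fun k (0 + h) - flat_fun k 0) / h"
        by (rule always_eventually) (auto simp: flat_fun_def)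
    qed
    then show ?thesis using 3 unfolding DERIV_def by (simp add: flat_fun_def)
  qed
qed

lemma smooth_flat_fun: "smooth_on UNIV (flat_fun k)"
proof -
  have "Ck_on j UNIV (flat_fun k)" for j
  proof (induction j arbitrary: k)
    case 0
    show ?case
      using flat_fun_has_derivative by (auto intro!: continuous_at_imp_continuous_on DERIV_isCont)
  next
    case (Suc j)
    show ?case
    proof (rule Ck_on_SucI[where f' = "\<lambda>s v. (flat_fun (k + 2) s + (- real k) * flat_fun (k + 1) s) * v"])
      show "(flat_fun k has_derivative
          (\<lambda>v. (flat_fun (k + 2) s + (- real k) * flat_fun (k + 1) s) * v)) (at s)" for s
        using flat_fun_has_derivative[of k s] by (simp add: has_field_derivative_def)
    qed (intro Ck_on_mult Ck_on_add Ck_on_const Suc open_UNIV)+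
  qed
  then show ?thesis by (simp add: smooth_on_def)
qed

lemma smooth_on_inner_self: "smooth_on UNIV (\<lambda>x::'a::euclidean_space. (x - c) \<bullet> (x - c))"
proof -
  have 1: "Ck_on k UNIV (\<lambda>x::'a. (x - c) \<bullet> w)" for k w
    using Ck_on_add[OF open_UNIV, of k "\<lambda>x. x \<bullet> w" "\<lambda>x. - (c \<bullet> w)"]
      smooth_on_bounded_linear[OF bounded_linear_inner_left[of w] open_UNIV]
      Ck_on_const[OF open_UNIV, of k "- (c \<bullet> w)"]
    by (simp add: smooth_on_def inner_diff_left)
  have "Ck_on k UNIV (\<lambda>x::'a. (x - c) \<bullet> (x - c))" for k
  proof -
    have "(\<lambda>x::'a. (x - c) \<bullet> (x - c)) = (\<lambda>x. \<Sum>b\<in>Basis. ((x - c) \<bullet> b) * ((x - c) \<bullet> b))"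
      by (rule ext, rule euclidean_inner)
    then show ?thesis by (auto intro!: Ck_on_sum Ck_on_mult 1)
  qed
  then show ?thesis by (simp add: smooth_on_def)
qed

text \<open>The argument of \<open>flat_fun 0\<close> is the squared radius minus the squared
  distance, positive exactly inside the ball; the constant factor normalises the value at the
  centre.\<close>

lemma smooth_bump_euclidean:
  fixes c :: "'a::euclidean_space"
  assumes "r > 0"
  obtains b :: "'a \<Rightarrow> real" where "smooth_on UNIV b" "b c = 1" "\<And>x. b x \<ge> 0"
    "\<And>x. r \<le> dist x c \<Longrightarrow> b x = 0"
proof -
  define b where "b x = inverse (flat_fun 0 (r\<^sup>2)) * flat_fun 0 (r\<^sup>2 + (- 1) * ((x - c) \<bullet> (x - c)))" for x
  have "smooth_on UNIV (\<lambda>x. r\<^sup>2 + (- 1) * ((x - c) \<bullet> (x - c)))"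
    by (intro smooth_on_add smooth_on_mult smooth_on_const smooth_on_inner_self open_UNIV)
  then have "smooth_on UNIV b" unfolding b_def
    by (intro smooth_on_mult smooth_on_const open_UNIV smooth_on_compose[OF _ smooth_flat_fun]) auto
  moreover have "b c = 1" using assms by (simp add: b_def flat_fun_def)
  moreover have "b x \<ge> 0" for x by (simp add: b_def flat_fun_def)
  moreover have "b x = 0" if "r \<le> dist x c" for x
    using power_mono[OF that, of 2] assms
    by (simp add: b_def flat_fun_def dist_norm power2_norm_eq_inner)
  ultimately show ?thesis using that by blast
qed

text \<open>The factor \<open>t ^ j\<close> makes the class of these integrals closed under differentiation.\<close>

lemma Ck_on_ray_integral:
  fixes f :: "'a::euclidean_space \<Rightarrow> real"
  assumes "r > 0"
  shows "Ck_on k (ball c r) f \<Longrightarrow>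
    Ck_on k (ball c r) (\<lambda>x. integral {0..1} (\<lambda>t. t ^ j * f (c + t *\<^sub>R (x - c))))"
proof (induction k arbitrary: f j)
  have seg: "c + t *\<^sub>R (x - c) \<in> ball c r" if "x \<in> ball c r" "t \<in> {0..1}" for x t
    using convexD_alt[OF convex_ball[of c r], of c x t] that assms by (auto simp: algebra_simps)
  have cont: "continuous_on (ball c r \<times> cbox 0 1) (\<lambda>(x, t). t ^ j *\<^sub>R g (c + t *\<^sub>R (x - c)))"
    if "continuous_on (ball c r) g" for g :: "'a \<Rightarrow> 'b::real_normed_vector" and j
    unfolding split_beta
    by (intro continuous_intros continuous_on_compose2[OF that]) (use seg in auto)
  {
    case 0
    show ?case
      using integral_continuous_on_param[OF cont, of f j] 0 by simp
  next
    case (Suc k)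
    \<comment> \<open>The Leibniz rule for parameter integrals asks for a derivative valued in
      bounded linear maps. \<open>D\<close> packages \<open>frechet_derivative f\<close> in this
      form, by its values on the basis, which also shows its continuity.\<close>
    define D where "D y = (\<Sum>b\<in>Basis. frechet_derivative f (at y) b *\<^sub>R blinfun_inner_left b)" for y
    have D: "blinfun_apply (D y) = frechet_derivative f (at y)" if "y \<in> ball c r" for y
    proof
      fix v
      have "blinfun_apply (D y) v = (\<Sum>b\<in>Basis. (v \<bullet> b) *\<^sub>R frechet_derivative f (at y) b)"
        by (simp add: D_def blinfun.sum_left blinfun.scaleR_left inner_commute mult.commute)
      then show "blinfun_apply (D y) v = frechet_derivative f (at y) v"
        by (subst linear_expand_Basis[OF has_derivative_linear[OF
            Ck_on_Suc_has_derivative[OF Suc.prems that]], of v])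
    qed
    have cD: "continuous_on (ball c r) D"
      unfolding D_def using Suc.prems by (auto intro!: continuous_intros Ck_on_imp_continuous_on[of k])
    let ?F = "\<lambda>x. integral {0..1} (\<lambda>t. t ^ j * f (c + t *\<^sub>R (x - c)))"
    let ?D = "\<lambda>x t. t ^ Suc j *\<^sub>R D (c + t *\<^sub>R (x - c))"
    show ?case
    proof (rule Ck_on_SucI[where f' = "\<lambda>x v. integral {0..1}
        (\<lambda>t. t ^ Suc j * frechet_derivative f (at (c + t *\<^sub>R (x - c))) v)"])
      fix x assume x: "x \<in> ball c r"
      have "(?F has_derivative integral (cbox 0 1) (?D x)) (at x within ball c r)"
        unfolding cbox_interval[symmetric]
      proof (rule leibniz_rule[OF _ _ cont[OF cD] x convex_ball])
        fix x' t assume *: "x' \<in> ball c r" "t \<in> cbox 0 (1::real)"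
        then have "c + t *\<^sub>R (x' - c) \<in> ball c r" using seg by auto
        note fd = Ck_on_Suc_has_derivative[OF Suc.prems this]
        have ray: "((\<lambda>x. c + t *\<^sub>R (x - c)) has_derivative (\<lambda>v. t *\<^sub>R v)) (at x' within ball c r)"
          by (auto intro!: derivative_eq_intros)
        have "((\<lambda>x. t ^ j * f (c + t *\<^sub>R (x - c))) has_derivative
            (\<lambda>v. t ^ j * frechet_derivative f (at (c + t *\<^sub>R (x' - c))) (t *\<^sub>R v)))
            (at x' within ball c r)"
          by (rule has_derivative_mult_right[OF has_derivative_compose[OF ray fd]])
        also have "(\<lambda>v. t ^ j * frechet_derivative f (at (c + t *\<^sub>R (x' - c))) (t *\<^sub>R v)) =
            blinfun_apply (?D x' t)"
          using seg[OF *[unfolded cbox_interval]]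
          by (simp add: D[symmetric] blinfun.bilinear_simps fun_eq_iff mult_ac)
        finally show "((\<lambda>x. t ^ j * f (c + t *\<^sub>R (x - c))) has_derivative blinfun_apply (?D x' t))
            (at x' within ball c r)" .
      next
        fix x' assume "x' \<in> ball c r"
        then show "(\<lambda>t. t ^ j * f (c + t *\<^sub>R (x' - c))) integrable_on cbox 0 1"
          by (intro integrable_continuous continuous_intros continuous_on_compose2[OF
                Ck_on_imp_continuous_on[OF Suc.prems]])
            (use seg in auto)
      qed
      moreover have "blinfun_apply (integral (cbox 0 1) (?D x)) = (\<lambda>v. integral {0..1}
          (\<lambda>t. t ^ Suc j * frechet_derivative f (at (c + t *\<^sub>R (x - c))) v))"
      proof
        fix v
        have "?D x integrable_on cbox 0 1"
          by (intro integrable_continuous continuous_intros continuous_on_compose2[OF cD])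
            (use seg x in auto)
        then have "blinfun_apply (integral (cbox 0 1) (?D x)) v =
            integral (cbox 0 1) ((\<lambda>L. blinfun_apply L v) \<circ> ?D x)"
          by (intro integral_linear[symmetric] bounded_linear_intros) auto
        also have "\<dots> = integral {0..1}
          (\<lambda>t. t ^ Suc j * frechet_derivative f (at (c + t *\<^sub>R (x - c))) v)"
          unfolding cbox_interval
          by (rule integral_cong)
            (use seg x in \<open>simp add: D[symmetric] blinfun.bilinear_simps\<close>)
        finally show "blinfun_apply (integral (cbox 0 1) (?D x)) v = integral {0..1}
          (\<lambda>t. t ^ Suc j * frechet_derivative f (at (c + t *\<^sub>R (x - c))) v)" .
      qed
      ultimately show "(?F has_derivative (\<lambda>v. integral {0..1}
          (\<lambda>t. t ^ Suc j * frechet_derivative f (at (c + t *\<^sub>R (x - c))) v))) (at x)"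
        by (simp only: at_within_open[OF x open_ball])
    next
      show "Ck_on k (ball c r) (\<lambda>x. integral {0..1}
          (\<lambda>t. t ^ Suc j * frechet_derivative f (at (c + t *\<^sub>R (x - c))) v))" for v
        by (rule Suc.IH) (use Suc.prems in simp)
    qed simp
  }
qed

text \<open>The fundamental theorem of calculus along the segment from \<open>c\<close> to
  \<open>x\<close>: \<open>h b\<close> is the average over the segment of the partial derivative in
  the direction \<open>b\<close>. At \<open>x = c\<close> the integrand is constant.\<close>

lemma hadamard_lemma:
  fixes f :: "'a::euclidean_space \<Rightarrow> real"
  assumes "r > 0" "smooth_on (ball c r) f"
  obtains h where "\<And>b. b \<in> Basis \<Longrightarrow> smooth_on (ball c r) (h b)"
    "\<And>b. h b c = frechet_derivative f (at c) b"
    "\<And>x. x \<in> ball c r \<Longrightarrow> f x = f c + (\<Sum>b\<in>Basis. ((x - c) \<bullet> b) * h b x)"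
proof -
  \<comment> \<open>The factor \<open>t ^ 0\<close> only gives the integral the shape of
    \<open>Ck_on_ray_integral\<close> with \<open>j = 0\<close>.\<close>
  define h where "h b x = integral {0..1} (\<lambda>t. t ^ 0 * frechet_derivative f (at (c + t *\<^sub>R (x - c))) b)" for b x
  have "smooth_on (ball c r) (h b)" for b
    unfolding h_def smooth_on_def
  proof (intro conjI allI Ck_on_ray_integral[OF assms(1)])
    show "Ck_on k (ball c r) (\<lambda>x. frechet_derivative f (at x) b)" for k
      using smooth_on_frechet_derivative[OF assms(2), of b] by (simp add: smooth_on_def)
  qed simp
  moreover have "h b c = frechet_derivative f (at c) b" for b
    by (simp add: h_def)
  moreover have "f x = f c + (\<Sum>b\<in>Basis. ((x - c) \<bullet> b) * h b x)" if x: "x \<in> ball c r" for x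
  proof -
    have seg: "c + t *\<^sub>R (x - c) \<in> ball c r" if "t \<in> {0..1}" for t
      using convexD_alt[OF convex_ball[of c r], of c x t] that x assms by (auto simp: algebra_simps)
    let ?D = "\<lambda>t. frechet_derivative f (at (c + t *\<^sub>R (x - c)))"
    have fd: "(f has_derivative ?D t) (at (c + t *\<^sub>R (x - c)))" if "t \<in> {0..1}" for t
      by (rule smooth_on_has_derivative[OF assms(2) seg[OF that]])
    have "((\<lambda>t. ?D t (x - c)) has_integral (f (c + 1 *\<^sub>R (x - c)) - f (c + 0 *\<^sub>R (x - c)))) {0..1}"
    proof (rule fundamental_theorem_of_calculus)
      fix t assume t: "t \<in> {0..1::real}"
      have ray: "((\<lambda>t. c + t *\<^sub>R (x - c)) has_derivative (\<lambda>s. s *\<^sub>R (x - c))) (at t within {0..1})"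
        by (auto intro!: derivative_eq_intros)
      have "((\<lambda>t. f (c + t *\<^sub>R (x - c))) has_derivative (\<lambda>s. ?D t (s *\<^sub>R (x - c)))) (at t within {0..1})"
        by (rule has_derivative_compose[OF ray fd[OF t]])
      then show "((\<lambda>t. f (c + t *\<^sub>R (x - c))) has_vector_derivative ?D t (x - c)) (at t within {0..1})"
        using linear_cmul[OF has_derivative_linear[OF fd[OF t]]]
        by (simp add: has_vector_derivative_def)
    qed simp
    then have "f x - f c = integral {0..1} (\<lambda>t. ?D t (x - c))"
      by (simp add: integral_unique)
    also have "\<dots> = integral {0..1} (\<lambda>t. \<Sum>b\<in>Basis. ((x - c) \<bullet> b) *\<^sub>R ?D t b)"
      by (rule integral_cong, rule linear_expand_Basis[OF has_derivative_linear[OF fd]])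
    also have "\<dots> = (\<Sum>b\<in>Basis. ((x - c) \<bullet> b) * h b x)"
    proof -
      have "(\<lambda>t. ?D t b) integrable_on {0..1}" for b
        by (intro integrable_continuous_interval
            continuous_on_compose2[OF smooth_on_imp_continuous_on[OF
              smooth_on_frechet_derivative[OF assms(2)]]] continuous_intros) (use seg in auto)
      then show ?thesis
        by (subst integral_sum) (auto simp: h_def intro!: integrable_on_mult_right)
    qed
    finally show ?thesis by simp
  qed
  ultimately show ?thesis using that by blast
qed

section \<open>Smooth functions on manifolds\<close>

lemma compact_closure_subset:
  assumes "compact K" "closure S \<subseteq> K"
  shows "compact (closure S)"
  using compact_Int_closed[OF assms(1) closed_closure[of S]] assms(2) by (simp add: inf.absorb2)

locale smooth_manifold =
  fixes A :: "('x::t2_space, 'e::euclidean_space) chart set"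
  assumes atlas: "smooth_atlas A"
begin

lemma chart:
  assumes "(U, \<phi>) \<in> A"
  shows chart_open: "open U" and chart_inj: "inj_on \<phi> U"
    and chart_image_open: "open (\<phi> ` U)"
    and chart_cont: "continuous_on U \<phi>"
    and chart_inv_cont: "continuous_on (\<phi> ` U) (inv_into U \<phi>)"
  using assms atlas by (auto simp: smooth_atlas_def is_chart_def homeomorphism_def)

lemma chart_inv [simp]: "(U, \<phi>) \<in> A \<Longrightarrow> x \<in> U \<Longrightarrow> inv_into U \<phi> (\<phi> x) = x"
  using chart_inj by (rule inv_into_f_f)

lemma chart_open_image:
  assumes "(U, \<phi>) \<in> A" "open N" "N \<subseteq> U"
  shows "open (\<phi> ` N)"
proof -
  have "\<phi> ` N = \<phi> ` U \<inter> inv_into U \<phi> -` N"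
    using assms chart_inv[OF assms(1)] by force
  then show ?thesis
    using continuous_on_open_vimage[OF chart_image_open] chart_inv_cont assms
    by (metis Int_commute)
qed

lemma chart_at: obtains U \<phi> where "(U, \<phi>) \<in> A" "x \<in> U"
proof -
  have "x \<in> (\<Union>(U, \<phi>)\<in>A. U)" using atlas by (simp add: smooth_atlas_def)
  then show ?thesis by (auto intro: that)
qed

lemma transition_smooth:
  assumes U: "(U, \<phi>) \<in> A" and V: "(V, \<psi>) \<in> A"
  shows "smooth_on (\<phi> ` (U \<inter> V)) (\<lambda>x. \<psi> (inv_into U \<phi> x))"
proof -
  have "\<forall>(U, \<phi>)\<in>A. \<forall>(V, \<psi>)\<in>A. smooth_on (\<phi> ` (U \<inter> V)) (\<psi> \<circ> inv_into U \<phi>)"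
    using atlas by (simp add: smooth_atlas_def)
  from bspec[OF this U] have "\<forall>(V, \<psi>)\<in>A. smooth_on (\<phi> ` (U \<inter> V)) (\<psi> \<circ> inv_into U \<phi>)" by simp
  from bspec[OF this V] show ?thesis by (simp add: comp_def)
qed

lemma smooth_functions_chart:
  assumes "u \<in> smooth_functions A" and U: "(U, \<phi>) \<in> A"
  shows "smooth_on (\<phi> ` U) (\<lambda>x. u (inv_into U \<phi> x))"
proof -
  have "\<forall>(U, \<phi>)\<in>A. smooth_on (\<phi> ` U) (\<lambda>x. u (inv_into U \<phi> x))"
    using assms(1) by (simp add: smooth_functions_def smooth_map_def comp_def)
  from bspec[OF this U] show ?thesis by simp
qed

lemma smooth_functions_cont: "u \<in> smooth_functions A \<Longrightarrow> continuous_on UNIV u"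
  by (simp add: smooth_functions_def smooth_map_def)

text \<open>One chart near each point is enough, because transition maps are smooth: any other chart
  expression is locally the given one composed with a transition map. Global continuity is obtained
  from the same local data.\<close>

lemma smooth_functionsI:
  assumes "\<And>x. \<exists>U \<phi> N. (U, \<phi>) \<in> A \<and> open N \<and> x \<in> N \<and> N \<subseteq> U \<and>
    smooth_on (\<phi> ` N) (\<lambda>y. u (inv_into U \<phi> y))"
  shows "u \<in> smooth_functions A"
proof -
  have "isCont u x" for x
  proof -
    obtain U \<phi> N where *: "(U, \<phi>) \<in> A" "open N" "x \<in> N" "N \<subseteq> U"
      "smooth_on (\<phi> ` N) (\<lambda>y. u (inv_into U \<phi> y))" using assms by blast
    have "continuous_on N (\<lambda>z. u (inv_into U \<phi> (\<phi> z)))"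
      by (rule continuous_on_compose2[OF smooth_on_imp_continuous_on[OF *(5)]
            continuous_on_subset[OF chart_cont[OF *(1)] *(4)]]) auto
    then have "continuous_on N u"
      by (rule continuous_on_eq) (use * in auto)
    then show ?thesis
      using * continuous_on_eq_continuous_at by blast
  qed
  moreover have "smooth_on (\<psi> ` V) (\<lambda>y. u (inv_into V \<psi> y))" if V: "(V, \<psi>) \<in> A" for V \<psi>
  proof (rule smooth_on_local[OF chart_image_open[OF V]])
    fix y assume "y \<in> \<psi> ` V"
    then obtain x where x: "x \<in> V" "y = \<psi> x" by auto
    obtain U \<phi> N where *: "(U, \<phi>) \<in> A" "open N" "x \<in> N" "N \<subseteq> U"
      "smooth_on (\<phi> ` N) (\<lambda>y. u (inv_into U \<phi> y))" using assms by blast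
    have o: "open (\<psi> ` (V \<inter> N))"
      using V * by (intro chart_open_image) (auto intro: chart_open)
    have "smooth_on (\<psi> ` (V \<inter> N)) (\<lambda>y. u (inv_into U \<phi> (\<phi> (inv_into V \<psi> y))))"
    proof (rule smooth_on_compose[OF _ *(5)])
      show "smooth_on (\<psi> ` (V \<inter> N)) (\<lambda>y. \<phi> (inv_into V \<psi> y))"
        by (rule smooth_on_subset[OF transition_smooth[OF V *(1)] o]) (use * in auto)
    qed (use V in auto)
    then have "smooth_on (\<psi> ` (V \<inter> N)) (\<lambda>y. u (inv_into V \<psi> y))"
      by (rule smooth_on_cong[THEN iffD1, rotated]) (use V * in auto)
    then show "\<exists>T. y \<in> T \<and> smooth_on T (\<lambda>y. u (inv_into V \<psi> y))"
      using x * by (intro exI[of _ "\<psi> ` (V \<inter> N)"]) simp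
  qed
  ultimately show ?thesis
    by (auto simp: smooth_functions_def smooth_map_def comp_def continuous_at_imp_continuous_on)
qed

lemma smooth_functionsI_chart:
  assumes "\<And>U \<phi>. (U, \<phi>) \<in> A \<Longrightarrow> smooth_on (\<phi> ` U) (\<lambda>y. u (inv_into U \<phi> y))"
  shows "u \<in> smooth_functions A"
  by (rule smooth_functionsI) (metis assms chart_at chart_open subset_refl)

lemma smooth_functions_const: "(\<lambda>x. c) \<in> smooth_functions A"
  by (auto intro!: smooth_functionsI_chart smooth_on_const chart_image_open)

lemma smooth_functions_add:
  "u \<in> smooth_functions A \<Longrightarrow> v \<in> smooth_functions A \<Longrightarrow> (\<lambda>x. u x + v x) \<in> smooth_functions A"
  by (intro smooth_functionsI_chart smooth_on_add) (auto intro: smooth_functions_chart)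

lemma smooth_functions_mult:
  "u \<in> smooth_functions A \<Longrightarrow> v \<in> smooth_functions A \<Longrightarrow> (\<lambda>x. u x * v x) \<in> smooth_functions A"
  by (intro smooth_functionsI_chart smooth_on_mult) (auto intro: smooth_functions_chart)

lemma smooth_functions_sum:
  "(\<And>i. i \<in> I \<Longrightarrow> u i \<in> smooth_functions A) \<Longrightarrow> (\<lambda>x. \<Sum>i\<in>I. u i x) \<in> smooth_functions A"
  by (induction I rule: infinite_finite_induct)
    (auto intro: smooth_functions_const smooth_functions_add)

lemma test_functions_smooth: "u \<in> test_functions A \<Omega> \<Longrightarrow> u \<in> smooth_functions A"
  by (simp add: test_functions_def)

section \<open>Test functions: supports, extension by zero, bump functions\<close>

lemma test_functions_support_subset:
  assumes "u \<in> test_functions A \<Omega>" "v \<in> smooth_functions A"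
    "{x. v x \<noteq> 0} \<subseteq> closure {x. u x \<noteq> 0}"
  shows "v \<in> test_functions A \<Omega>"
proof -
  have "closure {x. v x \<noteq> 0} \<subseteq> closure {x. u x \<noteq> 0}"
    using assms(3) by (simp add: closure_minimal)
  moreover from this have "compact (closure {x. v x \<noteq> 0})"
    by (rule compact_closure_subset[rotated]) (use assms(1) in \<open>simp add: test_functions_def\<close>)
  ultimately show ?thesis using assms by (auto simp: test_functions_def)
qed

lemma test_functions_mult:
  assumes "u \<in> test_functions A \<Omega>" "v \<in> smooth_functions A"
  shows "(\<lambda>x. u x * v x) \<in> test_functions A \<Omega>"
  by (rule test_functions_support_subset[OF assms(1)])
    (use assms closure_subset[of "{x. u x \<noteq> 0}"] in
      \<open>auto intro!: smooth_functions_mult intro: test_functions_smooth\<close>)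

lemma test_functions_extend:
  assumes U: "(U, \<phi>) \<in> A" and K: "compact K" "K \<subseteq> \<phi> ` U" and k: "smooth_on (\<phi> ` U) k"
    and zero: "\<And>y. y \<notin> K \<Longrightarrow> k y = 0"
  shows "(\<lambda>x. if x \<in> U then k (\<phi> x) else 0) \<in> test_functions A (inv_into U \<phi> ` K)"
    (is "?u \<in> _")
proof -
  let ?K = "inv_into U \<phi> ` K"
  have cK: "compact ?K"
    using compact_continuous_image[OF continuous_on_subset[OF chart_inv_cont[OF U] K(2)] K(1)] .
  have sub: "{x. ?u x \<noteq> 0} \<subseteq> ?K"
  proof
    fix x assume "x \<in> {x. ?u x \<noteq> 0}"
    then have "x \<in> U" "\<phi> x \<in> K" using zero by (auto split: if_splits)
    then show "x \<in> ?K" using chart_inv[OF U \<open>x \<in> U\<close>] by (metis imageI)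
  qed
  then have "closure {x. ?u x \<noteq> 0} \<subseteq> ?K"
    using cK compact_imp_closed closure_minimal by blast
  moreover from this have "compact (closure {x. ?u x \<noteq> 0})"
    using cK by (rule compact_closure_subset[rotated])
  moreover have "?u \<in> smooth_functions A"
  proof (rule smooth_functionsI)
    fix x
    show "\<exists>V \<psi> N. (V, \<psi>) \<in> A \<and> open N \<and> x \<in> N \<and> N \<subseteq> V \<and> smooth_on (\<psi> ` N) (\<lambda>y. ?u (inv_into V \<psi> y))"
    proof (cases "x \<in> U")
      case True
      have "smooth_on (\<phi> ` U) (\<lambda>y. ?u (inv_into U \<phi> y))"
        by (rule smooth_on_cong[THEN iffD1, OF _ k]) (use U in auto)
      then show ?thesis using U True chart_open[OF U]
        by (intro exI[of _ U] exI[of _ \<phi>] conjI) simp_all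
    next
      case False
      obtain V \<psi> where V: "(V, \<psi>) \<in> A" "x \<in> V" by (rule chart_at)
      have "?K \<subseteq> U" using K by (auto intro: inv_into_into)
      then have x: "x \<in> V - ?K" using False V by auto
      have o: "open (V - ?K)" using V chart_open cK compact_imp_closed by blast
      have "smooth_on (\<psi> ` (V - ?K)) (\<lambda>y. ?u (inv_into V \<psi> y))"
      proof (rule smooth_on_cong[THEN iffD1, OF _ smooth_on_const[of _ 0]])
        show "open (\<psi> ` (V - ?K))" using V o by (intro chart_open_image) auto
        fix y assume "y \<in> \<psi> ` (V - ?K)"
        then obtain z where z: "z \<in> V - ?K" "y = \<psi> z" by auto
        then have "?u z = 0" using sub by blast
        moreover have "inv_into V \<psi> y = z" using z V by simp
        ultimately show "0 = ?u (inv_into V \<psi> y)" by (simp split: if_splits)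
      qed
      then show ?thesis using V o x
        by (intro exI[of _ V] exI[of _ \<psi>] exI[of _ "V - ?K"] conjI) simp_all
    qed
  qed
  ultimately show ?thesis by (simp add: test_functions_def)
qed

lemma test_functions_mono: "u \<in> test_functions A \<Omega> \<Longrightarrow> \<Omega> \<subseteq> \<Omega>' \<Longrightarrow> u \<in> test_functions A \<Omega>'"
  by (auto simp: test_functions_def)

lemma bump_function:
  assumes "open \<Omega>" "x \<in> \<Omega>"
  obtains b where "b \<in> test_functions A \<Omega>" "b x = 1" "\<And>y. b y \<ge> 0"
proof -
  obtain U \<phi> where U: "(U, \<phi>) \<in> A" "x \<in> U" by (rule chart_at)
  have "open (\<phi> ` (U \<inter> \<Omega>))" using assms U by (intro chart_open_image) (auto intro: chart_open)
  then obtain r where r: "r > 0" "cball (\<phi> x) r \<subseteq> \<phi> ` (U \<inter> \<Omega>)"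
    using assms U open_contains_cball by (metis IntI imageI)
  obtain k :: "'e \<Rightarrow> real" where k: "smooth_on UNIV k" "k (\<phi> x) = 1" "\<And>y. k y \<ge> 0"
    "\<And>y. r \<le> dist y (\<phi> x) \<Longrightarrow> k y = 0"
    using smooth_bump_euclidean[OF r(1)] by metis
  let ?u = "\<lambda>x. if x \<in> U then k (\<phi> x) else 0"
  have "?u \<in> test_functions A (inv_into U \<phi> ` cball (\<phi> x) r)"
    by (rule test_functions_extend)
      (use U r k in \<open>auto intro: smooth_on_subset[OF k(1)] chart_image_open simp: dist_commute\<close>)
  moreover have "inv_into U \<phi> ` cball (\<phi> x) r \<subseteq> \<Omega>" using r U by force
  ultimately have "?u \<in> test_functions A \<Omega>" by (rule test_functions_mono)
  then show ?thesis using that[of ?u] U k by simp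
qed

section \<open>Vector fields\<close>

lemma vector_field_smooth: "vector_field A X \<Longrightarrow> u \<in> smooth_functions A \<Longrightarrow> X u \<in> smooth_functions A"
  by (simp add: vector_field_def)

lemma vector_field_mult:
  "vector_field A X \<Longrightarrow> u \<in> smooth_functions A \<Longrightarrow> v \<in> smooth_functions A \<Longrightarrow>
    X (\<lambda>x. u x * v x) = (\<lambda>x. u x * X v x + v x * X u x)"
  by (simp add: vector_field_def)

lemma vector_field_add:
  "vector_field A X \<Longrightarrow> u \<in> smooth_functions A \<Longrightarrow> v \<in> smooth_functions A \<Longrightarrow>
    X (\<lambda>x. u x + v x) = (\<lambda>x. X u x + X v x)"
  by (simp add: vector_field_def)

lemma vector_field_cmult:
  "vector_field A X \<Longrightarrow> u \<in> smooth_functions A \<Longrightarrow> X (\<lambda>x. c * u x) = (\<lambda>x. c * X u x)"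
  by (simp add: vector_field_def)

text \<open>The Leibniz rule for \<open>1 * 1\<close> gives \<open>X 1 = 2 * X 1\<close>.\<close>

lemma vector_field_const:
  assumes "vector_field A X" shows "X (\<lambda>x. c) = (\<lambda>x. 0)"
proof -
  have "X (\<lambda>x. 1 * 1) = (\<lambda>x. 1 * X (\<lambda>x. 1) x + 1 * X (\<lambda>x. 1) x)"
    by (rule vector_field_mult[OF assms]) (rule smooth_functions_const)+
  then have "X (\<lambda>x. 1) = (\<lambda>x. 0)" by (auto simp: fun_eq_iff)
  then show ?thesis
    using vector_field_cmult[OF assms smooth_functions_const[of 1], of c] by simp
qed

lemma vector_field_sum:
  assumes "vector_field A X"
  shows "(\<And>i. i \<in> I \<Longrightarrow> u i \<in> smooth_functions A) \<Longrightarrow>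
    X (\<lambda>x. \<Sum>i\<in>I. u i x) = (\<lambda>x. \<Sum>i\<in>I. X (u i) x)"
proof (induction I rule: infinite_finite_induct)
  case (insert i I)
  then show ?case
    using vector_field_add[OF assms, of "u i" "\<lambda>x. \<Sum>i\<in>I. u i x"] smooth_functions_sum[of I u]
    by simp
qed (simp_all add: vector_field_const[OF assms])

text \<open>Derivations are local: for a bump \<open>b\<close> at \<open>x\<close> supported off the
  support of \<open>u\<close>, the product \<open>b u\<close> vanishes, and the Leibniz rule at
  \<open>x\<close> leaves \<open>b x * X u x = 0\<close>.\<close>

lemma vector_field_support:
  assumes "vector_field A X" "u \<in> smooth_functions A"
  shows "{x. X u x \<noteq> 0} \<subseteq> closure {x. u x \<noteq> 0}"
proof (rule subsetI, rule ccontr)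
  fix x assume x: "x \<in> {x. X u x \<noteq> 0}" "x \<notin> closure {x. u x \<noteq> 0}"
  obtain b where b: "b \<in> test_functions A (- closure {x. u x \<noteq> 0})" "b x = 1"
    using bump_function[of "- closure {x. u x \<noteq> 0}" x] x by auto
  have "b y * u y = 0" for y
    using b(1) closure_subset[of "{x. u x \<noteq> 0}"] closure_subset[of "{x. b x \<noteq> 0}"]
    by (auto simp: test_functions_def)
  then have "X (\<lambda>y. b y * u y) = (\<lambda>y. 0)"
    using vector_field_const[OF assms(1), of 0] by presburger
  then have "b x * X u x + u x * X b x = 0"
    using vector_field_mult[OF assms(1) test_functions_smooth[OF b(1)] assms(2)]
    by (simp add: fun_eq_iff)
  moreover have "u x = 0" using x closure_subset[of "{x. u x \<noteq> 0}"] by auto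
  ultimately show False using x b by simp
qed

lemma vector_field_test:
  assumes "vector_field A X" "u \<in> test_functions A \<Omega>"
  shows "X u \<in> test_functions A \<Omega>"
  using test_functions_support_subset[OF assms(2)
      vector_field_smooth[OF assms(1) test_functions_smooth[OF assms(2)]]
      vector_field_support[OF assms(1) test_functions_smooth[OF assms(2)]]] .

text \<open>
  Multiplying Hadamard's expansion of \<open>u\<close> at \<open>c = \<phi> x\<close> by the square of a bump function \<open>b\<close>
  gives a global identity \<open>b\<^sup>2 (u - u x) = \<Sum> \<xi>\<^sub>i \<eta>\<^sub>i\<close> of smooth functions to which the
  derivation can be applied.
\<close>

lemma vector_field_eq_directional_derivative:
  assumes X: "vector_field A X" and U: "(U, \<phi>) \<in> A" "x \<in> U"
  obtains w where "\<And>u. u \<in> smooth_functions A \<Longrightarrow>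
    X u x = frechet_derivative (\<lambda>y. u (inv_into U \<phi> y)) (at (\<phi> x)) w"
proof -
  define c where "c = \<phi> x"
  obtain r where r: "r > 0" "ball c r \<subseteq> \<phi> ` U"
    using chart_image_open[OF U(1)] U(2) by (metis c_def imageI open_contains_ball)
  obtain k :: "'e \<Rightarrow> real" where k: "smooth_on UNIV k" "k c = 1"
    "\<And>y. r / 2 \<le> dist y c \<Longrightarrow> k y = 0"
    using smooth_bump_euclidean[of "r / 2" c] r(1) by (metis half_gt_zero)
  \<comment> \<open>As \<open>k\<close> vanishes beyond radius \<open>r / 2\<close>, the function
    \<open>h\<close> need only be smooth on the ball of radius \<open>r\<close>.\<close>
  define ext where "ext h = (\<lambda>x. if x \<in> U then k (\<phi> x) * h (\<phi> x) else 0)" for h :: "'e \<Rightarrow> real"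
  have ext: "ext h \<in> smooth_functions A" if "smooth_on (ball c r) h" for h
  proof -
    have "smooth_on (\<phi> ` U) (\<lambda>y. k y * h y)"
    proof (rule smooth_on_local[OF chart_image_open[OF U(1)]])
      fix y assume "y \<in> \<phi> ` U"
      show "\<exists>T. y \<in> T \<and> smooth_on T (\<lambda>y. k y * h y)"
      proof (cases "y \<in> ball c r")
        case True
        then show ?thesis
          by (intro exI[of _ "ball c r"] conjI smooth_on_mult that smooth_on_subset[OF k(1)]) auto
      next
        case False
        have "smooth_on (- cball c (r/2)) (\<lambda>y. k y * h y)"
          by (rule smooth_on_cong[THEN iffD1, OF _ smooth_on_const[of _ 0]])
            (use k(3) in \<open>auto simp: dist_commute not_le\<close>)
        moreover have "y \<in> - cball c (r/2)" using False r(1) by auto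
        ultimately show ?thesis by blast
      qed
    qed
    moreover have "cball c (r/2) \<subseteq> \<phi> ` U" using r by (auto intro!: subsetD[OF r(2)])
    ultimately show ?thesis
      unfolding ext_def
      by (intro test_functions_smooth[OF test_functions_extend[OF U(1) compact_cball[of c "r/2"]]])
        (use k(3) in \<open>auto simp: dist_commute\<close>)
  qed
  \<comment> \<open>The components of \<open>w\<close> are the values of the derivation on the
    cut-off coordinate functions.\<close>
  define w where "w = (\<Sum>b\<in>Basis. X (ext (\<lambda>y. (y - c) \<bullet> b)) x *\<^sub>R b)"
  have coord: "smooth_on (ball c r) (\<lambda>y. (y - c) \<bullet> b)" for b
    using smooth_on_add[OF smooth_on_bounded_linear[OF bounded_linear_inner_left[of b] open_ball[of c r]]
        smooth_on_const[OF open_ball, where c = "- (c \<bullet> b)"]] by (simp add: inner_diff_left)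
  have extx: "ext h x = h c" for h
    using U k by (simp add: ext_def c_def)
  have "X u x = frechet_derivative (\<lambda>y. u (inv_into U \<phi> y)) (at (\<phi> x)) w"
    if u: "u \<in> smooth_functions A" for u
  proof -
    let ?f = "\<lambda>y. u (inv_into U \<phi> y)"
    have f: "smooth_on (ball c r) ?f"
      by (rule smooth_on_subset[OF smooth_functions_chart[OF u U(1)]]) (use r in auto)
    obtain h where h: "\<And>b. b \<in> Basis \<Longrightarrow> smooth_on (ball c r) (h b)"
      "\<And>b. h b c = frechet_derivative ?f (at c) b"
      "\<And>y. y \<in> ball c r \<Longrightarrow> ?f y = ?f c + (\<Sum>b\<in>Basis. ((y - c) \<bullet> b) * h b y)"
    proof (rule hadamard_lemma[OF r(1) f], goal_cases)
      case (1 h)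
      show ?thesis by (rule 1(1)[of h]) (fact 1(2-4))+
    qed
    let ?\<xi> = "\<lambda>b. ext (\<lambda>y. (y - c) \<bullet> b)" and ?k = "ext (\<lambda>y. 1)"
    have k1: "?k \<in> smooth_functions A" by (intro ext smooth_on_const) simp
    have \<xi>: "?\<xi> b \<in> smooth_functions A" for b by (rule ext[OF coord])
    have \<eta>: "ext (h b) \<in> smooth_functions A" if "b \<in> Basis" for b by (rule ext[OF h(1)[OF that]])
    have u': "(\<lambda>z. u z + - u x) \<in> smooth_functions A"
      by (intro smooth_functions_add u smooth_functions_const)
    have id: "(\<lambda>z. (?k z * ?k z) * (u z + - u x)) = (\<lambda>z. \<Sum>b\<in>Basis. ?\<xi> b z * ext (h b) z)"
    proof
      fix z
      show "(?k z * ?k z) * (u z + - u x) = (\<Sum>b\<in>Basis. ?\<xi> b z * ext (h b) z)"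
      proof (cases "z \<in> U \<and> \<phi> z \<in> ball c r")
        case True
        then have "u z = u x + (\<Sum>b\<in>Basis. ((\<phi> z - c) \<bullet> b) * h b (\<phi> z))"
          using h(3)[of "\<phi> z"] U by (simp add: c_def)
        then show ?thesis using True
          by (simp add: ext_def sum_distrib_left mult_ac)
      next
        case False
        then have "z \<in> U \<Longrightarrow> k (\<phi> z) = 0" using k(3)[of "\<phi> z"] r(1) by (auto simp: dist_commute)
        then show ?thesis by (auto simp: ext_def)
      qed
    qed
    \<comment> \<open>At \<open>x\<close> the bump is 1 and \<open>u - u x\<close> vanishes, so the
      term in which \<open>X\<close> falls on the bump disappears.\<close>
    have "X (\<lambda>z. (?k z * ?k z) * (u z + - u x)) x = X u x"
      using vector_field_mult[OF X smooth_functions_mult[OF k1 k1] u']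
        vector_field_add[OF X u smooth_functions_const[of "- u x"]] vector_field_const[OF X]
      by (simp add: extx)
    moreover have "X (\<lambda>z. \<Sum>b\<in>Basis. ?\<xi> b z * ext (h b) z) x =
        (\<Sum>b\<in>Basis. X (\<lambda>z. ?\<xi> b z * ext (h b) z) x)"
      by (subst vector_field_sum[OF X]) (auto intro: smooth_functions_mult \<xi> \<eta>)
    moreover have "X (\<lambda>z. ?\<xi> b z * ext (h b) z) x = frechet_derivative ?f (at c) b * X (?\<xi> b) x"
      if "b \<in> Basis" for b
      by (subst vector_field_mult[OF X \<xi> \<eta>[OF that]]) (simp add: extx h(2))
    ultimately have "X u x = (\<Sum>b\<in>Basis. frechet_derivative ?f (at c) b * X (?\<xi> b) x)"
      using id by simp
    also have "\<dots> = frechet_derivative ?f (at c) w"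
    proof -
      have "linear (frechet_derivative ?f (at c))"
        by (rule has_derivative_linear[OF smooth_on_has_derivative[OF f]]) (use r in auto)
      then show ?thesis
        by (simp add: w_def linear_sum linear_cmul mult.commute)
    qed
    finally show ?thesis by (simp add: c_def)
  qed
  then show ?thesis using that by blast
qed

end

section \<open>Lie groups\<close>

locale lie_grp =
  fixes G :: "'g::{second_countable_topology, t2_space} monoid" (structure)
    and A :: "('g, 'e::euclidean_space) chart set"
  assumes lie: "lie_group G A"
begin

sublocale group G
  using lie by (simp add: lie_group_def)

sublocale smooth_manifold A
  using lie by unfold_locales (simp add: lie_group_def)

lemma carrier_UNIV [simp]: "carrier G = UNIV"
  using lie by (simp add: lie_group_def)

lemma inv_cancel [simp]: "inv x \<otimes> (x \<otimes> y) = y" "x \<otimes> (inv x \<otimes> y) = y"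
  by (simp_all flip: m_assoc)

lemma continuous_on_group_mult:
  assumes "continuous_on S f" "continuous_on S g"
  shows "continuous_on S (\<lambda>x. f x \<otimes> g x)"
proof -
  have "continuous_on UNIV (\<lambda>(x, y). x \<otimes> y)"
    using lie by (simp add: lie_group_def smooth_map_def)
  from continuous_on_compose2[OF this continuous_on_Pair[OF assms]] show ?thesis by simp
qed

lemma continuous_on_group_inv:
  assumes "continuous_on S f"
  shows "continuous_on S (\<lambda>x. inv (f x))"
proof -
  have "continuous_on UNIV (\<lambda>x. inv x)"
    using lie by (simp add: lie_group_def smooth_map_def)
  from continuous_on_compose2[OF this assms] show ?thesis by simp
qed

text \<open>Near each pair, compose the chart expression of the multiplication with that of
  \<open>u\<close> in a chart around the product. Freezing the first factor yields left
  translations; letting the second run along a curve yields the derivatives of right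
  translations.\<close>

lemma mult_chart_smooth:
  assumes U: "(U, \<phi>) \<in> A" and V: "(V, \<psi>) \<in> A" and u: "u \<in> smooth_functions A"
  shows "smooth_on (\<phi> ` U \<times> \<psi> ` V) (\<lambda>z. u (inv_into U \<phi> (fst z) \<otimes> inv_into V \<psi> (snd z)))"
proof (rule smooth_on_local)
  show "open (\<phi> ` U \<times> \<psi> ` V)" using U V by (intro open_Times chart_image_open)
  fix z assume "z \<in> \<phi> ` U \<times> \<psi> ` V"
  then obtain x y where xy: "x \<in> U" "y \<in> V" "z = (\<phi> x, \<psi> y)" by auto
  obtain W \<theta> where W: "(W, \<theta>) \<in> A" "x \<otimes> y \<in> W" by (rule chart_at)
  let ?m = "\<lambda>(x, y). x \<otimes> y"
  let ?S = "map_prod \<phi> \<psi> ` (U \<times> V \<inter> ?m -` W)"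
  have UV: "(U \<times> V, map_prod \<phi> \<psi>) \<in> prod_atlas A A"
    using U V by (auto simp: prod_atlas_def)
  have "smooth_map (prod_atlas A A) A ?m"
    using lie by (simp add: lie_group_def)
  then have "\<forall>(U, \<phi>)\<in>prod_atlas A A. \<forall>(V, \<psi>)\<in>A.
      smooth_on (\<phi> ` (U \<inter> ?m -` V)) (\<psi> \<circ> ?m \<circ> inv_into U \<phi>)"
    by (simp add: smooth_map_def)
  from bspec[OF this UV]
  have "\<forall>(W, \<theta>)\<in>A. smooth_on (map_prod \<phi> \<psi> ` (U \<times> V \<inter> ?m -` W))
      (\<theta> \<circ> ?m \<circ> inv_into (U \<times> V) (map_prod \<phi> \<psi>))"
    by simp
  from bspec[OF this W(1)]
  have m: "smooth_on ?S (\<lambda>z. \<theta> (?m (inv_into (U \<times> V) (map_prod \<phi> \<psi>) z)))"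
    by (simp add: comp_def)
  have inj: "inj_on (map_prod \<phi> \<psi>) (U \<times> V)"
    using map_prod_inj_on chart_inj U V by blast
  have "smooth_on ?S (\<lambda>z. u (inv_into W \<theta> (\<theta> (?m (inv_into (U \<times> V) (map_prod \<phi> \<psi>) z)))))"
    by (rule smooth_on_compose[OF m smooth_functions_chart[OF u W(1)]])
      (use inj in \<open>auto simp: inv_into_f_f simp flip: map_prod_simp\<close>)
  then have "smooth_on ?S (\<lambda>z. u (inv_into U \<phi> (fst z) \<otimes> inv_into V \<psi> (snd z)))"
  proof (rule smooth_on_cong[THEN iffD1, rotated])
    fix z assume "z \<in> ?S"
    then obtain x y where xy: "x \<in> U" "y \<in> V" "x \<otimes> y \<in> W" "z = map_prod \<phi> \<psi> (x, y)" by auto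
    have "inv_into (U \<times> V) (map_prod \<phi> \<psi>) z = (x, y)"
      unfolding xy(4) by (rule inv_into_f_f[OF inj]) (use xy in auto)
    then show "u (inv_into W \<theta> (\<theta> (?m (inv_into (U \<times> V) (map_prod \<phi> \<psi>) z)))) =
        u (inv_into U \<phi> (fst z) \<otimes> inv_into V \<psi> (snd z))"
      using xy U V W by simp
  qed
  moreover have "z \<in> ?S" using xy W by (auto intro!: image_eqI[of _ _ "(x, y)"])
  ultimately show "\<exists>T. z \<in> T \<and>
      smooth_on T (\<lambda>z. u (inv_into U \<phi> (fst z) \<otimes> inv_into V \<psi> (snd z)))"
    by (intro exI[of _ ?S] conjI)
qed

lemma left_transl_smooth:
  assumes "u \<in> smooth_functions A"
  shows "left_transl G x u \<in> smooth_functions A"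
proof (rule smooth_functionsI_chart)
  fix V \<psi> assume V: "(V, \<psi>) \<in> A"
  obtain U \<phi> where U: "(U, \<phi>) \<in> A" "inv x \<in> U" by (rule chart_at)
  \<comment> \<open>The affine map that freezes the first coordinate at
    \<open>\<phi> (inv x)\<close>, written as a sum of a linear map and a constant.\<close>
  have "smooth_on (\<psi> ` V) (\<lambda>b. (0, b) + (\<phi> (inv x), 0))"
    by (intro smooth_on_add smooth_on_const smooth_on_bounded_linear bounded_linear_Pair
        bounded_linear_zero bounded_linear_ident chart_image_open[OF V])
  then have "smooth_on (\<psi> ` V) (\<lambda>b. u (inv_into U \<phi> (fst ((0, b) + (\<phi> (inv x), 0))) \<otimes>
      inv_into V \<psi> (snd ((0, b) + (\<phi> (inv x), 0)))))"
    by (rule smooth_on_compose[OF _ mult_chart_smooth[OF U(1) V assms]]) (use U in auto)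
  then show "smooth_on (\<psi> ` V) (\<lambda>y. left_transl G x u (inv_into V \<psi> y))"
    using U by (simp add: left_transl_def)
qed

lemma lie_algebra_vector_field: "X \<in> lie_algebra G A \<Longrightarrow> vector_field A X"
  by (simp add: lie_algebra_def)

lemma lie_algebra_left_transl:
  "X \<in> lie_algebra G A \<Longrightarrow> u \<in> smooth_functions A \<Longrightarrow> X (left_transl G x u) = left_transl G x (X u)"
  by (simp add: lie_algebra_def)

text \<open>
  A left-invariant field is the derivative at \<open>t = 0\<close> of right translation along any curve with
  the right initial velocity; a straight line in a chart is enough, and the flow is not needed.
\<close>

lemma lie_algebra_curve:
  assumes X: "X \<in> lie_algebra G A"
  obtains \<gamma> :: "real \<Rightarrow> 'g" and \<tau> :: real where "\<tau> > 0" "\<gamma> 0 = \<one>"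
    "\<And>u g. u \<in> smooth_functions A \<Longrightarrow>
      ((\<lambda>t. u (g \<otimes> \<gamma> t)) has_real_derivative X u g) (at 0)"
    "continuous_on {- \<tau>..\<tau>} \<gamma>"
    "\<And>u. u \<in> test_functions A UNIV \<Longrightarrow>
      \<exists>L. \<forall>g. \<forall>t\<in>{- \<tau>..\<tau>}. \<bar>u (g \<otimes> \<gamma> t) - u g\<bar> \<le> L * \<bar>t\<bar>"
proof -
  obtain U \<phi> where U: "(U, \<phi>) \<in> A" "\<one> \<in> U" by (rule chart_at)
  define c where "c = \<phi> \<one>"
  obtain w where w: "\<And>u. u \<in> smooth_functions A \<Longrightarrow>
      X u \<one> = frechet_derivative (\<lambda>y. u (inv_into U \<phi> y)) (at c) w"
    unfolding c_def
    using vector_field_eq_directional_derivative[OF lie_algebra_vector_field[OF X] U] by blast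
  obtain r where r: "r > 0" "ball c r \<subseteq> \<phi> ` U"
    using chart_image_open[OF U(1)] U(2) by (metis c_def imageI open_contains_ball)
  \<comment> \<open>For \<open>\<bar>t\<bar> < 2 * \<tau>\<close> the line \<open>c + t w\<close>
    stays in the ball of radius \<open>r\<close>; the \<open>+ 1\<close> covers
    \<open>w = 0\<close>. The open interval \<open>J\<close> is twice as long as needed so that the
    compact interval of radius \<open>\<tau>\<close> lies inside it.\<close>
  define \<tau> where "\<tau> = r / (norm w + 1) / 2"
  define J where "J = {- (2 * \<tau>)<..<2 * \<tau>}"
  have nw: "norm w + 1 > 0" using norm_ge_zero[of w] by linarith
  have \<tau>: "\<tau> > 0" using r nw by (simp add: \<tau>_def)
  have line: "c + t *\<^sub>R w \<in> \<phi> ` U" if "t \<in> J" for t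
  proof -
    have "\<bar>t\<bar> < 2 * \<tau>" using that by (auto simp: J_def)
    also have "2 * \<tau> = r / (norm w + 1)" using nw by (simp add: \<tau>_def field_simps)
    finally have "\<bar>t\<bar> < r / (norm w + 1)" .
    then have "\<bar>t\<bar> * (norm w + 1) < r" using nw by (simp add: field_simps)
    moreover have "\<bar>t\<bar> * norm w \<le> \<bar>t\<bar> * (norm w + 1)" by (intro mult_left_mono) auto
    ultimately have "norm (t *\<^sub>R w) < r" by simp
    then show ?thesis using r by (auto simp: dist_norm)
  qed
  define \<gamma> where "\<gamma> t = inv_into U \<phi> (c + t *\<^sub>R w)" for t
  have \<gamma>0: "\<gamma> 0 = \<one>" using U by (simp add: \<gamma>_def c_def)
  have \<gamma>_cont: "continuous_on J \<gamma>"
    unfolding \<gamma>_def using line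
    by (intro continuous_on_compose2[OF chart_inv_cont[OF U(1)]] continuous_intros) auto
  have sub: "{- \<tau>..\<tau>} \<subseteq> J" using \<tau> by (auto simp: J_def)
  \<comment> \<open>The derivative is computed at every \<open>t\<close> in \<open>J\<close> because
    the Lipschitz bound rests on it. In product charts, moving along \<open>\<gamma>\<close> with
    \<open>g\<close> fixed is moving along a straight line.\<close>
  have F: "((\<lambda>t. u (g \<otimes> \<gamma> t)) has_real_derivative frechet_derivative
      (\<lambda>z. u (inv_into V \<psi> (fst z) \<otimes> inv_into U \<phi> (snd z))) (at (\<psi> g, c + t *\<^sub>R w)) (0, w)) (at t)"
    if u: "u \<in> smooth_functions A" and V: "(V, \<psi>) \<in> A" "g \<in> V" and t: "t \<in> J" for u V \<psi> g t
  proof -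
    let ?F = "\<lambda>z. u (inv_into V \<psi> (fst z) \<otimes> inv_into U \<phi> (snd z))"
    have fd: "(?F has_derivative frechet_derivative ?F (at (\<psi> g, c + t *\<^sub>R w))) (at (\<psi> g, c + t *\<^sub>R w))"
      by (rule smooth_on_has_derivative[OF mult_chart_smooth[OF V(1) U(1) u]]) (use V line t in auto)
    have ray: "((\<lambda>t. (\<psi> g, c + t *\<^sub>R w)) has_derivative (\<lambda>s. (0, s *\<^sub>R w))) (at t)"
      by (auto intro!: derivative_eq_intros)
    have "((\<lambda>t. ?F (\<psi> g, c + t *\<^sub>R w)) has_derivative
        (\<lambda>s. frechet_derivative ?F (at (\<psi> g, c + t *\<^sub>R w)) (0, s *\<^sub>R w))) (at t)"
      by (rule has_derivative_compose[OF ray fd])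
    moreover have "frechet_derivative ?F (at (\<psi> g, c + t *\<^sub>R w)) (0, s *\<^sub>R w) =
        frechet_derivative ?F (at (\<psi> g, c + t *\<^sub>R w)) (0, w) * s" for s
      using linear_cmul[OF has_derivative_linear[OF fd], of s "(0, w)"] by simp
    ultimately show ?thesis
      using V by (simp add: has_field_derivative_def \<gamma>_def)
  qed
  have deriv: "((\<lambda>t. u (g \<otimes> \<gamma> t)) has_real_derivative X u g) (at 0)"
    if u: "u \<in> smooth_functions A" for u g
  proof -
    \<comment> \<open>By left invariance the derivative at \<open>g\<close> is the derivative at the
      unit of the translate \<open>?v\<close>, for which \<open>w\<close> was chosen.\<close>
    let ?v = "left_transl G (inv g) u"
    let ?f = "\<lambda>y. ?v (inv_into U \<phi> y)"
    have v: "?v \<in> smooth_functions A" by (rule left_transl_smooth[OF u])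
    have fd: "(?f has_derivative frechet_derivative ?f (at (c + 0 *\<^sub>R w))) (at (c + 0 *\<^sub>R w))"
      by (rule smooth_on_has_derivative[OF smooth_functions_chart[OF v U(1)]])
        (use U in \<open>simp add: c_def\<close>)
    have ray: "((\<lambda>t. c + t *\<^sub>R w) has_derivative (\<lambda>s. s *\<^sub>R w)) (at 0)"
      by (auto intro!: derivative_eq_intros)
    have "((\<lambda>t. ?f (c + t *\<^sub>R w)) has_derivative
        (\<lambda>s. frechet_derivative ?f (at (c + 0 *\<^sub>R w)) (s *\<^sub>R w))) (at 0)"
      by (rule has_derivative_compose[OF ray fd])
    moreover have "frechet_derivative ?f (at (c + 0 *\<^sub>R w)) (s *\<^sub>R w) = X ?v \<one> * s" for s
      using linear_cmul[OF has_derivative_linear[OF fd], of s w] w[OF v] by simp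
    moreover have "X ?v \<one> = X u g"
      by (simp add: lie_algebra_left_transl[OF X u]) (simp add: left_transl_def)
    ultimately show ?thesis by (simp add: has_field_derivative_def \<gamma>_def left_transl_def)
  qed
  have lip: "\<exists>L. \<forall>g. \<forall>t\<in>{- \<tau>..\<tau>}. \<bar>u (g \<otimes> \<gamma> t) - u g\<bar> \<le> L * \<bar>t\<bar>"
    if test: "u \<in> test_functions A UNIV" for u
  proof -
    note u = test_functions_smooth[OF test]
    \<comment> \<open>Defined without charts, so that its continuity can be checked in one chart
      after another and then holds on all of \<open>UNIV \<times> J\<close>.\<close>
    define d where "d z = deriv (\<lambda>t. u (fst z \<otimes> \<gamma> t)) (snd z)" for z
    have d: "((\<lambda>t. u (g \<otimes> \<gamma> t)) has_real_derivative d (g, t)) (at t)" if t: "t \<in> J" for g t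
    proof -
      obtain V \<psi> where V: "(V, \<psi>) \<in> A" "g \<in> V" by (rule chart_at)
      show ?thesis using F[OF u V t] DERIV_imp_deriv[OF F[OF u V t]] by (simp add: d_def)
    qed
    have "continuous_on (\<Union>c\<in>A. fst c \<times> J) d"
    proof (rule continuous_on_open_UN)
      fix c' assume "c' \<in> A"
      then obtain V \<psi> where V: "(V, \<psi>) \<in> A" "c' = (V, \<psi>)" by (cases c') auto
      show "open (fst c' \<times> J)" using V by (auto intro!: open_Times chart_open simp: J_def)
      let ?F = "\<lambda>z. u (inv_into V \<psi> (fst z) \<otimes> inv_into U \<phi> (snd z))"
      have "continuous_on (V \<times> J) (\<lambda>z. frechet_derivative ?F (at (\<psi> (fst z), c + snd z *\<^sub>R w)) (0, w))"
        by (rule continuous_on_compose2[OF smooth_on_imp_continuous_on[OF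
                smooth_on_frechet_derivative[OF mult_chart_smooth[OF V(1) U(1) u]]]])
          (use line in \<open>auto intro!: continuous_intros continuous_on_compose2[OF chart_cont[OF V(1)]]\<close>)
      then show "continuous_on (fst c' \<times> J) d"
        by (subst (asm) continuous_on_cong[OF refl, of _ _ d])
          (use V DERIV_unique[OF F[OF u V(1)] d] in auto)
    qed
    moreover have "(\<Union>c\<in>A. fst c \<times> J) = UNIV \<times> J"
      using chart_at by (auto; metis fst_conv)
    ultimately have cont: "continuous_on (UNIV \<times> J) d" by simp
    let ?K = "closure {y. u y \<noteq> 0}"
    \<comment> \<open>The points \<open>g\<close> whose path \<open>g \<otimes> \<gamma> s\<close>
      meets the support for some \<open>s\<close> in the interval. For other \<open>g\<close> both
      values of \<open>u\<close> are zero; on this compact set the derivative \<open>d\<close> is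
      bounded.\<close>
    let ?K' = "(\<lambda>z. fst z \<otimes> inv (\<gamma> (snd z))) ` (?K \<times> {- \<tau>..\<tau>})"
    have K: "compact ?K" using test by (simp add: test_functions_def)
    have K': "compact ?K'"
      by (intro compact_continuous_image compact_Times K compact_Icc continuous_on_group_mult
          continuous_on_group_inv continuous_on_compose2[OF \<gamma>_cont] continuous_intros)
        (use sub in auto)
    have "compact (d ` (?K' \<times> {- \<tau>..\<tau>}))"
      by (rule compact_continuous_image[OF continuous_on_subset[OF cont] compact_Times[OF K' compact_Icc]])
        (use sub in auto)
    then have "bounded (d ` (?K' \<times> {- \<tau>..\<tau>}))" by (rule compact_imp_bounded)
    then obtain L where L': "\<forall>y\<in>d ` (?K' \<times> {- \<tau>..\<tau>}). norm y \<le> L" by (auto simp only: bounded_iff)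
    have L: "\<bar>d (g, t)\<bar> \<le> L" if "g \<in> ?K'" "t \<in> {- \<tau>..\<tau>}" for g t
      using bspec[OF L' imageI[OF SigmaI[OF that]]] by simp
    \<comment> \<open>The absolute value is taken since \<open>L\<close> may be negative when
      \<open>?K'\<close> is empty.\<close>
    have "\<bar>u (g \<otimes> \<gamma> t) - u g\<bar> \<le> \<bar>L\<bar> * \<bar>t\<bar>" if t: "t \<in> {- \<tau>..\<tau>}" for g t
    proof (cases "g \<in> ?K'")
      case True
      have "norm (u (g \<otimes> \<gamma> t) - u (g \<otimes> \<gamma> 0)) \<le> \<bar>L\<bar> * norm (t - 0)"
      proof (rule field_differentiable_bound[of "{- \<tau>..\<tau>}"])
        fix s assume s: "s \<in> {- \<tau>..\<tau>}"
        show "((\<lambda>t. u (g \<otimes> \<gamma> t)) has_real_derivative d (g, s)) (at s within {- \<tau>..\<tau>})"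
          by (rule has_field_derivative_at_within[OF d]) (use s sub in blast)
        show "norm (d (g, s)) \<le> \<bar>L\<bar>"
          using L[OF True s] by simp
      qed (use t \<tau> in auto)
      then show ?thesis by (simp add: \<gamma>0)
    next
      case False
      have z: "u (g \<otimes> \<gamma> s) = 0" if "s \<in> {- \<tau>..\<tau>}" for s
      proof (rule ccontr)
        assume "u (g \<otimes> \<gamma> s) \<noteq> 0"
        then have "g \<otimes> \<gamma> s \<in> ?K" using closure_subset[of "{y. u y \<noteq> 0}"] by auto
        then have "(g \<otimes> \<gamma> s) \<otimes> inv (\<gamma> s) \<in> ?K'"
          using that by (intro image_eqI[of _ _ "(g \<otimes> \<gamma> s, s)"]) auto
        then show False using False by (simp add: m_assoc)
      qed
      show ?thesis using z[OF t] z[of 0] \<tau> by (simp add: \<gamma>0)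
    qed
    then show ?thesis by blast
  qed
  show ?thesis
    using that[of \<tau> \<gamma>] \<tau> \<gamma>0 deriv continuous_on_subset[OF \<gamma>_cont sub] lip by blast
qed

end

section \<open>Left Haar measures\<close>

locale haar_lie_grp = lie_grp G A
  for G :: "'g::{second_countable_topology, t2_space} monoid" (structure)
    and A :: "('g, 'e::euclidean_space) chart set" +
  fixes \<mu> :: "'g measure"
  assumes haar: "left_haar_measure G \<mu>"
begin

lemma sets_haar [simp, measurable_cong]: "sets \<mu> = sets borel"
  using haar by (simp add: left_haar_measure_def)

lemma space_haar [simp]: "space \<mu> = UNIV"
  using sets_eq_imp_space_eq[OF sets_haar] by simp

lemma measurable_haar: "borel_measurable \<mu> = borel_measurable borel"
  by (rule measurable_cong_sets) simp_all

lemma measurable_group_mult [measurable (raw)]: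
  assumes "f \<in> borel_measurable M" "g \<in> borel_measurable M"
  shows "(\<lambda>x. f x \<otimes> g x) \<in> borel_measurable M"
  by (rule borel_measurable_continuous_Pair[OF assms]) (intro continuous_on_group_mult continuous_intros)

lemma measurable_group_inv [measurable (raw)]:
  assumes "f \<in> borel_measurable M"
  shows "(\<lambda>x. inv (f x)) \<in> borel_measurable M"
  by (rule borel_measurable_continuous_on[OF _ assms]) (intro continuous_on_group_inv continuous_intros)

lemma smooth_functions_measurable: "u \<in> smooth_functions A \<Longrightarrow> u \<in> borel_measurable borel"
  by (rule borel_measurable_continuous_onI[OF smooth_functions_cont])

lemma haar_invariant: "distr \<mu> borel (\<lambda>y. x \<otimes> y) = \<mu>"
  using haar by (simp add: left_haar_measure_def)

lemma haar_compact: "compact K \<Longrightarrow> emeasure \<mu> K < \<infinity>"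
  using haar by (simp add: left_haar_measure_def)

lemma nn_integral_transl:
  assumes [measurable]: "f \<in> borel_measurable borel"
  shows "(\<integral>\<^sup>+y. f (x \<otimes> y) \<partial>\<mu>) = (\<integral>\<^sup>+y. f y \<partial>\<mu>)"
  by (subst (2) haar_invariant[of x, symmetric], subst nn_integral_distr) simp_all

lemma AE_transl:
  assumes "AE y in \<mu>. P y"
  shows "AE y in \<mu>. P (x \<otimes> y)"
proof (rule AE_distrD[of "\<lambda>y. x \<otimes> y" \<mu> borel P])
  show "AE y in distr \<mu> borel (\<lambda>y. x \<otimes> y). P y" unfolding haar_invariant by (rule assms)
qed simp

lemma compact_neighbourhood:
  fixes x :: 'g
  obtains V K where "open V" "x \<in> V" "V \<subseteq> K" "compact K"
proof -
  obtain U \<phi> where U: "(U, \<phi>) \<in> A" "x \<in> U" by (rule chart_at)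
  obtain r where r: "r > 0" "cball (\<phi> x) r \<subseteq> \<phi> ` U"
    using chart_image_open[OF U(1)] U(2) by (metis imageI open_contains_cball)
  let ?V = "\<phi> -` ball (\<phi> x) r \<inter> U" and ?K = "inv_into U \<phi> ` cball (\<phi> x) r"
  have "open ?V"
    using chart_cont[OF U(1)] chart_open[OF U(1)] continuous_on_open_vimage by (metis open_ball)
  moreover have "compact ?K"
    by (intro compact_continuous_image continuous_on_subset[OF chart_inv_cont[OF U(1)] r(2)]) simp
  moreover have "?V \<subseteq> ?K"
  proof
    fix y assume "y \<in> ?V"
    then show "y \<in> ?K" using U(1) by (intro image_eqI[of _ _ "\<phi> y"]) auto
  qed
  ultimately show ?thesis using that[of ?V ?K] U r by simp
qed

text \<open>The open sets contained in compact sets cover the group, since charts are locally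
  compact, and countably many of them suffice by second countability. The exchanges of integrals
  below rest on this.\<close>

sublocale sigma_finite_measure \<mu>
proof
  define F where "F = {V :: 'g set. open V \<and> (\<exists>K. V \<subseteq> K \<and> compact K)}"
  have "\<exists>F'. F' \<subseteq> F \<and> countable F' \<and> \<Union>F' = \<Union>F"
  proof (rule Lindelof[of F])
    show "open S" if "S \<in> F" for S using that by (simp add: F_def)
  qed (intro exI conjI)
  then obtain F' where F': "F' \<subseteq> F" "countable F'" "\<Union>F' = \<Union>F" by (elim exE conjE)
  have "x \<in> \<Union>F" for x
  proof -
    obtain V K where "open V" "x \<in> V" "V \<subseteq> K" "compact K" by (rule compact_neighbourhood)
    then show ?thesis unfolding F_def by (intro UnionI[of V]) auto
  qed
  then have "\<Union>F = UNIV" by (simp add: set_eq_iff)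
  then have "\<Union>F' = space \<mu>" using F' by simp
  moreover have "emeasure \<mu> V \<noteq> \<infinity>" if "V \<in> F'" for V
  proof -
    obtain K where "V \<subseteq> K" "compact K" using subsetD[OF F'(1) \<open>V \<in> F'\<close>] by (auto simp: F_def)
    then show ?thesis
      using haar_compact[of K] emeasure_mono[of V K \<mu>] compact_imp_closed[of K]
      by (auto simp: less_top[symmetric] top_unique)
  qed
  moreover have "F' \<subseteq> sets \<mu>" using F' by (auto simp: F_def)
  ultimately show "\<exists>A. countable A \<and> A \<subseteq> sets \<mu> \<and> \<Union>A = space \<mu> \<and> (\<forall>a\<in>A. emeasure \<mu> a \<noteq> \<infinity>)"
    using F' by (intro exI[of _ F']) simp
qed

sublocale \<mu>\<mu>: pair_sigma_finite \<mu> \<mu> ..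

lemma haar_UNIV: "emeasure \<mu> UNIV \<noteq> 0"
  using haar by (simp add: left_haar_measure_def)

text \<open>The translates of a nonempty open set cover the group, hence countably many do, by
  Lindelof. If the set were null, so would be the whole group.\<close>

lemma haar_open_pos:
  assumes "open V" "V \<noteq> {}"
  shows "emeasure \<mu> V > 0"
proof (rule ccontr)
  assume "\<not> emeasure \<mu> V > 0"
  then have null: "emeasure \<mu> V = 0" by simp
  obtain v where v: "v \<in> V" using assms by auto
  define T where "T x = (\<lambda>y. inv x \<otimes> y) -` V" for x
  have T: "emeasure \<mu> (T x) = 0" for x
    using null emeasure_distr[of "\<lambda>y. inv x \<otimes> y" \<mu> borel V] assms(1) haar_invariant[of "inv x"]
    by (simp add: T_def)
  have oT: "open (T x)" for x
    unfolding T_def using assms(1) by (intro open_vimage continuous_on_group_mult continuous_intros)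
  obtain F' where F': "F' \<subseteq> range T" "countable F'" "\<Union>F' = \<Union>(range T)"
    using Lindelof[of "range T"] oT by blast
  \<comment> \<open>The translate that carries \<open>v\<close> to \<open>y\<close>.\<close>
  have "y \<in> T (y \<otimes> inv v)" for y
    using v by (simp add: T_def inv_mult_group m_assoc)
  then have "\<Union>(range T) = UNIV" by blast
  then have "UNIV = (\<Union>S\<in>F'. S)" using F' by simp
  moreover have "(\<Union>S\<in>F'. S) \<in> null_sets \<mu>"
    by (rule null_sets_UN'[OF F'(2)]) (use F'(1) T oT in \<open>auto simp: null_sets_def\<close>)
  ultimately have "UNIV \<in> null_sets \<mu>" by metis
  then show False using haar_UNIV by auto
qed

text \<open>Inversion need not preserve \<open>\<mu>\<close>, but it preserves null sets. Let
  \<open>?B\<close> be the exceptional set and integrate its indicator at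
  \<open>inv y \<otimes> x\<close> over both variables: integrating first over \<open>y\<close>
  gives 0 by hypothesis, integrating first over \<open>x\<close> gives
  \<open>emeasure \<mu> ?B\<close> times the nonzero mass of the group.\<close>

lemma AE_group_inv:
  assumes P: "Measurable.pred borel P" and AE: "AE y in \<mu>. P (inv y)"
  shows "AE y in \<mu>. P y"
proof -
  note [measurable] = P
  let ?B = "{y. \<not> P y}"
  have [measurable]: "?B \<in> sets borel" by simp
  have "(\<integral>\<^sup>+y. indicator ?B (inv (inv x \<otimes> y)) \<partial>\<mu>) = 0" for x
  proof -
    have "(\<integral>\<^sup>+y. indicator ?B (inv (inv x \<otimes> y)) \<partial>\<mu>) = (\<integral>\<^sup>+y. indicator ?B (inv y) \<partial>\<mu>)"
      by (rule nn_integral_transl) measurable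
    also have "\<dots> = 0"
      by (subst nn_integral_0_iff_AE) (use AE in \<open>auto simp: indicator_def\<close>)
    finally show ?thesis .
  qed
  then have "0 = (\<integral>\<^sup>+x. (\<integral>\<^sup>+y. indicator ?B (inv (inv x \<otimes> y)) \<partial>\<mu>) \<partial>\<mu>)" by simp
  also have "\<dots> = (\<integral>\<^sup>+y. (\<integral>\<^sup>+x. indicator ?B (inv (inv x \<otimes> y)) \<partial>\<mu>) \<partial>\<mu>)"
    by (rule \<mu>\<mu>.Fubini'[symmetric]) measurable
  also have "\<dots> = (\<integral>\<^sup>+y. (\<integral>\<^sup>+x. indicator ?B (inv y \<otimes> x) \<partial>\<mu>) \<partial>\<mu>)"
    by (simp add: inv_mult_group)
  also have "\<dots> = (\<integral>\<^sup>+y. emeasure \<mu> ?B \<partial>\<mu>)"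
    by (subst nn_integral_transl) simp_all
  also have "\<dots> = emeasure \<mu> ?B * emeasure \<mu> UNIV" by simp
  finally have "emeasure \<mu> ?B = 0" using haar_UNIV by auto
  then show ?thesis by (subst AE_iff_measurable[of ?B]) auto
qed

section \<open>Uniqueness of Haar measure and the modular function\<close>

text \<open>These right-translated integrals are going to be denominators. They are positive because
  the integrand exceeds \<open>h\<close> on an open neighbourhood of \<open>inv x\<close>, and
  finite because it is bounded with support in a compact set.\<close>

lemma nn_integral_transl_bump:
  assumes b: "b \<in> test_functions A UNIV" "b \<one> = 1" "\<And>y. b y \<ge> 0"
  shows "0 < (\<integral>\<^sup>+t. ennreal (b (t \<otimes> x)) \<partial>\<mu>)" "(\<integral>\<^sup>+t. ennreal (b (t \<otimes> x)) \<partial>\<mu>) < \<infinity>"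
proof -
  have [measurable]: "b \<in> borel_measurable borel"
    using b test_functions_smooth smooth_functions_measurable by auto
  have bc: "continuous_on UNIV b" using b test_functions_smooth smooth_functions_cont by auto
  obtain h :: real where h: "0 < h" "h < 1" using dense zero_less_one by blast
  let ?V = "{t. h < b (t \<otimes> x)}"
  have "continuous_on UNIV (\<lambda>t. b (t \<otimes> x))"
    by (intro continuous_on_compose2[OF bc] continuous_on_group_mult continuous_intros) auto
  then have V: "open ?V" by (intro open_Collect_less continuous_on_const)
  have "inv x \<in> ?V" using b h by simp
  then have "0 < emeasure \<mu> ?V" using haar_open_pos[OF V] by blast
  then have "0 < ennreal h * emeasure \<mu> ?V" using h by (simp add: ennreal_zero_less_mult_iff)
  also have "\<dots> = (\<integral>\<^sup>+t. ennreal h * indicator ?V t \<partial>\<mu>)"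
    using V by (subst nn_integral_cmult_indicator) auto
  also have "\<dots> \<le> (\<integral>\<^sup>+t. ennreal (b (t \<otimes> x)) \<partial>\<mu>)"
    by (intro nn_integral_mono) (auto simp: indicator_def intro!: ennreal_leI)
  finally show "0 < (\<integral>\<^sup>+t. ennreal (b (t \<otimes> x)) \<partial>\<mu>)" .
  let ?K = "closure {y. b y \<noteq> 0}"
  let ?K' = "(\<lambda>y. y \<otimes> inv x) ` ?K"
  have K: "compact ?K" using b by (simp add: test_functions_def)
  have K': "compact ?K'"
    by (intro compact_continuous_image K continuous_on_group_mult continuous_intros)
  have "compact (b ` ?K)" by (intro compact_continuous_image K continuous_on_subset[OF bc]) auto
  then have "bounded (b ` ?K)" by (rule compact_imp_bounded)
  then obtain M where M: "\<forall>y\<in>b ` ?K. norm y \<le> M" by (auto simp only: bounded_iff)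
  have "ennreal (b (t \<otimes> x)) \<le> ennreal M * indicator ?K' t" for t
  proof (cases "b (t \<otimes> x) = 0")
    case False
    then have *: "t \<otimes> x \<in> ?K" using closure_subset[of "{y. b y \<noteq> 0}"] by auto
    then have "(t \<otimes> x) \<otimes> inv x \<in> ?K'" by (rule imageI)
    then have "t \<in> ?K'" by (simp add: m_assoc)
    moreover have "b (t \<otimes> x) \<le> M" using M * by force
    ultimately show ?thesis by (auto intro!: ennreal_leI)
  qed simp
  then have "(\<integral>\<^sup>+t. ennreal (b (t \<otimes> x)) \<partial>\<mu>) \<le> (\<integral>\<^sup>+t. ennreal M * indicator ?K' t \<partial>\<mu>)"
    by (intro nn_integral_mono)
  also have "\<dots> = ennreal M * emeasure \<mu> ?K'"
    using compact_imp_closed[OF K'] by (subst nn_integral_cmult_indicator) auto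
  also have "\<dots> < \<infinity>" using haar_compact[OF K'] by (auto simp: ennreal_mult_less_top)
  finally show "(\<integral>\<^sup>+t. ennreal (b (t \<otimes> x)) \<partial>\<mu>) < \<infinity>" .
qed

text \<open>
  Uniqueness of Haar measure: the second factor on the right-hand side depends on \<open>\<nu>\<close> only.
\<close>

lemma nn_integral_haar_factor:
  assumes \<nu>: "left_haar_measure G \<nu>"
    and b: "b \<in> test_functions A UNIV" "b \<one> = 1" "\<And>y. b y \<ge> 0"
    and [measurable]: "f \<in> borel_measurable borel"
  shows "(\<integral>\<^sup>+x. f x \<partial>\<mu>) = (\<integral>\<^sup>+x. ennreal (b x) \<partial>\<mu>) *
    (\<integral>\<^sup>+t. f (inv t) / (\<integral>\<^sup>+s. ennreal (b (s \<otimes> inv t)) \<partial>\<nu>) \<partial>\<nu>)"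
proof -
  interpret \<nu>: haar_lie_grp G A \<nu> by unfold_locales (rule \<nu>)
  interpret P: pair_sigma_finite \<mu> \<nu> ..
  have [measurable]: "b \<in> borel_measurable borel"
    using b test_functions_smooth smooth_functions_measurable by auto
  define g where "g x = ennreal (b x)" for x
  \<comment> \<open>The factor 1, written as the integral of \<open>g (t \<otimes> x)\<close> over
    \<open>t\<close> divided by \<open>D x\<close>, brings in a second variable. Replacing
    \<open>x\<close> by \<open>inv t \<otimes> x\<close> and afterwards \<open>t\<close> by
    \<open>x \<otimes> t\<close>, two left translations, separates the variables.\<close>
  define D where "D x = (\<integral>\<^sup>+s. g (s \<otimes> x) \<partial>\<nu>)" for x
  have [measurable]: "g \<in> borel_measurable borel" unfolding g_def by measurable
  have [measurable]: "D \<in> borel_measurable borel" unfolding D_def by measurable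
  have D: "0 < D x" "D x < \<infinity>" for x
    using \<nu>.nn_integral_transl_bump[OF b] by (simp_all add: D_def g_def)
  have "(\<integral>\<^sup>+x. f x \<partial>\<mu>) = (\<integral>\<^sup>+x. (\<integral>\<^sup>+t. f x / D x * g (t \<otimes> x) \<partial>\<nu>) \<partial>\<mu>)"
  proof (rule nn_integral_cong)
    fix x
    have "(\<integral>\<^sup>+t. f x / D x * g (t \<otimes> x) \<partial>\<nu>) = f x / D x * D x"
      unfolding D_def[of x] by (subst nn_integral_cmult) (simp_all add: D_def)
    also have "\<dots> = f x"
      using D[of x] by (simp add: ennreal_divide_times ennreal_mult_divide_eq less_top[symmetric]
          mult_divide_eq_ennreal)
    finally show "f x = (\<integral>\<^sup>+t. f x / D x * g (t \<otimes> x) \<partial>\<nu>)" ..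
  qed
  also have "\<dots> = (\<integral>\<^sup>+t. (\<integral>\<^sup>+x. f x / D x * g (t \<otimes> x) \<partial>\<mu>) \<partial>\<nu>)"
    by (rule P.Fubini'[symmetric]) measurable
  also have "\<dots> = (\<integral>\<^sup>+t. (\<integral>\<^sup>+x. f (inv t \<otimes> x) / D (inv t \<otimes> x) * g x \<partial>\<mu>) \<partial>\<nu>)"
  proof (rule nn_integral_cong)
    fix t
    have "(\<integral>\<^sup>+x. f (inv t \<otimes> x) / D (inv t \<otimes> x) * g (t \<otimes> (inv t \<otimes> x)) \<partial>\<mu>) =
        (\<integral>\<^sup>+x. f x / D x * g (t \<otimes> x) \<partial>\<mu>)"
      by (rule nn_integral_transl[where f = "\<lambda>x. f x / D x * g (t \<otimes> x)"]) measurable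
    then show "(\<integral>\<^sup>+x. f x / D x * g (t \<otimes> x) \<partial>\<mu>) = (\<integral>\<^sup>+x. f (inv t \<otimes> x) / D (inv t \<otimes> x) * g x \<partial>\<mu>)"
      by simp
  qed
  also have "\<dots> = (\<integral>\<^sup>+x. (\<integral>\<^sup>+t. f (inv t \<otimes> x) / D (inv t \<otimes> x) * g x \<partial>\<nu>) \<partial>\<mu>)"
    by (rule P.Fubini') measurable
  also have "\<dots> = (\<integral>\<^sup>+x. (\<integral>\<^sup>+t. f (inv t) / D (inv t) * g x \<partial>\<nu>) \<partial>\<mu>)"
  proof (rule nn_integral_cong)
    fix x
    have "(\<integral>\<^sup>+t. f (inv (x \<otimes> t) \<otimes> x) / D (inv (x \<otimes> t) \<otimes> x) * g x \<partial>\<nu>) =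
        (\<integral>\<^sup>+t. f (inv t \<otimes> x) / D (inv t \<otimes> x) * g x \<partial>\<nu>)"
      by (rule \<nu>.nn_integral_transl[where f = "\<lambda>t. f (inv t \<otimes> x) / D (inv t \<otimes> x) * g x"]) measurable
    then show "(\<integral>\<^sup>+t. f (inv t \<otimes> x) / D (inv t \<otimes> x) * g x \<partial>\<nu>) = (\<integral>\<^sup>+t. f (inv t) / D (inv t) * g x \<partial>\<nu>)"
      by (simp add: inv_mult_group m_assoc)
  qed
  also have "\<dots> = (\<integral>\<^sup>+x. (\<integral>\<^sup>+t. f (inv t) / D (inv t) \<partial>\<nu>) * g x \<partial>\<mu>)"
    by (intro nn_integral_cong nn_integral_multc) measurable
  also have "\<dots> = (\<integral>\<^sup>+t. f (inv t) / D (inv t) \<partial>\<nu>) * (\<integral>\<^sup>+x. g x \<partial>\<mu>)"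
    by (rule nn_integral_cmult) measurable
  finally show ?thesis by (simp add: g_def D_def mult.commute)
qed

text \<open>Left and right translations commute, so the pushforward under a right translation is
  again a left Haar measure and therefore proportional to \<open>\<mu>\<close>. As a function of
  \<open>s\<close>, the factor is a modular function of the group.\<close>

lemma haar_right_transl:
  obtains c :: real where "c > 0" "distr \<mu> borel (\<lambda>y. y \<otimes> s) = density \<mu> (\<lambda>_. ennreal c)"
proof -
  let ?\<nu> = "distr \<mu> borel (\<lambda>y. y \<otimes> s)"
  have \<nu>: "left_haar_measure G ?\<nu>"
    unfolding left_haar_measure_def
  proof (intro conjI allI impI)
    show "sets ?\<nu> = sets borel" by simp
    show "emeasure ?\<nu> UNIV \<noteq> 0" using haar_UNIV by (simp add: emeasure_distr)
    fix K :: "'g set" assume K: "compact K"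
    have "(\<lambda>y. y \<otimes> s) -` K = (\<lambda>y. y \<otimes> inv s) ` K"
    proof (intro equalityI subsetI)
      fix y assume "y \<in> (\<lambda>y. y \<otimes> s) -` K"
      then show "y \<in> (\<lambda>y. y \<otimes> inv s) ` K" by (intro image_eqI[of _ _ "y \<otimes> s"]) (auto simp: m_assoc)
    qed (auto simp: m_assoc)
    moreover have "compact ((\<lambda>y. y \<otimes> inv s) ` K)"
      by (intro compact_continuous_image K continuous_on_group_mult continuous_intros)
    ultimately show "emeasure ?\<nu> K < \<infinity>"
      using haar_compact compact_imp_closed[OF K] by (simp add: emeasure_distr)
  next
    fix x
    have "distr ?\<nu> borel (\<lambda>y. x \<otimes> y) = distr \<mu> borel ((\<lambda>y. x \<otimes> y) \<circ> (\<lambda>y. y \<otimes> s))"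
      by (rule distr_distr) measurable
    also have "(\<lambda>y. x \<otimes> y) \<circ> (\<lambda>y. y \<otimes> s) = (\<lambda>y. y \<otimes> s) \<circ> (\<lambda>y. x \<otimes> y)"
      by (simp add: comp_def m_assoc)
    also have "distr \<mu> borel \<dots> = distr (distr \<mu> borel (\<lambda>y. x \<otimes> y)) borel (\<lambda>y. y \<otimes> s)"
      by (rule distr_distr[symmetric]) measurable
    finally show "distr ?\<nu> borel (\<lambda>y. x \<otimes> y) = ?\<nu>" by (simp add: haar_invariant)
  qed
  interpret \<nu>: haar_lie_grp G A ?\<nu> by unfold_locales (rule \<nu>)
  obtain b where b: "b \<in> test_functions A UNIV" "b \<one> = 1" "\<And>y. b y \<ge> 0"
    using bump_function[of UNIV \<one>] by auto
  define p where "p = (\<integral>\<^sup>+x. ennreal (b x) \<partial>\<mu>)"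
  define q where "q = (\<integral>\<^sup>+x. ennreal (b x) \<partial>?\<nu>)"
  have p: "0 < p" "p < \<infinity>" and q: "0 < q" "q < \<infinity>"
    using nn_integral_transl_bump[OF b, of \<one>] \<nu>.nn_integral_transl_bump[OF b, of \<one>]
    by (simp_all add: p_def q_def)
  define c where "c = enn2real q / enn2real p"
  have c: "c > 0" using p q by (simp add: c_def enn2real_positive_iff)
  have qp: "q = ennreal c * p"
  proof -
    obtain p' where p': "p = ennreal p'" "p' > 0" using p by (cases p) auto
    obtain q' where q': "q = ennreal q'" "q' > 0" using q by (cases q) auto
    show ?thesis using p' q' by (simp add: c_def flip: ennreal_mult)
  qed
  have "?\<nu> = density \<mu> (\<lambda>_. ennreal c)"
  proof (rule measure_eqI)
    fix B assume "B \<in> sets ?\<nu>"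
    then have [measurable]: "B \<in> sets borel" by simp
    \<comment> \<open>The second factor of \<open>nn_integral_haar_factor\<close> with reference
      measure \<open>\<mu>\<close>; it is the same for both measures, so they differ by the ratio of
      \<open>q\<close> and \<open>p\<close>.\<close>
    define J where "J = (\<integral>\<^sup>+t. indicator B (inv t) / (\<integral>\<^sup>+s. ennreal (b (s \<otimes> inv t)) \<partial>\<mu>) \<partial>\<mu>)"
    have "emeasure ?\<nu> B = q * J"
      using \<nu>.nn_integral_haar_factor[OF haar b, of "indicator B"] by (simp add: q_def J_def)
    moreover have "emeasure \<mu> B = p * J"
      using nn_integral_haar_factor[OF haar b, of "indicator B"] by (simp add: p_def J_def)
    ultimately show "emeasure ?\<nu> B = emeasure (density \<mu> (\<lambda>_. ennreal c)) B"
      by (simp add: emeasure_density nn_integral_cmult qp mult.assoc)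
  qed simp
  then show ?thesis using that c by blast
qed

section \<open>Differentiating integrals along right translations\<close>

lemma integrable_haar_compact:
  fixes F :: "'g \<Rightarrow> real"
  assumes "F \<in> borel_measurable borel" "compact K" "\<And>x. \<bar>F x\<bar> \<le> M * indicator K x"
  shows "integrable \<mu> F"
proof (rule Bochner_Integration.integrable_bound)
  show "integrable \<mu> (\<lambda>x. M * indicator K x :: real)"
    using haar_compact[OF assms(2)] compact_imp_closed[OF assms(2)]
    by (intro integrable_mult_right integrable_real_indicator) auto
  show "F \<in> borel_measurable \<mu>" using assms(1) by (simp add: measurable_haar)
  show "AE x in \<mu>. norm (F x) \<le> norm (M * indicator K x)"
    using assms(3) order_trans[OF assms(3) abs_ge_self] by simp
qed

lemma compact_support_bounded:
  assumes "continuous_on UNIV F" "compact K" "\<And>x. x \<notin> K \<Longrightarrow> F x = (0::real)"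
  obtains M where "M > 0" "\<And>x. \<bar>F x\<bar> \<le> M * indicator K x"
proof -
  have "compact (F ` K)" by (intro compact_continuous_image assms(2) continuous_on_subset[OF assms(1)]) auto
  then have "bounded (F ` K)" by (rule compact_imp_bounded)
  then obtain M where M: "M > 0" "\<forall>y\<in>F ` K. norm y \<le> M" by (auto simp only: bounded_pos)
  have "\<bar>F x\<bar> \<le> M * indicator K x" for x
    using M(2) assms(3)[of x] by (cases "x \<in> K") auto
  then show ?thesis using that M(1) by blast
qed

lemma integrable_haar_compact_support:
  assumes "continuous_on UNIV F" "compact K" "\<And>x. x \<notin> K \<Longrightarrow> F x = (0::real)"
  shows "integrable \<mu> F"
proof -
  obtain M where "\<And>x. \<bar>F x\<bar> \<le> M * indicator K x"
    using compact_support_bounded[OF assms] by metis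
  then show ?thesis
    by (rule integrable_haar_compact[OF borel_measurable_continuous_onI[OF assms(1)] assms(2)])
qed

text \<open>Right translation by \<open>\<gamma> t\<close> multiplies the integral of
  \<open>F\<close> by \<open>c t\<close>, so the difference quotient of \<open>F\<close> has
  integral \<open>(c t - 1) / t\<close> times that of \<open>F\<close>. Dominated convergence along
  \<open>t = \<tau> / (n + 1)\<close> passes to the derivative, with no assumption on the behaviour
  of \<open>c\<close> near 0.\<close>

lemma integral_right_transl_difference_quotient:
  fixes \<gamma> :: "real \<Rightarrow> 'g" and F F' :: "'g \<Rightarrow> real"
  assumes \<gamma>: "\<tau> > 0" "\<gamma> 0 = \<one>" "continuous_on {- \<tau>..\<tau>} \<gamma>"
    and c: "\<And>t. c t > 0" "\<And>t. distr \<mu> borel (\<lambda>y. y \<otimes> \<gamma> t) = density \<mu> (\<lambda>_. ennreal (c t))"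
    and F: "continuous_on UNIV F" "compact K" "\<And>x. x \<notin> K \<Longrightarrow> F x = 0"
    and F': "\<And>g. ((\<lambda>t. F (g \<otimes> \<gamma> t)) has_real_derivative F' g) (at 0)"
    and L: "\<And>g t. t \<in> {- \<tau>..\<tau>} \<Longrightarrow> \<bar>F (g \<otimes> \<gamma> t) - F g\<bar> \<le> L * \<bar>t\<bar>"
  shows "(\<lambda>n. (c (\<tau> / real (Suc n)) - 1) / (\<tau> / real (Suc n)) * integral\<^sup>L \<mu> F) \<longlonglongrightarrow> integral\<^sup>L \<mu> F'"
proof -
  define t where "t n = \<tau> / real (Suc n)" for n
  have t: "t n \<noteq> 0" "t n > 0" "t n \<in> {- \<tau>..\<tau>}" for n
  proof -
    show "t n > 0" using \<gamma>(1) by (simp add: t_def)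
    then show "t n \<noteq> 0" by simp
    have "t n \<le> \<tau> / 1" unfolding t_def using \<gamma>(1) by (intro divide_left_mono) auto
    then show "t n \<in> {- \<tau>..\<tau>}" using \<open>t n > 0\<close> by simp
  qed
  have t0: "t \<longlonglongrightarrow> 0" unfolding t_def by (rule LIMSEQ_Suc[OF lim_const_over_n])
  have F_int: "integrable \<mu> F" by (rule integrable_haar_compact_support[OF F])
  have [measurable]: "F \<in> borel_measurable borel" using F by (intro borel_measurable_continuous_onI)
  have transl_int: "integrable \<mu> (\<lambda>g. F (g \<otimes> \<gamma> t))" for t
  proof -
    have "integrable (distr \<mu> borel (\<lambda>y. y \<otimes> \<gamma> t)) F"
      unfolding c(2) by (subst integrable_density) (use F_int c(1)[of t] in \<open>auto simp: less_imp_le\<close>)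
    then show ?thesis by (subst (asm) integrable_distr_eq) simp_all
  qed
  have transl: "(\<integral>g. F (g \<otimes> \<gamma> t) \<partial>\<mu>) = c t * integral\<^sup>L \<mu> F" for t
  proof -
    have "(\<integral>g. F (g \<otimes> \<gamma> t) \<partial>\<mu>) = integral\<^sup>L (distr \<mu> borel (\<lambda>y. y \<otimes> \<gamma> t)) F"
      by (subst integral_distr) simp_all
    also have "\<dots> = c t * integral\<^sup>L \<mu> F"
      unfolding c(2) by (subst integral_density) (use c(1)[of t] in \<open>auto simp: less_imp_le\<close>)
    finally show ?thesis .
  qed
  define s where "s n g = (F (g \<otimes> \<gamma> (t n)) - F g) / t n" for n g
  \<comment> \<open>One compact set that contains the supports of all the difference quotients, so
    that a multiple of its indicator dominates them.\<close>
  let ?K = "(\<lambda>z. fst z \<otimes> inv (\<gamma> (snd z))) ` (K \<times> {- \<tau>..\<tau>})"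
  have K': "compact ?K"
    by (intro compact_continuous_image compact_Times F(2) compact_Icc continuous_on_group_mult
        continuous_on_group_inv continuous_on_compose2[OF \<gamma>(3)] continuous_intros) auto
  have lim: "(\<lambda>n. s n g) \<longlonglongrightarrow> F' g" for g
  proof -
    have "((\<lambda>h. (F (g \<otimes> \<gamma> (0 + h)) - F (g \<otimes> \<gamma> 0)) / h) \<longlongrightarrow> F' g) (at 0)"
      using F'[of g] unfolding DERIV_def .
    moreover have "filterlim t (at 0) sequentially"
      using t0 t by (simp add: filterlim_at)
    ultimately have "((\<lambda>n. (F (g \<otimes> \<gamma> (0 + t n)) - F (g \<otimes> \<gamma> 0)) / t n) \<longlongrightarrow> F' g) sequentially"
      by (rule filterlim_compose)
    then show ?thesis by (simp add: s_def \<gamma>)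
  qed
  have s_bound: "\<bar>s n g\<bar> \<le> L * indicator ?K g" for n g
  proof (cases "g \<in> ?K")
    case True
    have "\<bar>s n g\<bar> = \<bar>F (g \<otimes> \<gamma> (t n)) - F g\<bar> / t n" using t[of n] by (simp add: s_def)
    also have "\<dots> \<le> L" using L[OF t(3), of g n] t[of n] by (simp add: field_simps)
    finally show ?thesis using True by simp
  next
    case False
    have z: "F (g \<otimes> \<gamma> r) = 0" if r: "r \<in> {- \<tau>..\<tau>}" for r
    proof (rule F(3), rule notI)
      assume "g \<otimes> \<gamma> r \<in> K"
      then have "(g \<otimes> \<gamma> r) \<otimes> inv (\<gamma> r) \<in> ?K"
        using r by (intro image_eqI[of _ _ "(g \<otimes> \<gamma> r, r)"]) auto
      then show False using False by (simp add: m_assoc)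
    qed
    show ?thesis using z[OF t(3)] z[of 0] \<gamma> False by (simp add: s_def)
  qed
  have "(\<lambda>n. integral\<^sup>L \<mu> (s n)) \<longlonglongrightarrow> integral\<^sup>L \<mu> F'"
  proof (rule integral_dominated_convergence[where w = "\<lambda>g. L * indicator ?K g"])
    show s_meas: "s n \<in> borel_measurable \<mu>" for n
      unfolding s_def measurable_haar by measurable
    show "F' \<in> borel_measurable \<mu>"
      by (rule borel_measurable_LIMSEQ_real[OF lim s_meas])
    show "integrable \<mu> (\<lambda>g. L * indicator ?K g :: real)"
      using haar_compact[OF K'] compact_imp_closed[OF K']
      by (intro integrable_mult_right integrable_real_indicator) auto
  qed (use lim s_bound in auto)
  moreover have "integral\<^sup>L \<mu> (s n) = (c (t n) - 1) / t n * integral\<^sup>L \<mu> F" for n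
    unfolding s_def using transl_int F_int by (simp add: transl left_diff_distrib diff_divide_distrib)
  ultimately show ?thesis by (simp add: t_def)
qed

text \<open>
  The constant \<open>\<kappa>\<close> is the derivative at \<open>t = 0\<close> of the modular function along \<open>\<gamma>\<close>. The
  functions \<open>F\<close> are only required to be Lipschitz along \<open>\<gamma>\<close>, which allows nonlinear
  expressions in test functions.
\<close>

lemma lie_algebra_divergence:
  assumes X: "X \<in> lie_algebra G A"
  obtains \<gamma> :: "real \<Rightarrow> 'g" and \<tau> \<kappa> :: real where "\<tau> > 0" "\<gamma> 0 = \<one>"
    "\<And>u g. u \<in> smooth_functions A \<Longrightarrow>
      ((\<lambda>t. u (g \<otimes> \<gamma> t)) has_real_derivative X u g) (at 0)"
    "\<And>u. u \<in> test_functions A UNIV \<Longrightarrow>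
      \<exists>L. \<forall>g. \<forall>t\<in>{- \<tau>..\<tau>}. \<bar>u (g \<otimes> \<gamma> t) - u g\<bar> \<le> L * \<bar>t\<bar>"
    "\<And>F F' K L. continuous_on UNIV F \<Longrightarrow> compact K \<Longrightarrow> (\<And>x. x \<notin> K \<Longrightarrow> F x = 0) \<Longrightarrow>
      (\<And>g. ((\<lambda>t. F (g \<otimes> \<gamma> t)) has_real_derivative F' g) (at 0)) \<Longrightarrow>
      (\<And>g t. t \<in> {- \<tau>..\<tau>} \<Longrightarrow> \<bar>F (g \<otimes> \<gamma> t) - F g\<bar> \<le> L * \<bar>t\<bar>) \<Longrightarrow>
      integral\<^sup>L \<mu> F' = \<kappa> * integral\<^sup>L \<mu> F"
proof (rule lie_algebra_curve[OF X], goal_cases)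
  case (1 \<gamma> \<tau>)
  note \<gamma> = 1(2-6)
  have "\<exists>c::real. c > 0 \<and> distr \<mu> borel (\<lambda>y. y \<otimes> s) = density \<mu> (\<lambda>_. ennreal c)" for s
    using haar_right_transl by metis
  then have "\<forall>t. \<exists>c::real. c > 0 \<and> distr \<mu> borel (\<lambda>y. y \<otimes> \<gamma> t) = density \<mu> (\<lambda>_. ennreal c)" by simp
  from choice[OF this] obtain c where c': "\<forall>t. c t > (0::real) \<and>
    distr \<mu> borel (\<lambda>y. y \<otimes> \<gamma> t) = density \<mu> (\<lambda>_. ennreal (c t))" ..
  have c: "\<And>t. c t > 0" "\<And>t. distr \<mu> borel (\<lambda>y. y \<otimes> \<gamma> t) = density \<mu> (\<lambda>_. ennreal (c t))"
    using spec[OF c'] by simp_all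
  note quot = integral_right_transl_difference_quotient[where \<gamma> = \<gamma> and \<tau> = \<tau> and c = c, OF \<gamma>(1,2,4) c]
  obtain b where b: "b \<in> test_functions A UNIV" "b \<one> = 1" "\<And>y. b y \<ge> 0"
    using bump_function[of UNIV \<one>] by auto
  have bs: "b \<in> smooth_functions A" by (rule test_functions_smooth[OF b(1)])
  let ?S = "closure {y. b y \<noteq> 0}"
  have S: "compact ?S" "\<And>y. y \<notin> ?S \<Longrightarrow> b y = 0"
    using b(1) closure_subset[of "{y. b y \<noteq> 0}"] by (auto simp: test_functions_def)
  have [measurable]: "b \<in> borel_measurable borel" by (rule smooth_functions_measurable[OF bs])
  have "integral\<^sup>L \<mu> b = enn2real (\<integral>\<^sup>+x. ennreal (b x) \<partial>\<mu>)"
    using b by (intro integral_eq_nn_integral) (auto simp: measurable_haar)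
  moreover have "0 < (\<integral>\<^sup>+x. ennreal (b x) \<partial>\<mu>)" "(\<integral>\<^sup>+x. ennreal (b x) \<partial>\<mu>) < \<infinity>"
    using nn_integral_transl_bump[OF b, of \<one>] by simp_all
  ultimately have bpos: "integral\<^sup>L \<mu> b > 0" by (simp add: enn2real_positive_iff)
  obtain Lb where Lb: "\<forall>g. \<forall>t\<in>{- \<tau>..\<tau>}. \<bar>b (g \<otimes> \<gamma> t) - b g\<bar> \<le> Lb * \<bar>t\<bar>"
    using \<gamma>(5)[OF b(1)] by blast
  \<comment> \<open>Applied to \<open>b\<close>, whose integral is not zero, the preceding lemma
    forces the sequence \<open>m\<close> to converge. Its limit is \<open>\<kappa>\<close>, and for
    any other \<open>F\<close> the formula follows from uniqueness of limits.\<close>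
  define m where "m n = (c (\<tau> / real (Suc n)) - 1) / (\<tau> / real (Suc n))" for n
  have "(\<lambda>n. m n * integral\<^sup>L \<mu> b) \<longlonglongrightarrow> integral\<^sup>L \<mu> (X b)"
    unfolding m_def by (rule quot[where L = Lb, OF smooth_functions_cont[OF bs] S \<gamma>(3)[OF bs]]) (use Lb in auto)
  from tendsto_divide[OF this tendsto_const[of "integral\<^sup>L \<mu> b"]]
  have m: "m \<longlonglongrightarrow> integral\<^sup>L \<mu> (X b) / integral\<^sup>L \<mu> b" using bpos by simp
  show ?case
  proof (rule 1(1)[of \<tau> \<gamma> "integral\<^sup>L \<mu> (X b) / integral\<^sup>L \<mu> b"])
    fix F F' :: "'g \<Rightarrow> real" and K L
    assume F: "continuous_on UNIV F" "compact K" "\<And>x. x \<notin> K \<Longrightarrow> F x = 0"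
      "\<And>g. ((\<lambda>t. F (g \<otimes> \<gamma> t)) has_real_derivative F' g) (at 0)"
      "\<And>g t. t \<in> {- \<tau>..\<tau>} \<Longrightarrow> \<bar>F (g \<otimes> \<gamma> t) - F g\<bar> \<le> L * \<bar>t\<bar>"
    have "(\<lambda>n. m n * integral\<^sup>L \<mu> F) \<longlonglongrightarrow> integral\<^sup>L \<mu> F'"
      unfolding m_def by (rule quot[OF F])
    moreover have "(\<lambda>n. m n * integral\<^sup>L \<mu> F) \<longlonglongrightarrow> integral\<^sup>L \<mu> (X b) / integral\<^sup>L \<mu> b * integral\<^sup>L \<mu> F"
      by (rule tendsto_mult_right[OF m])
    ultimately show "integral\<^sup>L \<mu> F' = integral\<^sup>L \<mu> (X b) / integral\<^sup>L \<mu> b * integral\<^sup>L \<mu> F"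
      by (rule LIMSEQ_unique)
  qed (fact \<gamma>)+
qed

end

section \<open>An interpolation inequality\<close>

text \<open>The right-hand side is the derivative of \<open>u v D powr r\<close> along a field for
  which \<open>v\<close> is the derivative of \<open>u\<close> and \<open>w\<close> that of
  \<open>v\<close>. Its first term is \<open>D powr (r + 1)\<close> up to
  \<open>E * D powr r\<close>; the other terms are estimated by
  \<open>\<bar>u\<bar> \<le> e * sqrt D\<close>, \<open>v\<^sup>2 \<le> D\<close> and
  \<open>(u / e)\<^sup>2 \<le> E\<close>.\<close>

lemma powr_interpolation_pointwise:
  fixes u v w e \<delta> r D s E :: real
  assumes e: "e > 0" and \<delta>: "\<delta> > 0"
    and E: "E = (u / e)\<^sup>2 + \<delta>" and D: "D = v\<^sup>2 + E"
  shows "D powr (r + 1) - (1 + 2 * \<bar>r\<bar>) * (E * D powr r) - (1 + 2 * \<bar>r\<bar>) * e * (\<bar>w\<bar> * D powr (r + 1 / 2))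
    \<le> v * v * D powr r + u * w * D powr r +
      u * v * (r * D powr (r - 1) * (2 * v * w + 2 * u * v / e\<^sup>2))"
proof -
  have E0: "E > 0" using \<delta> by (simp add: E add_nonneg_pos)
  have D0: "D > 0" using E0 by (simp add: D add_nonneg_pos)
  \<comment> \<open>After division by \<open>y\<close> all powers of \<open>D\<close> become
    polynomials in \<open>s = sqrt D\<close>, and the claim becomes polynomial apart from absolute
    values.\<close>
  define y where "y = D powr (r - 1)"
  define s where "s = sqrt D"
  have y: "y > 0" using D0 by (simp add: y_def)
  have s: "s > 0" "s * s = D" using D0 by (simp_all add: s_def)
  have Dr: "D powr r = D * y"
    using D0 by (simp add: y_def powr_diff)
  have Dr1: "D powr (r + 1) = D * D * y"
    using D0 by (simp add: powr_add Dr)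
  have Dr2: "D powr (r + 1 / 2) = s * D * y"
    using D0 by (simp add: powr_add Dr s_def powr_half_sqrt)
  have "(u / e)\<^sup>2 \<le> s\<^sup>2" using s by (simp add: power2_eq_square D E \<delta> less_imp_le)
  then have "\<bar>u / e\<bar> \<le> s" using s(1) by (simp add: abs_le_square_iff[symmetric])
  then have u: "\<bar>u\<bar> \<le> e * s" using e by (simp add: pos_divide_le_eq mult.commute)
  have vD: "v\<^sup>2 \<le> D" using E0 by (simp add: D)
  have ueE: "(u / e)\<^sup>2 \<le> E" using \<delta> by (simp add: E)
  have 1: "v * v * D = D * D - E * D" by (simp add: D power2_eq_square algebra_simps)
  have 2: "- (e * s * \<bar>w\<bar> * D) \<le> u * w * D"
  proof -
    have "\<bar>u * w * D\<bar> \<le> e * s * \<bar>w\<bar> * D"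
      using u D0 by (simp add: abs_mult mult_right_mono)
    then show ?thesis by linarith
  qed
  have 3: "- (2 * \<bar>r\<bar> * (e * s * \<bar>w\<bar> * D)) \<le> 2 * r * u * v\<^sup>2 * w"
  proof -
    have "\<bar>2 * r * u * v\<^sup>2 * w\<bar> = 2 * \<bar>r\<bar> * (\<bar>u\<bar> * v\<^sup>2 * \<bar>w\<bar>)" by (simp add: abs_mult)
    also have "\<dots> \<le> 2 * \<bar>r\<bar> * ((e * s) * D * \<bar>w\<bar>)"
      using u vD e s by (intro mult_left_mono mult_right_mono mult_mono) auto
    finally have "\<bar>2 * r * u * v\<^sup>2 * w\<bar> \<le> 2 * \<bar>r\<bar> * (e * s * \<bar>w\<bar> * D)" by (simp add: mult_ac)
    then show ?thesis by linarith
  qed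
  have 4: "- (2 * \<bar>r\<bar> * (E * D)) \<le> 2 * r * (u / e)\<^sup>2 * v\<^sup>2"
  proof -
    have "\<bar>2 * r * (u / e)\<^sup>2 * v\<^sup>2\<bar> = 2 * \<bar>r\<bar> * ((u / e)\<^sup>2 * v\<^sup>2)" by (simp add: abs_mult)
    also have "\<dots> \<le> 2 * \<bar>r\<bar> * (E * D)"
      using ueE vD E0 by (intro mult_left_mono mult_mono) auto
    finally show ?thesis by linarith
  qed
  have "D * D - (1 + 2 * \<bar>r\<bar>) * (E * D) - (1 + 2 * \<bar>r\<bar>) * e * (\<bar>w\<bar> * (s * D)) \<le>
      v * v * D + u * w * D + 2 * r * u * v\<^sup>2 * w + 2 * r * (u / e)\<^sup>2 * v\<^sup>2"
    using 1 2 3 4 by (simp add: algebra_simps)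
  then have "(D * D - (1 + 2 * \<bar>r\<bar>) * (E * D) - (1 + 2 * \<bar>r\<bar>) * e * (\<bar>w\<bar> * (s * D))) * y \<le>
      (v * v * D + u * w * D + 2 * r * u * v\<^sup>2 * w + 2 * r * (u / e)\<^sup>2 * v\<^sup>2) * y"
    using y by (intro mult_right_mono) auto
  then show ?thesis
    unfolding Dr Dr1 Dr2 y_def[symmetric]
    by (simp add: algebra_simps power2_eq_square power_divide)
qed

text \<open>A form of Young's inequality that also covers negative \<open>r\<close>: either
  \<open>E \<le> \<eta> * D\<close> and the first term suffices, or
  \<open>D \<le> E / \<eta>\<close> and the second one does.\<close>

lemma mult_powr_le_split:
  fixes E D r \<eta> :: real
  assumes "0 < E" "E \<le> D" "\<eta> > 0" "r + 1 \<ge> 0"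
  shows "E * D powr r \<le> \<eta> * D powr (r + 1) + (E / \<eta>) powr (r + 1)"
proof (cases "E \<le> \<eta> * D")
  case True
  then have "E * D powr r \<le> \<eta> * D * D powr r" by (intro mult_right_mono) auto
  also have "\<dots> = \<eta> * D powr (r + 1)" using assms by (simp add: powr_add)
  finally show ?thesis by (simp add: add_increasing2)
next
  case False
  then have "D \<le> E / \<eta>" using assms by (simp add: field_simps)
  then have "D powr (r + 1) \<le> (E / \<eta>) powr (r + 1)" using assms by (intro powr_mono2) auto
  moreover have "E * D powr r \<le> D powr (r + 1)" using assms by (simp add: powr_add mult_right_mono mult.commute)
  moreover have "0 \<le> \<eta> * D powr (r + 1)" using assms by simp
  ultimately show ?thesis by linarith
qed

text \<open>Compare \<open>\<bar>w\<bar>\<close> with the square root of \<open>D\<close> and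
  replace the smaller by the larger.\<close>

lemma mult_powr_le_add_powr:
  fixes w D p :: real
  assumes "D > 0" "p \<ge> 1"
  shows "\<bar>w\<bar> * D powr ((p - 1) / 2) \<le> D powr (p / 2) + \<bar>w\<bar> powr p"
proof (cases "\<bar>w\<bar> \<le> D powr (1 / 2)")
  case True
  then have "\<bar>w\<bar> * D powr ((p - 1) / 2) \<le> D powr (1 / 2) * D powr ((p - 1) / 2)" by (intro mult_right_mono) auto
  also have "\<dots> = D powr (p / 2)" by (simp flip: powr_add add: field_simps)
  finally show ?thesis by (simp add: add_increasing2)
next
  case False
  then have w: "\<bar>w\<bar> > D powr (1 / 2)" by simp
  have w0: "\<bar>w\<bar> > 0" using w by (smt (verit) powr_ge_zero)
  have "D powr ((p - 1) / 2) = (D powr (1 / 2)) powr (p - 1)" by (simp add: powr_powr)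
  also have "\<dots> \<le> \<bar>w\<bar> powr (p - 1)" using w assms by (intro powr_mono2) auto
  finally have "\<bar>w\<bar> * D powr ((p - 1) / 2) \<le> \<bar>w\<bar> * \<bar>w\<bar> powr (p - 1)" by (intro mult_left_mono) auto
  also have "\<dots> = \<bar>w\<bar> powr p" using w0 by (simp add: powr_diff)
  finally show ?thesis by (simp add: add_increasing)
qed

lemma powr_add_le:
  fixes a b q :: real
  assumes "a \<ge> 0" "b \<ge> 0" "q \<ge> 0"
  shows "(a + b) powr q \<le> 2 powr q * (a powr q + b powr q)"
proof -
  have "(a + b) powr q \<le> (2 * max a b) powr q" using assms by (intro powr_mono2) auto
  also have "\<dots> = 2 powr q * max a b powr q" using assms by (simp add: powr_mult)
  also have "\<dots> \<le> 2 powr q * (a powr q + b powr q)"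
    by (intro mult_left_mono) (auto simp: max_def)
  finally show ?thesis .
qed

text \<open>Since \<open>\<delta> > 0\<close>, the base of the power stays away from 0, so
  \<open>H\<close> is continuously differentiable for every exponent \<open>r\<close>, negative ones
  included. Its gradient is bounded on the compact square, and the mean value inequality along the
  segment gives the bound.\<close>

lemma product_powr_lipschitz:
  fixes e \<delta> r M :: real
  assumes e: "e > 0" and \<delta>: "\<delta> > 0"
  defines "H \<equiv> \<lambda>u v. u * v * (v\<^sup>2 + ((u / e)\<^sup>2 + \<delta>)) powr r"
  obtains L where "L \<ge> 0" "\<And>u v u' v'. \<bar>u\<bar> \<le> M \<Longrightarrow> \<bar>v\<bar> \<le> M \<Longrightarrow> \<bar>u'\<bar> \<le> M \<Longrightarrow> \<bar>v'\<bar> \<le> M \<Longrightarrow>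
    \<bar>H u' v' - H u v\<bar> \<le> L * (\<bar>u' - u\<bar> + \<bar>v' - v\<bar>)"
proof -
  define D where "D z = (snd z)\<^sup>2 + ((fst z / e)\<^sup>2 + \<delta>)" for z :: "real \<times> real"
  have D0: "D z > 0" for z using \<delta> by (auto simp: D_def intro!: add_nonneg_pos)
  then have D0': "D z \<noteq> 0" for z by (metis less_irrefl)
  \<comment> \<open>\<open>Hu\<close> and \<open>Hv\<close> are the partial derivatives of
    \<open>H\<close>.\<close>
  define Hu where "Hu z = snd z * D z powr r + fst z * snd z * (r * D z powr (r - 1) * (2 * fst z / e\<^sup>2))" for z
  define Hv where "Hv z = fst z * D z powr r + fst z * snd z * (r * D z powr (r - 1) * (2 * snd z))" for z
  have cD: "continuous_on S D" for S unfolding D_def by (intro continuous_intros) (use e in auto)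
  have cont: "continuous_on S Hu" "continuous_on S Hv" for S
    unfolding Hu_def Hv_def by (intro continuous_intros cD; use D0' e in simp)+
  let ?B = "{- M..M} \<times> {- M..M}"
  have "compact (Hu ` ?B)" "compact (Hv ` ?B)"
    by (intro compact_continuous_image cont compact_Times compact_Icc)+
  then have "bounded (Hu ` ?B)" "bounded (Hv ` ?B)" by (auto intro: compact_imp_bounded)
  then obtain L1 L2 where L1: "L1 > 0" "\<forall>y\<in>Hu ` ?B. norm y \<le> L1" and L2: "L2 > 0" "\<forall>y\<in>Hv ` ?B. norm y \<le> L2"
    by (auto simp only: bounded_pos)
  have "\<bar>H u' v' - H u v\<bar> \<le> (L1 + L2) * (\<bar>u' - u\<bar> + \<bar>v' - v\<bar>)"
    if M: "\<bar>u\<bar> \<le> M" "\<bar>v\<bar> \<le> M" "\<bar>u'\<bar> \<le> M" "\<bar>v'\<bar> \<le> M" for u v u' v'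
  proof -
    define z where "z s = (u + s * (u' - u), v + s * (v' - v))" for s :: real
    have zB: "z s \<in> ?B" if s: "s \<in> {0..1}" for s
    proof -
      have "\<bar>(1 - s) * a + s * b\<bar> \<le> M" if "\<bar>a\<bar> \<le> M" "\<bar>b\<bar> \<le> M" for a b :: real
      proof -
        have "\<bar>(1 - s) * a + s * b\<bar> \<le> (1 - s) * \<bar>a\<bar> + s * \<bar>b\<bar>"
          using s abs_triangle_ineq[of "(1 - s) * a" "s * b"] by (simp add: abs_mult)
        also have "\<dots> \<le> (1 - s) * M + s * M" using s that by (intro add_mono mult_left_mono) auto
        finally show ?thesis by (simp add: algebra_simps)
      qed
      from this[OF M(1,3)] this[OF M(2,4)] show ?thesis
        by (auto simp: z_def algebra_simps abs_le_iff)
    qed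
    have "norm (H (fst (z 1)) (snd (z 1)) - H (fst (z 0)) (snd (z 0))) \<le>
        ((L1 + L2) * (\<bar>u' - u\<bar> + \<bar>v' - v\<bar>)) * norm (1 - 0 :: real)"
    proof (rule field_differentiable_bound[of "{0..1}"])
      fix s :: real assume s: "s \<in> {0..1}"
      let ?d = "Hu (z s) * (u' - u) + Hv (z s) * (v' - v)"
      have zu: "((\<lambda>s. fst (z s)) has_real_derivative (u' - u)) (at s)"
        and zv: "((\<lambda>s. snd (z s)) has_real_derivative (v' - v)) (at s)"
        unfolding z_def by (auto intro!: derivative_eq_intros)
      have zD: "((\<lambda>s. D (z s)) has_real_derivative
          (2 * snd (z s) * (v' - v) + 2 * fst (z s) / e\<^sup>2 * (u' - u))) (at s)"
        unfolding D_def using e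
        by (auto intro!: derivative_eq_intros zu zv simp: power2_eq_square field_simps)
      have "((\<lambda>s. H (fst (z s)) (snd (z s))) has_real_derivative
          (fst (z s) * snd (z s) * (r * D (z s) powr (r - 1) *
            (2 * snd (z s) * (v' - v) + 2 * fst (z s) / e\<^sup>2 * (u' - u))) +
          (fst (z s) * (v' - v) + (u' - u) * snd (z s)) * D (z s) powr r)) (at s)"
        unfolding H_def D_def[symmetric, of "(_, _)", simplified]
        using DERIV_mult[OF DERIV_mult[OF zu zv] DERIV_fun_powr[OF zD D0, of r]]
        by (simp add: D_def add.commute mult.commute)
      moreover have "(fst (z s) * snd (z s) * (r * D (z s) powr (r - 1) *
            (2 * snd (z s) * (v' - v) + 2 * fst (z s) / e\<^sup>2 * (u' - u))) +
          (fst (z s) * (v' - v) + (u' - u) * snd (z s)) * D (z s) powr r) = ?d"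
        by (simp add: Hu_def Hv_def algebra_simps)
      ultimately show "((\<lambda>s. H (fst (z s)) (snd (z s))) has_field_derivative ?d) (at s within {0..1})"
        by (simp add: has_field_derivative_at_within)
      have "\<bar>?d\<bar> \<le> \<bar>Hu (z s)\<bar> * \<bar>u' - u\<bar> + \<bar>Hv (z s)\<bar> * \<bar>v' - v\<bar>"
        using abs_triangle_ineq[of "Hu (z s) * (u' - u)" "Hv (z s) * (v' - v)"] by (simp add: abs_mult)
      also have "\<dots> \<le> L1 * \<bar>u' - u\<bar> + L2 * \<bar>v' - v\<bar>"
        using bspec[OF L1(2) imageI[OF zB[OF s]]] bspec[OF L2(2) imageI[OF zB[OF s]]]
        by (intro add_mono mult_right_mono) auto
      also have "\<dots> \<le> (L1 + L2) * (\<bar>u' - u\<bar> + \<bar>v' - v\<bar>)"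
        using L1 L2 by (simp add: algebra_simps)
      finally show "norm ?d \<le> (L1 + L2) * (\<bar>u' - u\<bar> + \<bar>v' - v\<bar>)" by simp
    qed auto
    then show ?thesis by (simp add: z_def)
  qed
  then show ?thesis using that[of "L1 + L2"] L1 L2 by simp
qed

lemma square_powr_half:
  fixes x p :: real
  shows "(x\<^sup>2) powr (p / 2) = \<bar>x\<bar> powr p"
proof (cases "x = 0")
  case False
  then have "\<bar>x\<bar> powr p = (\<bar>x\<bar> powr 2) powr (p / 2)" by (simp only: powr_powr) simp
  then show ?thesis using False by simp
qed simp

text \<open>Serves to let the regularisation parameter \<open>\<delta>\<close> tend to 0; for an
  error \<open>\<epsilon>\<close> one takes \<open>\<delta> = \<sigma> powr (1 / q)\<close>.\<close>

lemma le_if_le_add_powr: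
  fixes a b B q :: real
  assumes "q > 0" "\<And>\<delta>. \<delta> > 0 \<Longrightarrow> a \<le> b + B * \<delta> powr q"
  shows "a \<le> b"
proof (rule field_le_epsilon)
  fix \<epsilon> :: real assume \<epsilon>: "\<epsilon> > 0"
  define \<sigma> where "\<sigma> = \<epsilon> / (\<bar>B\<bar> + 1)"
  have \<sigma>: "\<sigma> > 0" using \<epsilon> by (simp add: \<sigma>_def add_nonneg_pos)
  have "a \<le> b + B * (\<sigma> powr (1 / q)) powr q" using \<sigma> by (intro assms(2)) simp
  also have "(\<sigma> powr (1 / q)) powr q = \<sigma>" using \<sigma> assms(1) by (simp add: powr_powr)
  also have "b + B * \<sigma> \<le> b + (\<bar>B\<bar> + 1) * \<sigma>" using \<sigma> by (intro add_left_mono mult_right_mono) auto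
  also have "(\<bar>B\<bar> + 1) * \<sigma> = \<epsilon>" by (simp add: \<sigma>_def add_nonneg_pos)
  finally show "a \<le> b + \<epsilon>" .
qed

context haar_lie_grp
begin

lemma test_functions_support:
  assumes "u \<in> test_functions A \<Omega>"
  shows "compact (closure {x. u x \<noteq> 0})" "x \<notin> closure {x. u x \<noteq> 0} \<Longrightarrow> u x = 0"
  using assms closure_subset[of "{x. u x \<noteq> 0}"] by (auto simp: test_functions_def)

lemma test_functions_cont: "u \<in> test_functions A \<Omega> \<Longrightarrow> continuous_on S u"
  using smooth_functions_cont[OF test_functions_smooth] continuous_on_subset by blast

lemma test_functions_integrable_powr:
  assumes "u \<in> test_functions A \<Omega>" "p \<ge> 1"
  shows "integrable \<mu> (\<lambda>x. \<bar>u x\<bar> powr p)"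
proof (rule integrable_haar_compact_support[OF _ test_functions_support(1)[OF assms(1)]])
  show "continuous_on UNIV (\<lambda>x. \<bar>u x\<bar> powr p)"
    using assms by (intro continuous_on_powr' continuous_intros test_functions_cont) auto
  fix x assume "x \<notin> closure {x. u x \<noteq> 0}"
  then have "u x = 0" by (rule test_functions_support(2)[OF assms(1)])
  then show "\<bar>u x\<bar> powr p = 0" by simp
qed

text \<open>Applied to powers of the regularised expression \<open>D\<close>: off the support of
  \<open>u\<close> it equals the constant \<open>\<delta>\<close>, so it is integrated over a
  compact set only.\<close>

lemma integrable_haar_indicator_mult:
  fixes f :: "'g \<Rightarrow> real"
  assumes "continuous_on UNIV f" "compact K"
  shows "integrable \<mu> (\<lambda>x. indicator K x * f x)"
proof -
  have "compact (f ` K)" by (intro compact_continuous_image assms(2) continuous_on_subset[OF assms(1)]) auto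
  then have "bounded (f ` K)" by (rule compact_imp_bounded)
  then obtain M where M: "\<forall>y\<in>f ` K. norm y \<le> M" by (auto simp only: bounded_iff)
  have [measurable]: "f \<in> borel_measurable borel" "K \<in> sets borel"
    using assms compact_imp_closed[OF assms(2)] by (auto intro: borel_measurable_continuous_onI)
  show ?thesis
    by (rule integrable_haar_compact[OF _ assms(2), of _ M])
      (use M in \<open>auto simp: indicator_def abs_mult\<close>)
qed

text \<open>
  Integrate \<open>X F\<close> for \<open>F = u v D\<^bsup>p/2-1\<^esup>\<close>, where \<open>v = X u\<close> and
  \<open>D = v\<^sup>2 + (u/e)\<^sup>2 + \<delta>\<close>, a regularisation of \<open>sgn v \<bar>v\<bar>\<^bsup>p-1\<^esup>\<close> times \<open>u\<close> truncated at
  height \<open>e \<bar>v\<bar>\<close>. The truncation is what makes \<open>p < 2\<close>, and in particular \<open>p = 1\<close>, work.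
\<close>

lemma lie_algebra_interpolation:
  assumes X: "X \<in> lie_algebra G A" and p: "p \<ge> 1" and \<epsilon>: "\<epsilon> > 0"
  obtains C :: real where "C \<ge> 0" "\<And>u. u \<in> test_functions A UNIV \<Longrightarrow>
    (\<integral>x. \<bar>X u x\<bar> powr p \<partial>\<mu>) \<le> \<epsilon> * (\<integral>x. \<bar>X (X u) x\<bar> powr p \<partial>\<mu>) + C * (\<integral>x. \<bar>u x\<bar> powr p \<partial>\<mu>)"
proof (rule lie_algebra_divergence[OF X], goal_cases)
  case (1 \<gamma> \<tau> \<kappa>)
  note \<tau> = 1(2) and \<gamma>0 = 1(3) and \<gamma>_deriv = 1(4) and \<gamma>_lip = 1(5) and div = 1(6)
  define r where "r = p / 2 - 1"
  have r: "r + 1 = p / 2" "r + 1 / 2 = (p - 1) / 2" by (simp_all add: r_def field_simps)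
  define c1 where "c1 = 1 + 2 * \<bar>r\<bar>"
  have c1: "c1 \<ge> 1" by (simp add: c1_def)
  \<comment> \<open>In units of \<open>D powr (p / 2)\<close>, the term with \<open>E\<close> costs
    1/4 by the choice of \<open>\<eta>\<close> and the term with \<open>w\<close> costs 1/8 by the
    choice of \<open>e\<close>, which leaves 5/8. The term with \<open>\<kappa>\<close> costs
    another 1/8, so half remains. The third bound on \<open>e\<close> makes the final coefficient of
    \<open>\<bar>X (X u)\<bar> powr p\<close> at most \<open>\<epsilon>\<close>.\<close>
  define \<eta> where "\<eta> = 1 / (4 * c1)"
  have \<eta>: "\<eta> > 0" "c1 * \<eta> = 1 / 4" using c1 by (simp_all add: \<eta>_def)
  define e where "e = min (1 / (8 * c1)) (min (1 / (8 * (\<bar>\<kappa>\<bar> + 1))) (\<epsilon> / (2 * c1)))"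
  have e0: "e > 0" using c1 \<epsilon> by (simp add: e_def add_nonneg_pos)
  have "e \<le> 1 / (8 * c1)" "e \<le> 1 / (8 * (\<bar>\<kappa>\<bar> + 1))" "e \<le> \<epsilon> / (2 * c1)" by (simp_all add: e_def)
  moreover have "8 * c1 > 0" "8 * (\<bar>\<kappa>\<bar> + 1) > 0" "2 * c1 > 0" using c1 by (auto intro: add_nonneg_pos)
  ultimately have "e * (8 * c1) \<le> 1" "e * (8 * (\<bar>\<kappa>\<bar> + 1)) \<le> 1" "e * (2 * c1) \<le> \<epsilon>"
    by (simp_all only: pos_le_divide_eq)
  then have e: "c1 * e \<le> 1 / 8" "\<bar>\<kappa>\<bar> * e \<le> 1 / 8" "2 * c1 * e \<le> \<epsilon>"
    using e0 by (simp_all add: algebra_simps)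
  \<comment> \<open>\<open>c2\<close> and \<open>c3\<close> arise from splitting
    \<open>(E x / \<eta>) powr (p / 2)\<close> into the contributions of
    \<open>(u x / e)\<^sup>2\<close> and of \<open>\<delta>\<close>. Neither depends on
    \<open>u\<close> or \<open>\<delta>\<close>.\<close>
  define c2 where "c2 = c1 * 2 powr (p / 2) * (1 / (e\<^sup>2 * \<eta>)) powr (p / 2)"
  define c3 where "c3 = c1 * 2 powr (p / 2) * (1 / \<eta>) powr (p / 2)"
  have c23: "c2 \<ge> 0" "c3 \<ge> 0" using c1 by (simp_all add: c2_def c3_def)
  show ?case
  proof (rule 1(1)[of "2 * c2"])
    show "0 \<le> 2 * c2" using c23 by simp
    fix u assume u: "u \<in> test_functions A UNIV"
    define v where "v = X u"
    define w where "w = X v"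
    have v: "v \<in> test_functions A UNIV" unfolding v_def
      by (rule vector_field_test[OF lie_algebra_vector_field[OF X] u])
    have w: "w \<in> test_functions A UNIV" unfolding w_def
      by (rule vector_field_test[OF lie_algebra_vector_field[OF X] v])
    note us = test_functions_smooth[OF u] and vs = test_functions_smooth[OF v]
    define K where "K = closure {x. u x \<noteq> 0}"
    have K: "compact K" and u0: "\<And>x. x \<notin> K \<Longrightarrow> u x = 0"
      unfolding K_def by (rule test_functions_support[OF u], erule test_functions_support[OF u])
    have v0: "v x = 0" if "x \<notin> K" for x
      using vector_field_support[OF lie_algebra_vector_field[OF X] us] that
      by (auto simp: v_def K_def)
    have "closure {x. v x \<noteq> 0} \<subseteq> K"
      by (rule closure_minimal) (use v0 in \<open>auto simp: K_def\<close>)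
    then have w0: "w x = 0" if "x \<notin> K" for x
      using vector_field_support[OF lie_algebra_vector_field[OF X] vs] that
      by (auto simp: w_def)
    let ?k = "\<lambda>x. indicator K x :: real"
    let ?U = "\<integral>x. \<bar>u x\<bar> powr p \<partial>\<mu>" and ?V = "\<integral>x. \<bar>v x\<bar> powr p \<partial>\<mu>" and ?W = "\<integral>x. \<bar>w x\<bar> powr p \<partial>\<mu>"
    have int: "integrable \<mu> (\<lambda>x. \<bar>u x\<bar> powr p)" "integrable \<mu> (\<lambda>x. \<bar>v x\<bar> powr p)"
      "integrable \<mu> (\<lambda>x. \<bar>w x\<bar> powr p)"
      using test_functions_integrable_powr[OF _ p] u v w by auto
    have intk: "integrable \<mu> ?k"
      using integrable_haar_indicator_mult[OF _ K, of "\<lambda>_. 1"] by simp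
    have "?V \<le> (\<epsilon> * ?W + 2 * c2 * ?U) + (2 * c3 * integral\<^sup>L \<mu> ?k) * \<delta> powr (p / 2)" if \<delta>: "\<delta> > 0" for \<delta>
    proof -
      define E where "E x = (u x / e)\<^sup>2 + \<delta>" for x
      define D where "D x = (v x)\<^sup>2 + E x" for x
      have E0: "E x > 0" for x using \<delta> by (simp add: E_def add_nonneg_pos)
      have D0: "D x > 0" and ED: "E x \<le> D x" for x using E0[of x] by (auto simp: D_def add_nonneg_pos)
      have cD: "continuous_on UNIV D"
        unfolding D_def E_def using e0 by (intro continuous_intros test_functions_cont[OF u] test_functions_cont[OF v]) auto
      have cDp: "continuous_on UNIV (\<lambda>x. D x powr q)" for q
        by (intro continuous_on_powr cD continuous_on_const) (use D0 in \<open>metis less_irrefl\<close>)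
      define F where "F x = u x * v x * D x powr r" for x
      define F' where "F' x = v x * v x * D x powr r + u x * w x * D x powr r +
        u x * v x * (r * D x powr (r - 1) * (2 * v x * w x + 2 * u x * v x / e\<^sup>2))" for x
      have cF: "continuous_on UNIV F"
        unfolding F_def by (intro continuous_intros cDp test_functions_cont[OF u] test_functions_cont[OF v])
      have cF': "continuous_on UNIV F'"
        unfolding F'_def using e0
        by (intro continuous_intros cDp test_functions_cont[OF u] test_functions_cont[OF v] test_functions_cont[OF w]) auto
      have F0: "F x = 0" "F' x = 0" if "x \<notin> K" for x
        using u0[OF that] v0[OF that] by (simp_all add: F_def F'_def)
      have intF: "integrable \<mu> F" "integrable \<mu> F'"
        using integrable_haar_compact_support[OF cF K] integrable_haar_compact_support[OF cF' K] F0 by auto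
      obtain Mu where Mu: "Mu > 0" "\<And>x. \<bar>u x\<bar> \<le> Mu * ?k x"
        using compact_support_bounded[OF test_functions_cont[OF u] K] u0 by blast
      obtain Mv where Mv: "Mv > 0" "\<And>x. \<bar>v x\<bar> \<le> Mv * ?k x"
        using compact_support_bounded[OF test_functions_cont[OF v] K] v0 by blast
      define M where "M = max Mu Mv"
      have M: "\<bar>u x\<bar> \<le> M" "\<bar>v x\<bar> \<le> M" for x
        using Mu(1) Mv(1) Mu(2)[of x] Mv(2)[of x] by (cases "x \<in> K"; auto simp: M_def)+
      obtain L where L: "L \<ge> 0" "\<And>x y. \<bar>F y - F x\<bar> \<le> L * (\<bar>u y - u x\<bar> + \<bar>v y - v x\<bar>)"
      proof (rule product_powr_lipschitz[OF e0 \<delta>, of M r], goal_cases)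
        case (1 L)
        show ?case
        proof (rule 1(1)[OF 1(2)])
          fix x y
          show "\<bar>F y - F x\<bar> \<le> L * (\<bar>u y - u x\<bar> + \<bar>v y - v x\<bar>)"
            using 1(3)[OF M(1)[of x] M(2)[of x] M(1)[of y] M(2)[of y]] by (simp add: F_def D_def E_def)
        qed
      qed
      obtain Lu where Lu: "\<forall>g. \<forall>t\<in>{- \<tau>..\<tau>}. \<bar>u (g \<otimes> \<gamma> t) - u g\<bar> \<le> Lu * \<bar>t\<bar>"
        using \<gamma>_lip[OF u] by blast
      obtain Lv where Lv: "\<forall>g. \<forall>t\<in>{- \<tau>..\<tau>}. \<bar>v (g \<otimes> \<gamma> t) - v g\<bar> \<le> Lv * \<bar>t\<bar>"
        using \<gamma>_lip[OF v] by blast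
      have "integral\<^sup>L \<mu> F' = \<kappa> * integral\<^sup>L \<mu> F"
      proof (rule div[OF cF K F0(1)])
        fix g
        have du: "((\<lambda>t. u (g \<otimes> \<gamma> t)) has_real_derivative v g) (at 0)"
          using \<gamma>_deriv[OF us] by (simp add: v_def)
        have dv: "((\<lambda>t. v (g \<otimes> \<gamma> t)) has_real_derivative w g) (at 0)"
          using \<gamma>_deriv[OF vs] by (simp add: w_def)
        have g0: "g \<otimes> \<gamma> 0 = g" by (simp add: \<gamma>0)
        have dD: "((\<lambda>t. D (g \<otimes> \<gamma> t)) has_real_derivative (2 * v g * w g + 2 * u g * v g / e\<^sup>2)) (at 0)"
          unfolding D_def E_def using e0
          by (auto intro!: derivative_eq_intros du dv simp: g0 power2_eq_square field_simps)
        show "((\<lambda>t. F (g \<otimes> \<gamma> t)) has_real_derivative F' g) (at 0)"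
          unfolding F_def
          by (rule DERIV_cong[OF DERIV_mult[OF DERIV_mult[OF du dv] DERIV_fun_powr[OF dD D0, of r]]])
            (simp add: F'_def g0 algebra_simps)
      next
        fix g t assume t: "t \<in> {- \<tau>..\<tau>}"
        have "\<bar>F (g \<otimes> \<gamma> t) - F g\<bar> \<le> L * (\<bar>u (g \<otimes> \<gamma> t) - u g\<bar> + \<bar>v (g \<otimes> \<gamma> t) - v g\<bar>)"
          by (rule L(2))
        also have "\<dots> \<le> L * (Lu * \<bar>t\<bar> + Lv * \<bar>t\<bar>)"
          using Lu Lv t L(1) by (intro mult_left_mono add_mono) auto
        finally show "\<bar>F (g \<otimes> \<gamma> t) - F g\<bar> \<le> (L * (Lu + Lv)) * \<bar>t\<bar>" by (simp add: algebra_simps)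
      qed
      define Q where "Q = (\<integral>x. ?k x * D x powr (p / 2) \<partial>\<mu>)"
      have intQ: "integrable \<mu> (\<lambda>x. ?k x * D x powr (p / 2))"
        by (rule integrable_haar_indicator_mult[OF cDp K])
      have "\<bar>integral\<^sup>L \<mu> F\<bar> \<le> e * Q"
      proof -
        have "\<bar>integral\<^sup>L \<mu> F\<bar> \<le> (\<integral>x. \<bar>F x\<bar> \<partial>\<mu>)" using integral_norm_bound[of \<mu> F] by simp
        also have "\<dots> \<le> (\<integral>x. e * (?k x * D x powr (p / 2)) \<partial>\<mu>)"
        proof (intro integral_mono)
          fix x
          show "\<bar>F x\<bar> \<le> e * (?k x * D x powr (p / 2))"
          proof (cases "x \<in> K")
            case True
            \<comment> \<open>The inequality of arithmetic and geometric means gives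
              \<open>\<bar>u v\<bar> \<le> e * D\<close>; this is how the factor \<open>e\<close>
              gets in front of \<open>Q\<close>, against which \<open>\<kappa>\<close> is
              absorbed.\<close>
            have "2 * (\<bar>u x / e\<bar> * \<bar>v x\<bar>) \<le> (u x / e)\<^sup>2 + (v x)\<^sup>2"
              using sum_squares_bound[of "\<bar>u x / e\<bar>" "\<bar>v x\<bar>"]
              by (simp only: power2_abs mult.assoc)
            moreover have "0 \<le> \<bar>u x / e\<bar> * \<bar>v x\<bar>" by simp
            ultimately have "\<bar>u x / e\<bar> * \<bar>v x\<bar> \<le> D x" unfolding D_def E_def using \<delta> by linarith
            then have "\<bar>u x\<bar> * \<bar>v x\<bar> \<le> e * D x"
              using e0 by (simp add: pos_divide_le_eq mult.commute)
            then have "\<bar>u x\<bar> * \<bar>v x\<bar> * D x powr r \<le> e * D x * D x powr r" by (intro mult_right_mono) auto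
            also have "\<dots> = e * D x powr (p / 2)" using D0[of x] by (simp add: powr_add flip: r(1))
            finally show ?thesis using True by (simp add: F_def abs_mult)
          qed (simp add: F0)
        qed (use intF intQ in auto)
        finally show ?thesis by (simp add: Q_def)
      qed
      then have "\<bar>\<kappa> * integral\<^sup>L \<mu> F\<bar> \<le> \<bar>\<kappa>\<bar> * (e * Q)" by (simp add: abs_mult mult_left_mono)
      moreover have Q0: "Q \<ge> 0" unfolding Q_def by (intro integral_nonneg_AE) simp
      then have "\<bar>\<kappa>\<bar> * (e * Q) \<le> 1 / 8 * Q"
        using mult_right_mono[OF e(2), of Q] by (simp add: mult.assoc)
      ultimately have F'_le: "integral\<^sup>L \<mu> F' \<le> 1 / 8 * Q"
        using \<open>integral\<^sup>L \<mu> F' = \<kappa> * integral\<^sup>L \<mu> F\<close> by linarith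
      have pointwise: "5 / 8 * (?k x * D x powr (p / 2)) \<le>
          F' x + (c2 * \<bar>u x\<bar> powr p + (c3 * \<delta> powr (p / 2)) * ?k x + c1 * e * \<bar>w x\<bar> powr p)" for x
      proof (cases "x \<in> K")
        case True
        have 1: "D x powr (p / 2) - c1 * (E x * D x powr r) - c1 * e * (\<bar>w x\<bar> * D x powr ((p - 1) / 2)) \<le> F' x"
          using powr_interpolation_pointwise[OF e0 \<delta> E_def D_def, of x r "w x"]
          unfolding F'_def c1_def r by simp
        have "c1 * (E x * D x powr r) \<le> c1 * (\<eta> * D x powr (r + 1) + (E x / \<eta>) powr (r + 1))"
          using c1 p by (intro mult_left_mono mult_powr_le_split E0 ED \<eta>(1)) (auto simp: r)
        then have 2: "c1 * (E x * D x powr r) \<le> 1 / 4 * D x powr (p / 2) + c1 * (E x / \<eta>) powr (p / 2)"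
          using \<eta>(2) unfolding r by (simp add: distrib_left mult.assoc[symmetric])
        have "c1 * e * (\<bar>w x\<bar> * D x powr ((p - 1) / 2)) \<le> c1 * e * (D x powr (p / 2) + \<bar>w x\<bar> powr p)"
          using c1 e0 by (intro mult_left_mono mult_powr_le_add_powr D0 p) auto
        moreover have "c1 * e * D x powr (p / 2) \<le> 1 / 8 * D x powr (p / 2)"
          using e(1) by (intro mult_right_mono) auto
        ultimately have 3: "c1 * e * (\<bar>w x\<bar> * D x powr ((p - 1) / 2)) \<le>
            1 / 8 * D x powr (p / 2) + c1 * e * \<bar>w x\<bar> powr p"
          by (simp add: distrib_left)
        have "(E x / \<eta>) powr (p / 2) = ((u x / e)\<^sup>2 / \<eta> + \<delta> / \<eta>) powr (p / 2)"
          by (simp add: E_def add_divide_distrib)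
        also have "\<dots> \<le> 2 powr (p / 2) * (((u x / e)\<^sup>2 / \<eta>) powr (p / 2) + (\<delta> / \<eta>) powr (p / 2))"
          using \<eta>(1) \<delta> p by (intro powr_add_le) auto
        also have "((u x / e)\<^sup>2 / \<eta>) powr (p / 2) = (1 / (e\<^sup>2 * \<eta>)) powr (p / 2) * \<bar>u x\<bar> powr p"
        proof -
          have "(u x / e)\<^sup>2 / \<eta> = 1 / (e\<^sup>2 * \<eta>) * (u x)\<^sup>2" by (simp add: power_divide)
          then have "((u x / e)\<^sup>2 / \<eta>) powr (p / 2) = (1 / (e\<^sup>2 * \<eta>)) powr (p / 2) * (u x)\<^sup>2 powr (p / 2)"
            using \<eta>(1) by (simp only: powr_mult)
          then show ?thesis by (simp only: square_powr_half)
        qed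
        also have "(\<delta> / \<eta>) powr (p / 2) = (1 / \<eta>) powr (p / 2) * \<delta> powr (p / 2)"
          using \<eta>(1) \<delta> by (simp add: powr_mult[symmetric])
        finally have "c1 * (E x / \<eta>) powr (p / 2) \<le> c1 * (2 powr (p / 2) *
            ((1 / (e\<^sup>2 * \<eta>)) powr (p / 2) * \<bar>u x\<bar> powr p + (1 / \<eta>) powr (p / 2) * \<delta> powr (p / 2)))"
          using c1 by (intro mult_left_mono) auto
        then have 4: "c1 * (E x / \<eta>) powr (p / 2) \<le> c2 * \<bar>u x\<bar> powr p + c3 * \<delta> powr (p / 2)"
          by (simp add: c2_def c3_def algebra_simps)
        show ?thesis using 1 2 3 4 True by simp
      next
        case False
        then show ?thesis using F0(2) c23 c1 e0 by simp
      qed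
      have "5 / 8 * Q = (\<integral>x. 5 / 8 * (?k x * D x powr (p / 2)) \<partial>\<mu>)" by (simp add: Q_def)
      also have "\<dots> \<le> (\<integral>x. F' x + (c2 * \<bar>u x\<bar> powr p + (c3 * \<delta> powr (p / 2)) * ?k x + c1 * e * \<bar>w x\<bar> powr p) \<partial>\<mu>)"
        using intQ intF int intk by (intro integral_mono pointwise) auto
      also have "\<dots> = integral\<^sup>L \<mu> F' + (c2 * ?U + (c3 * \<delta> powr (p / 2)) * integral\<^sup>L \<mu> ?k + c1 * e * ?W)"
        using intF int intk by simp
      finally have Q: "1 / 2 * Q \<le> c2 * ?U + (c3 * \<delta> powr (p / 2)) * integral\<^sup>L \<mu> ?k + c1 * e * ?W"
        using F'_le by linarith
      \<comment> \<open>Together with the bound for \<open>1 / 2 * Q\<close> this gives the factors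
        2 in the claim; only the term with \<open>c3\<close> still depends on
        \<open>\<delta>\<close>.\<close>
      have "?V \<le> Q" unfolding Q_def
      proof (intro integral_mono)
        fix x
        show "\<bar>v x\<bar> powr p \<le> ?k x * D x powr (p / 2)"
        proof (cases "x \<in> K")
          case True
          have "\<bar>v x\<bar> powr p = ((v x)\<^sup>2) powr (p / 2)"
            by (rule square_powr_half[symmetric])
          also have "\<dots> \<le> D x powr (p / 2)"
            using E0[of x] p by (intro powr_mono2) (auto simp: D_def)
          finally show ?thesis using True by simp
        qed (use v0 p in simp)
      qed (use int intQ in auto)
      moreover have "2 * c1 * e * ?W \<le> \<epsilon> * ?W"
        using e(3) by (intro mult_right_mono integral_nonneg_AE) auto
      ultimately show ?thesis using Q by (simp add: algebra_simps)
    qed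
    then have "?V \<le> \<epsilon> * ?W + 2 * c2 * ?U"
    proof (rule le_if_le_add_powr[of "p / 2", rotated])
      show "0 < p / 2" using p by simp
    qed
    then show "(\<integral>x. \<bar>X u x\<bar> powr p \<partial>\<mu>) \<le> \<epsilon> * (\<integral>x. \<bar>X (X u) x\<bar> powr p \<partial>\<mu>) + 2 * c2 * (\<integral>x. \<bar>u x\<bar> powr p \<partial>\<mu>)"
      by (simp add: v_def w_def)
  qed
qed

end

section \<open>Words in the vector fields\<close>

text \<open>With the strict bound \<open>k < l\<close>, taking \<open>l = m\<close> gives the lower
  order quantity that is to be absorbed. For the cutoff function \<open>l = Suc m\<close> is used,
  so that all its derivatives of order up to \<open>m\<close> are included.\<close>

definition word_sum :: "nat \<Rightarrow> (nat \<Rightarrow> 'g operator) \<Rightarrow> nat \<Rightarrow> ('g \<Rightarrow> real) \<Rightarrow> 'g \<Rightarrow> real" where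
  "word_sum \<nu> X l u x = (\<Sum>k<l. \<Sum>I\<in>multi_indices \<nu> k. \<bar>word_op X I u x\<bar>)"

lemma finite_multi_indices [simp, intro]: "finite (multi_indices \<nu> k)"
  using finite_lists_length_eq[of "{1..\<nu>}" k] by (simp add: multi_indices_def conj_commute)

lemma multi_indices_0 [simp]: "multi_indices \<nu> 0 = {[]}"
  by (auto simp: multi_indices_def)

lemma multi_indices_snoc: "i \<in> {1..\<nu>} \<Longrightarrow> I \<in> multi_indices \<nu> k \<Longrightarrow> I @ [i] \<in> multi_indices \<nu> (Suc k)"
  by (auto simp: multi_indices_def)

lemma multi_indices_Suc: "multi_indices \<nu> (Suc k) = (\<lambda>(i, I). i # I) ` ({1..\<nu>} \<times> multi_indices \<nu> k)"
  by (auto simp: multi_indices_def length_Suc_conv image_iff)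

lemma word_op_simps [simp]:
  "word_op X [] u = u" "word_op X (i # I) u = X i (word_op X I u)"
  "word_op X (I @ J) u = word_op X I (word_op X J u)"
  by (simp_all add: word_op_def)

lemma word_sum_nonneg [simp]: "word_sum \<nu> X l u x \<ge> 0"
  by (simp add: word_sum_def sum_nonneg)

lemma word_sum_mono: "l \<le> l' \<Longrightarrow> word_sum \<nu> X l u x \<le> word_sum \<nu> X l' u x"
  unfolding word_sum_def by (intro sum_mono2) (auto intro: sum_nonneg)

lemma word_le_word_sum:
  assumes "I \<in> multi_indices \<nu> k" "k < l"
  shows "\<bar>word_op X I u x\<bar> \<le> word_sum \<nu> X l u x"
proof -
  have "\<bar>word_op X I u x\<bar> \<le> (\<Sum>I\<in>multi_indices \<nu> k. \<bar>word_op X I u x\<bar>)"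
    using assms by (intro member_le_sum) auto
  also have "\<dots> \<le> word_sum \<nu> X l u x"
    unfolding word_sum_def
    by (rule member_le_sum[where f = "\<lambda>k. \<Sum>I\<in>multi_indices \<nu> k. \<bar>word_op X I u x\<bar>"])
      (use assms in \<open>auto intro: sum_nonneg\<close>)
  finally show ?thesis .
qed

text \<open>Appending \<open>i\<close> at the right end embeds the words of length \<open>k\<close>
  into those of length \<open>Suc k\<close>.\<close>

lemma word_sum_field_le:
  assumes "i \<in> {1..\<nu>}"
  shows "word_sum \<nu> X l (X i u) x \<le> word_sum \<nu> X (Suc l) u x"
proof -
  have "(\<Sum>I\<in>multi_indices \<nu> k. \<bar>word_op X I (X i u) x\<bar>) \<le>
      (\<Sum>I\<in>multi_indices \<nu> (Suc k). \<bar>word_op X I u x\<bar>)" for k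
  proof -
    have "(\<Sum>I\<in>multi_indices \<nu> k. \<bar>word_op X I (X i u) x\<bar>) =
        (\<Sum>I\<in>(\<lambda>I. I @ [i]) ` multi_indices \<nu> k. \<bar>word_op X I u x\<bar>)"
      by (subst sum.reindex) (auto simp: inj_on_def)
    also have "\<dots> \<le> (\<Sum>I\<in>multi_indices \<nu> (Suc k). \<bar>word_op X I u x\<bar>)"
      using multi_indices_snoc[OF assms] by (intro sum_mono2) auto
    finally show ?thesis .
  qed
  then have "word_sum \<nu> X l (X i u) x \<le> (\<Sum>k<l. \<Sum>I\<in>multi_indices \<nu> (Suc k). \<bar>word_op X I u x\<bar>)"
    unfolding word_sum_def by (intro sum_mono)
  also have "\<dots> \<le> word_sum \<nu> X (Suc l) u x"
    unfolding word_sum_def by (subst sum.lessThan_Suc_shift) simp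
  finally show ?thesis .
qed

context haar_lie_grp
begin

lemma word_op_smooth:
  assumes "\<forall>i\<in>{1..\<nu>}. X i \<in> lie_algebra G A" "u \<in> smooth_functions A"
  shows "set I \<subseteq> {1..\<nu>} \<Longrightarrow> word_op X I u \<in> smooth_functions A"
proof (induction I)
  case (Cons i I)
  then show ?case
    using vector_field_smooth[of "X i" "word_op X I u"] lie_algebra_vector_field[of "X i"] assms(1) by simp
qed (simp add: assms)

lemma word_op_test:
  assumes "\<forall>i\<in>{1..\<nu>}. X i \<in> lie_algebra G A" "u \<in> test_functions A \<Omega>"
  shows "set I \<subseteq> {1..\<nu>} \<Longrightarrow> word_op X I u \<in> test_functions A \<Omega>"
proof (induction I)
  case (Cons i I)
  then show ?case
    using vector_field_test[of "X i" "word_op X I u"] lie_algebra_vector_field[of "X i"] assms(1) by simp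
qed (simp add: assms)

lemma word_op_left_transl:
  assumes "\<forall>i\<in>{1..\<nu>}. X i \<in> lie_algebra G A" "u \<in> smooth_functions A"
  shows "set I \<subseteq> {1..\<nu>} \<Longrightarrow> word_op X I (left_transl G x u) = left_transl G x (word_op X I u)"
proof (induction I)
  case (Cons i I)
  then have "word_op X I u \<in> smooth_functions A" using word_op_smooth[OF assms] by simp
  then show ?case using Cons lie_algebra_left_transl[of "X i"] assms(1) by simp
qed simp

lemma word_op_add:
  assumes X: "\<forall>i\<in>{1..\<nu>}. X i \<in> lie_algebra G A"
    and u: "u \<in> smooth_functions A" and v: "v \<in> smooth_functions A"
  shows "set I \<subseteq> {1..\<nu>} \<Longrightarrow> word_op X I (\<lambda>x. u x + v x) = (\<lambda>x. word_op X I u x + word_op X I v x)"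
proof (induction I)
  case (Cons i I)
  have "X i \<in> lie_algebra G A" using Cons X by simp
  moreover have "word_op X I u \<in> smooth_functions A" "word_op X I v \<in> smooth_functions A"
    using Cons word_op_smooth[OF X u] word_op_smooth[OF X v] by simp_all
  ultimately show ?case
    using Cons vector_field_add[of "X i" "word_op X I u" "word_op X I v"]
    by (simp add: lie_algebra_vector_field)
qed simp

text \<open>In the difference at least one field falls on \<open>\<phi>\<close>, so at most
  \<open>k - 1\<close> fall on \<open>u\<close>. Induction removes the last letter, which acts
  first: \<open>X i (\<phi> u)\<close> is a sum of two products, and the hypothesis, being general
  in both factors, applies to each. The constant comes from
  \<open>2 * 3 ^ k' + 1 \<le> 3 ^ Suc k'\<close>.\<close>

lemma word_op_mult_bound:
  assumes X: "\<forall>i\<in>{1..\<nu>}. X i \<in> lie_algebra G A"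
  shows "I \<in> multi_indices \<nu> k \<Longrightarrow> \<phi> \<in> smooth_functions A \<Longrightarrow> u \<in> smooth_functions A \<Longrightarrow>
    \<bar>word_op X I (\<lambda>x. \<phi> x * u x) x - \<phi> x * word_op X I u x\<bar> \<le>
      3 ^ k * word_sum \<nu> X (Suc k) \<phi> x * word_sum \<nu> X k u x"
proof (induction I arbitrary: k \<phi> u rule: rev_induct)
  case Nil
  then show ?case by (simp add: multi_indices_def)
next
  case (snoc i I k \<phi> u)
  obtain k' where k: "k = Suc k'" and I: "I \<in> multi_indices \<nu> k'" and i: "i \<in> {1..\<nu>}"
    using snoc.prems(1) by (auto simp: multi_indices_def)
  have sI: "set I \<subseteq> {1..\<nu>}" using I by (simp add: multi_indices_def)
  note \<phi> = snoc.prems(2) and u = snoc.prems(3)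
  have Xi: "vector_field A (X i)" using i X lie_algebra_vector_field by auto
  have \<phi>': "X i \<phi> \<in> smooth_functions A" and u': "X i u \<in> smooth_functions A"
    using vector_field_smooth[OF Xi] \<phi> u by auto
  let ?S = "word_sum \<nu> X (Suc k) \<phi> x" and ?T = "word_sum \<nu> X k u x"
  have eq: "word_op X (I @ [i]) (\<lambda>x. \<phi> x * u x) =
      (\<lambda>x. word_op X I (\<lambda>x. \<phi> x * X i u x) x + word_op X I (\<lambda>x. X i \<phi> x * u x) x)"
    using word_op_add[OF X smooth_functions_mult[OF \<phi> u'] smooth_functions_mult[OF \<phi>' u] sI]
    by (simp add: vector_field_mult[OF Xi \<phi> u] mult.commute)
  have 1: "\<bar>word_op X I (\<lambda>x. \<phi> x * X i u x) x - \<phi> x * word_op X I (X i u) x\<bar> \<le> 3 ^ k' * ?S * ?T"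
  proof -
    have "3 ^ k' * word_sum \<nu> X (Suc k') \<phi> x * word_sum \<nu> X k' (X i u) x \<le> 3 ^ k' * ?S * ?T"
      using word_sum_field_le[OF i, of X k' u x] word_sum_mono[of "Suc k'" "Suc k" \<nu> X \<phi> x] k
      by (intro mult_mono mult_left_mono) auto
    then show ?thesis using snoc.IH[OF I \<phi> u'] by linarith
  qed
  have 2: "\<bar>word_op X I (\<lambda>x. X i \<phi> x * u x) x - X i \<phi> x * word_op X I u x\<bar> \<le> 3 ^ k' * ?S * ?T"
  proof -
    have "3 ^ k' * word_sum \<nu> X (Suc k') (X i \<phi>) x * word_sum \<nu> X k' u x \<le> 3 ^ k' * ?S * ?T"
      using word_sum_field_le[OF i, of X "Suc k'" \<phi> x] word_sum_mono[of k' k \<nu> X u x] k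
      by (intro mult_mono mult_left_mono) auto
    then show ?thesis using snoc.IH[OF I \<phi>' u] by linarith
  qed
  have 3: "\<bar>X i \<phi> x * word_op X I u x\<bar> \<le> ?S * ?T"
    using word_le_word_sum[of "[i]" \<nu> 1 "Suc k" X \<phi> x] word_le_word_sum[OF I, of k X u x] i k
    unfolding abs_mult by (intro mult_mono) (auto simp: multi_indices_def)
  have "\<bar>word_op X (I @ [i]) (\<lambda>x. \<phi> x * u x) x - \<phi> x * word_op X (I @ [i]) u x\<bar> \<le>
      3 ^ k' * ?S * ?T + 3 ^ k' * ?S * ?T + ?S * ?T"
    using 1 2 3 unfolding eq unfolding word_op_simps by linarith
  also have "\<dots> \<le> 3 ^ k * ?S * ?T"
  proof -
    have "2 * 3 ^ k' + 1 \<le> (3 :: real) ^ k" using one_le_power[of "3::real" k'] k by simp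
    then have "(2 * 3 ^ k' + 1) * (?S * ?T) \<le> 3 ^ k * (?S * ?T)" by (intro mult_right_mono) auto
    then show ?thesis by (simp add: algebra_simps)
  qed
  finally show ?case .
qed

section \<open>Freezing the coefficients of an invariant operator\<close>

text \<open>
  As the \<open>X\<^sub>I\<close> with \<open>\<bar>I\<bar> = m\<close> may be linearly dependent, the coefficients of an invariant operator
  need not be constant, nor even locally bounded. For a given function, however, they may be
  replaced by their values at almost any point.
\<close>

lemma left_invariant_frozen_coefficients:
  assumes X: "\<forall>i\<in>{1..\<nu>}. X i \<in> lie_algebra G A"
    and b: "\<forall>I\<in>multi_indices \<nu> m. b I \<in> borel_measurable \<mu>"
    and inv: "left_invariant_op G A \<mu> (principal_part \<nu> X m b)"
    and u: "u \<in> smooth_functions A"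
  shows "AE y in \<mu>. AE w in \<mu>.
    principal_part \<nu> X m b u w = (\<Sum>I\<in>multi_indices \<nu> m. b I y * word_op X I u w)"
proof -
  define f where "f = principal_part \<nu> X m b u"
  define Q where "Q y w \<longleftrightarrow> (\<Sum>I\<in>multi_indices \<nu> m. b I y * word_op X I u w) = f w" for y w
  have wm: "word_op X I u \<in> borel_measurable borel" if "I \<in> multi_indices \<nu> m" for I
    using that word_op_smooth[OF X u, of I] smooth_functions_measurable by (simp add: multi_indices_def)
  have bm: "b I \<in> borel_measurable borel" if "I \<in> multi_indices \<nu> m" for I
    using bspec[OF b that] unfolding measurable_haar .
  have fm [measurable]: "f \<in> borel_measurable borel"
    unfolding f_def principal_part_def using wm bm by (intro borel_measurable_sum borel_measurable_times) auto
  \<comment> \<open>Invariance for the translate of \<open>u\<close>: the coefficients are taken at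
    \<open>y\<close>, but the derivatives of \<open>u\<close> at
    \<open>inv x \<otimes> y\<close>.\<close>
  have "AE y in \<mu>. Q y (inv x \<otimes> y)" for x
  proof -
    have "AE y in \<mu>. principal_part \<nu> X m b (left_transl G x u) y = left_transl G x f y"
      using inv u by (simp add: left_invariant_op_def f_def)
    moreover have "principal_part \<nu> X m b (left_transl G x u) y =
        (\<Sum>I\<in>multi_indices \<nu> m. b I y * word_op X I u (inv x \<otimes> y))" for y
      unfolding principal_part_def
      by (intro sum.cong refl) (simp add: word_op_left_transl[OF X u] multi_indices_def, simp add: left_transl_def)
    ultimately show ?thesis by (simp add: Q_def left_transl_def)
  qed
  moreover have "Measurable.pred (\<mu> \<Otimes>\<^sub>M \<mu>) (\<lambda>z. Q (snd z) (inv (fst z) \<otimes> snd z))"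
  proof -
    have [measurable]: "(\<lambda>z. inv (fst z) \<otimes> snd z) \<in> \<mu> \<Otimes>\<^sub>M \<mu> \<rightarrow>\<^sub>M borel" by measurable
    have "(\<lambda>z. \<Sum>I\<in>multi_indices \<nu> m. b I (snd z) * word_op X I u (inv (fst z) \<otimes> snd z))
        \<in> borel_measurable (\<mu> \<Otimes>\<^sub>M \<mu>)"
    proof (intro borel_measurable_sum borel_measurable_times)
      fix I assume I: "I \<in> multi_indices \<nu> m"
      note [measurable] = wm[OF I] bm[OF I]
      show "(\<lambda>z. b I (snd z)) \<in> borel_measurable (\<mu> \<Otimes>\<^sub>M \<mu>)" by measurable
      show "(\<lambda>z. word_op X I u (inv (fst z) \<otimes> snd z)) \<in> borel_measurable (\<mu> \<Otimes>\<^sub>M \<mu>)" by measurable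
    qed
    then show ?thesis unfolding Q_def by measurable
  qed
  then have "{z \<in> space (\<mu> \<Otimes>\<^sub>M \<mu>). Q (snd z) (inv (fst z) \<otimes> snd z)} \<in> sets (\<mu> \<Otimes>\<^sub>M \<mu>)" by measurable
  \<comment> \<open>Exchanging the quantifiers by Fubini fixes the point \<open>y\<close> of the
    coefficients and lets the point of the derivatives vary.\<close>
  ultimately have "AE y in \<mu>. AE x in \<mu>. Q y (inv x \<otimes> y)"
    using \<mu>\<mu>.AE_commute[of "\<lambda>x y. Q y (inv x \<otimes> y)"] by simp
  then show ?thesis
  proof (rule AE_mp[OF _ AE_I2], intro impI)
    fix y assume "AE x in \<mu>. Q y (inv x \<otimes> y)"
    \<comment> \<open>With \<open>x = y \<otimes> s\<close> the point
      \<open>inv x \<otimes> y\<close> becomes \<open>inv s\<close>.\<close>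
    then have "AE s in \<mu>. Q y (inv (y \<otimes> s) \<otimes> y)" by (rule AE_transl)
    then have "AE s in \<mu>. Q y (inv s)" by (simp add: inv_mult_group m_assoc)
    moreover have "Measurable.pred borel (Q y)"
    proof -
      have [measurable]: "(\<lambda>w. \<Sum>I\<in>multi_indices \<nu> m. b I y * word_op X I u w) \<in> borel_measurable borel"
        using wm by (intro borel_measurable_sum borel_measurable_times) auto
      show ?thesis unfolding Q_def by measurable
    qed
    ultimately have "AE w in \<mu>. Q y w" by (rule AE_group_inv[rotated])
    then show "AE w in \<mu>. principal_part \<nu> X m b u w = (\<Sum>I\<in>multi_indices \<nu> m. b I y * word_op X I u w)"
      by (simp add: Q_def f_def eq_commute)
  qed
qed

text \<open>The sets where all \<open>\<bar>f i\<bar>\<close> are at most \<open>M\<close> exhaust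
  the group as \<open>M\<close> grows, so one of them is not null, and every property that holds
  almost everywhere holds somewhere on it. This \<open>M\<close> is chosen before \<open>P\<close>,
  which is what keeps the constants below uniform in \<open>\<alpha>\<close> and
  \<open>z\<close>.\<close>

lemma AE_ex_bounded:
  fixes f :: "'i \<Rightarrow> 'g \<Rightarrow> real"
  assumes "finite T"
  obtains M :: real where "M > 0" "\<And>P. AE y in \<mu>. P y \<Longrightarrow> \<exists>y. P y \<and> (\<forall>i\<in>T. \<bar>f i y\<bar> \<le> M)"
proof -
  define B where "B M y \<longleftrightarrow> (\<forall>i\<in>T. \<bar>f i y\<bar> \<le> real (Suc M))" for M y
  have "\<exists>M. \<not> (AE y in \<mu>. \<not> B M y)"
  proof (rule ccontr)
    assume "\<not> ?thesis"
    then have AE: "AE y in \<mu>. \<forall>M. \<not> B M y" by (simp add: AE_all_countable)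
    have ex: "\<exists>M. B M y" for y
    proof -
      obtain M where M: "(\<Sum>i\<in>T. \<bar>f i y\<bar>) \<le> real M" using real_arch_simple by blast
      have "\<bar>f i y\<bar> \<le> real (Suc M)" if "i \<in> T" for i
        using member_le_sum[of i T "\<lambda>i. \<bar>f i y\<bar>"] that assms M by simp
      then show ?thesis by (auto simp: B_def)
    qed
    from AE have "AE y in \<mu>. False" by (rule eventually_mono) (use ex in blast)
    then show False using haar_UNIV by (simp add: AE_iff_measurable[of UNIV])
  qed
  then obtain M where M: "\<not> (AE y in \<mu>. \<not> B M y)" by blast
  have "\<exists>y. P y \<and> (\<forall>i\<in>T. \<bar>f i y\<bar> \<le> real (Suc M))" if P: "AE y in \<mu>. P y" for P
  proof (rule ccontr)
    assume "\<not> ?thesis"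
    then have nB: "P y \<Longrightarrow> \<not> B M y" for y by (auto simp: B_def)
    from P have "AE y in \<mu>. \<not> B M y" by (rule eventually_mono) (rule nB)
    then show False using M by simp
  qed
  then show ?thesis using that[of "real (Suc M)"] by simp
qed

end

section \<open>Powers of the \<open>L\<^sup>p\<close> norm\<close>

text \<open>The norm before the root is taken. In this form it can be integrated over the
  translations \<open>z\<close> by Tonelli's theorem.\<close>

definition Lp_pow :: "'g measure \<Rightarrow> real \<Rightarrow> ('g \<Rightarrow> real) \<Rightarrow> ennreal" where
  "Lp_pow \<mu> p f = (\<integral>\<^sup>+x. ennreal (\<bar>f x\<bar> powr p) \<partial>\<mu>)"

lemma Lp_norm_eq: "Lp_norm \<mu> p f = (if Lp_pow \<mu> p f = \<infinity> then \<infinity> else ennreal (enn2real (Lp_pow \<mu> p f) powr (1 / p)))"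
  by (simp add: Lp_norm_def Lp_pow_def Let_def)

lemma sum_powr_le_card:
  fixes t :: "'i \<Rightarrow> real"
  assumes "finite K" "\<And>k. k \<in> K \<Longrightarrow> t k \<ge> 0" "q \<ge> 0"
  shows "(\<Sum>k\<in>K. t k) powr q \<le> real (card K) powr q * (\<Sum>k\<in>K. t k powr q)"
proof (cases "K = {}")
  case False
  let ?M = "Max (t ` K)"
  have M: "?M \<in> t ` K" "\<And>k. k \<in> K \<Longrightarrow> t k \<le> ?M" using assms False by auto
  then obtain k0 where k0: "k0 \<in> K" "?M = t k0" by auto
  have "(\<Sum>k\<in>K. t k) \<le> real (card K) * ?M" using M(2) by (intro sum_bounded_above)
  then have "(\<Sum>k\<in>K. t k) powr q \<le> (real (card K) * t k0) powr q"
    using assms k0 by (intro powr_mono2 sum_nonneg) auto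
  also have "\<dots> = real (card K) powr q * t k0 powr q" using assms k0 by (simp add: powr_mult)
  also have "\<dots> \<le> real (card K) powr q * (\<Sum>k\<in>K. t k powr q)"
    using assms(1) k0(1) member_le_sum[of k0 K "\<lambda>k. t k powr q"] by (intro mult_left_mono) auto
  finally show ?thesis .
qed simp

text \<open>Write \<open>t powr p\<close> as \<open>t * t powr (p - 1)\<close> and bound the second
  factor by the same power of the whole sum.\<close>

lemma sum_powr_le_powr_sum:
  fixes t :: "'i \<Rightarrow> real"
  assumes "finite K" "\<And>k. k \<in> K \<Longrightarrow> t k \<ge> 0" "p \<ge> 1"
  shows "(\<Sum>k\<in>K. t k powr p) \<le> (\<Sum>k\<in>K. t k) powr p"
proof -
  let ?S = "\<Sum>k\<in>K. t k"
  have S: "?S \<ge> 0" using assms by (intro sum_nonneg)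
  have eq: "x powr p = x * x powr (p - 1)" if "x \<ge> 0" for x :: real
    using that by (cases "x = 0") (auto simp: powr_diff)
  have "(\<Sum>k\<in>K. t k powr p) \<le> (\<Sum>k\<in>K. t k * ?S powr (p - 1))"
  proof (rule sum_mono)
    fix k assume k: "k \<in> K"
    have "t k \<le> ?S" using assms k by (intro member_le_sum) auto
    then have "t k powr (p - 1) \<le> ?S powr (p - 1)" using assms k by (intro powr_mono2) auto
    then show "t k powr p \<le> t k * ?S powr (p - 1)"
      unfolding eq[OF assms(2)[OF k]] using assms k by (intro mult_left_mono) auto
  qed
  also have "\<dots> = ?S powr p" by (simp add: eq[OF S] sum_distrib_right)
  finally show ?thesis .
qed

lemma sum_ennreal_eq_top:
  fixes f :: "'i \<Rightarrow> ennreal"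
  assumes "finite K" "\<exists>k\<in>K. f k = \<infinity>"
  shows "sum f K = \<infinity>"
proof -
  obtain k where k: "k \<in> K" "f k = \<infinity>" using assms by blast
  have "f k \<le> sum f K" using k assms by (intro member_le_sum) auto
  then show ?thesis using k by (simp add: top_unique)
qed

text \<open>Infinite terms are treated first, because \<open>enn2real\<close> sends infinity to 0.
  If all terms on the right are finite, so is the left-hand side, and real arithmetic
  applies.\<close>

lemma Lp_pow_le_of_Lp_norm_le:
  assumes K: "finite K" and p: "p \<ge> 1" and C: "C > 0"
    and le: "Lp_norm \<mu> p f \<le> ennreal C * (\<Sum>k\<in>K. Lp_norm \<mu> p (g k))"
  shows "Lp_pow \<mu> p f \<le> ennreal ((C * real (card K)) powr p) * (\<Sum>k\<in>K. Lp_pow \<mu> p (g k))"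
proof (cases "\<exists>k\<in>K. Lp_pow \<mu> p (g k) = \<infinity>")
  case True
  then have "(\<Sum>k\<in>K. Lp_pow \<mu> p (g k)) = \<infinity>" by (rule sum_ennreal_eq_top[OF K])
  moreover have "(C * real (card K)) powr p > 0" using True K C by (auto simp: card_gt_0_iff)
  ultimately show ?thesis by (simp add: ennreal_mult_top)
next
  case False
  define t where "t k = enn2real (Lp_pow \<mu> p (g k))" for k
  have t: "Lp_pow \<mu> p (g k) = ennreal (t k)" "t k \<ge> 0" if "k \<in> K" for k
    using False that by (auto simp: t_def less_top)
  have "(\<Sum>k\<in>K. Lp_norm \<mu> p (g k)) = (\<Sum>k\<in>K. ennreal (t k powr (1 / p)))"
    by (intro sum.cong refl) (use t in \<open>simp add: Lp_norm_eq\<close>)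
  also have "\<dots> = ennreal (\<Sum>k\<in>K. t k powr (1 / p))" by (intro sum_ennreal) auto
  finally have le': "Lp_norm \<mu> p f \<le> ennreal (C * (\<Sum>k\<in>K. t k powr (1 / p)))"
    using le C by (simp add: ennreal_mult sum_nonneg)
  then have fin: "Lp_pow \<mu> p f \<noteq> \<infinity>" by (auto simp: Lp_norm_eq top_unique split: if_splits)
  define s where "s = enn2real (Lp_pow \<mu> p f)"
  have s: "Lp_pow \<mu> p f = ennreal s" "s \<ge> 0" using fin by (auto simp: s_def less_top)
  have "s powr (1 / p) \<le> C * (\<Sum>k\<in>K. t k powr (1 / p))"
    using le' s C by (simp add: Lp_norm_eq ennreal_le_iff sum_nonneg)
  then have "(s powr (1 / p)) powr p \<le> (C * (\<Sum>k\<in>K. t k powr (1 / p))) powr p"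
    using p by (intro powr_mono2) auto
  also have "\<dots> = C powr p * (\<Sum>k\<in>K. t k powr (1 / p)) powr p"
    using C by (simp add: powr_mult sum_nonneg)
  also have "\<dots> \<le> C powr p * (real (card K) powr p * (\<Sum>k\<in>K. (t k powr (1 / p)) powr p))"
    using K p by (intro mult_left_mono sum_powr_le_card) auto
  also have "(\<Sum>k\<in>K. (t k powr (1 / p)) powr p) = (\<Sum>k\<in>K. t k)"
    using p t by (intro sum.cong) (auto simp: powr_powr)
  also have "(s powr (1 / p)) powr p = s" using p s by (simp add: powr_powr)
  finally have "s \<le> (C * real (card K)) powr p * (\<Sum>k\<in>K. t k)"
    using C by (simp add: powr_mult mult.assoc)
  then have "ennreal s \<le> ennreal ((C * real (card K)) powr p) * ennreal (\<Sum>k\<in>K. t k)"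
    using t by (subst ennreal_mult[symmetric]) (auto intro!: ennreal_leI sum_nonneg)
  also have "ennreal (\<Sum>k\<in>K. t k) = (\<Sum>k\<in>K. Lp_pow \<mu> p (g k))"
    using t by (subst sum_ennreal[symmetric]) auto
  finally show ?thesis using s by simp
qed

lemma Lp_norm_le_of_Lp_pow_le:
  assumes K: "finite K" and p: "p \<ge> 1" and C: "C > 0"
    and le: "Lp_pow \<mu> p f \<le> ennreal C * (\<Sum>k\<in>K. Lp_pow \<mu> p (g k))"
  shows "Lp_norm \<mu> p f \<le> ennreal (C powr (1 / p)) * (\<Sum>k\<in>K. Lp_norm \<mu> p (g k))"
proof (cases "\<exists>k\<in>K. Lp_pow \<mu> p (g k) = \<infinity>")
  case True
  then have "\<exists>k\<in>K. Lp_norm \<mu> p (g k) = \<infinity>" by (auto simp: Lp_norm_eq)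
  then have "(\<Sum>k\<in>K. Lp_norm \<mu> p (g k)) = \<infinity>" by (rule sum_ennreal_eq_top[OF K])
  then show ?thesis using C by (simp add: ennreal_mult_top)
next
  case False
  define t where "t k = enn2real (Lp_pow \<mu> p (g k))" for k
  have t: "Lp_pow \<mu> p (g k) = ennreal (t k)" "t k \<ge> 0" if "k \<in> K" for k
    using False that by (auto simp: t_def less_top)
  have "(\<Sum>k\<in>K. Lp_pow \<mu> p (g k)) = ennreal (\<Sum>k\<in>K. t k)"
    using t by (subst sum_ennreal[symmetric]) auto
  then have le': "Lp_pow \<mu> p f \<le> ennreal (C * (\<Sum>k\<in>K. t k))"
    using le C t by (simp add: ennreal_mult sum_nonneg)
  then have fin: "Lp_pow \<mu> p f \<noteq> \<infinity>" by (auto simp: top_unique)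
  define s where "s = enn2real (Lp_pow \<mu> p f)"
  have s: "Lp_pow \<mu> p f = ennreal s" "s \<ge> 0" using fin by (auto simp: s_def less_top)
  have "s \<le> C * (\<Sum>k\<in>K. t k)"
    using le' s C t by (simp add: ennreal_le_iff sum_nonneg)
  then have "s powr (1 / p) \<le> (C * (\<Sum>k\<in>K. t k)) powr (1 / p)"
    using p s by (intro powr_mono2) auto
  also have "\<dots> = C powr (1 / p) * (\<Sum>k\<in>K. (t k powr (1 / p)) powr p) powr (1 / p)"
    using C p t by (simp add: powr_mult sum_nonneg powr_powr)
  also have "\<dots> \<le> C powr (1 / p) * ((\<Sum>k\<in>K. t k powr (1 / p)) powr p) powr (1 / p)"
    using K p by (intro mult_left_mono powr_mono2 sum_powr_le_powr_sum sum_nonneg) auto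
  also have "\<dots> = C powr (1 / p) * (\<Sum>k\<in>K. t k powr (1 / p))"
    using p by (simp add: powr_powr sum_nonneg)
  finally have "ennreal (s powr (1 / p)) \<le> ennreal (C powr (1 / p)) * ennreal (\<Sum>k\<in>K. t k powr (1 / p))"
    by (subst ennreal_mult[symmetric]) (auto intro!: ennreal_leI sum_nonneg)
  also have "ennreal (\<Sum>k\<in>K. t k powr (1 / p)) = (\<Sum>k\<in>K. Lp_norm \<mu> p (g k))"
    using t by (subst sum_ennreal[symmetric]) (auto simp: Lp_norm_eq)
  finally show ?thesis using s by (simp add: Lp_norm_eq)
qed

section \<open>Averaging over translates of a cutoff function\<close>

context haar_lie_grp
begin

text \<open>After a left translation in \<open>g\<close>, the weight of \<open>k g\<close> is the
  integral of \<open>h (inv z \<otimes> g)\<close> over \<open>z\<close>, and left invariance in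
  \<open>z\<close> shows that it does not depend on \<open>g\<close>. The inverse in
  \<open>h (inv z)\<close> remains because the group may fail to be unimodular.\<close>

lemma nn_integral_average:
  assumes [measurable]: "h \<in> borel_measurable borel" "k \<in> borel_measurable borel"
  shows "(\<integral>\<^sup>+z. (\<integral>\<^sup>+g. h g * k (z \<otimes> g) \<partial>\<mu>) \<partial>\<mu>) = (\<integral>\<^sup>+z. h (inv z) \<partial>\<mu>) * (\<integral>\<^sup>+g. k g \<partial>\<mu>)"
proof -
  have "(\<integral>\<^sup>+z. (\<integral>\<^sup>+g. h g * k (z \<otimes> g) \<partial>\<mu>) \<partial>\<mu>) = (\<integral>\<^sup>+z. (\<integral>\<^sup>+g. h (inv z \<otimes> g) * k g \<partial>\<mu>) \<partial>\<mu>)"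
  proof (rule nn_integral_cong)
    fix z
    have "(\<integral>\<^sup>+g. h (inv z \<otimes> g) * k (z \<otimes> (inv z \<otimes> g)) \<partial>\<mu>) = (\<integral>\<^sup>+g. h g * k (z \<otimes> g) \<partial>\<mu>)"
      by (rule nn_integral_transl[where f = "\<lambda>g. h g * k (z \<otimes> g)"]) measurable
    then show "(\<integral>\<^sup>+g. h g * k (z \<otimes> g) \<partial>\<mu>) = (\<integral>\<^sup>+g. h (inv z \<otimes> g) * k g \<partial>\<mu>)" by simp
  qed
  also have "\<dots> = (\<integral>\<^sup>+g. (\<integral>\<^sup>+z. h (inv z \<otimes> g) * k g \<partial>\<mu>) \<partial>\<mu>)"
    by (rule \<mu>\<mu>.Fubini'[symmetric]) measurable
  also have "\<dots> = (\<integral>\<^sup>+g. (\<integral>\<^sup>+z. h (inv z) \<partial>\<mu>) * k g \<partial>\<mu>)"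
  proof (rule nn_integral_cong)
    fix g
    have "(\<integral>\<^sup>+z. h (inv (g \<otimes> z) \<otimes> g) * k g \<partial>\<mu>) = (\<integral>\<^sup>+z. h (inv z \<otimes> g) * k g \<partial>\<mu>)"
      by (rule nn_integral_transl[where f = "\<lambda>z. h (inv z \<otimes> g) * k g"]) measurable
    then have "(\<integral>\<^sup>+z. h (inv z \<otimes> g) * k g \<partial>\<mu>) = (\<integral>\<^sup>+z. h (inv z) * k g \<partial>\<mu>)"
      by (simp add: inv_mult_group m_assoc)
    also have "\<dots> = (\<integral>\<^sup>+z. h (inv z) \<partial>\<mu>) * k g" by (rule nn_integral_multc) measurable
    finally show "(\<integral>\<^sup>+z. h (inv z \<otimes> g) * k g \<partial>\<mu>) = (\<integral>\<^sup>+z. h (inv z) \<partial>\<mu>) * k g" .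
  qed
  also have "\<dots> = (\<integral>\<^sup>+z. h (inv z) \<partial>\<mu>) * (\<integral>\<^sup>+g. k g \<partial>\<mu>)"
    by (rule nn_integral_cmult) measurable
  finally show ?thesis .
qed

lemma nn_integral_inv_finite:
  assumes "continuous_on UNIV h" "compact K" "\<And>x. x \<notin> K \<Longrightarrow> h x = (0::real)"
  shows "(\<integral>\<^sup>+z. ennreal \<bar>h (inv z)\<bar> \<partial>\<mu>) < \<infinity>"
proof -
  have "integrable \<mu> (\<lambda>z. h (inv z))"
  proof (rule integrable_haar_compact_support)
    show "continuous_on UNIV (\<lambda>z. h (inv z))"
      by (rule continuous_on_compose2[OF assms(1)]) (auto intro!: continuous_on_group_inv continuous_intros)
    show "compact ((\<lambda>z. inv z) ` K)"
      by (intro compact_continuous_image assms(2) continuous_on_group_inv continuous_intros)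
    fix x assume x: "x \<notin> (\<lambda>z. inv z) ` K"
    show "h (inv x) = 0"
    proof (rule assms(3), rule notI)
      assume "inv x \<in> K"
      then have "inv (inv x) \<in> (\<lambda>z. inv z) ` K" by (rule imageI)
      then show False using x by simp
    qed
  qed
  then show ?thesis by (simp add: integrable_iff_bounded)
qed

text \<open>The averaged weight of the cutoff stands on the left of the averaged estimate and has to
  be divided out.\<close>

lemma nn_integral_inv_pos:
  assumes h: "continuous_on UNIV h" and x: "h x > (0::real)"
  shows "(\<integral>\<^sup>+z. ennreal \<bar>h (inv z)\<bar> \<partial>\<mu>) > 0"
proof -
  have c: "continuous_on UNIV (\<lambda>z. h (inv z))"
    by (rule continuous_on_compose2[OF h]) (auto intro!: continuous_on_group_inv continuous_intros)
  have [measurable]: "(\<lambda>z. h (inv z)) \<in> borel_measurable borel" by (rule borel_measurable_continuous_onI[OF c])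
  have V: "open {z. 0 < h (inv z)}" by (intro open_Collect_less c continuous_on_const)
  have "inv x \<in> {z. 0 < h (inv z)}" using x by simp
  then have pos: "emeasure \<mu> {z. 0 < h (inv z)} > 0" using haar_open_pos[OF V] by blast
  show ?thesis
  proof (rule ccontr)
    assume "\<not> ?thesis"
    then have "(\<integral>\<^sup>+z. ennreal \<bar>h (inv z)\<bar> \<partial>\<mu>) = 0" by simp
    then have "AE z in \<mu>. ennreal \<bar>h (inv z)\<bar> = 0" by (subst (asm) nn_integral_0_iff_AE) auto
    then have "AE z in \<mu>. \<not> 0 < h (inv z)" by (rule eventually_mono) auto
    then have "emeasure \<mu> {z. 0 < h (inv z)} = 0"
      using AE_iff_measurable[of "{z. 0 < h (inv z)}" \<mu> "\<lambda>z. \<not> 0 < h (inv z)"] V by simp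
    then show False using pos by simp
  qed
qed

end

section \<open>Localisation of a matrix operator\<close>

locale matrix_diff_op = haar_lie_grp G A \<mu>
  for G :: "'g::{second_countable_topology, t2_space} monoid" (structure)
    and A :: "('g, 'e::euclidean_space) chart set" and \<mu> :: "'g measure" +
  fixes \<nu> m n q :: nat and X :: "nat \<Rightarrow> 'g operator"
    and a :: "nat \<Rightarrow> nat \<Rightarrow> nat list \<Rightarrow> 'g \<Rightarrow> real"
  assumes fields: "\<forall>i\<in>{1..\<nu>}. X i \<in> lie_algebra G A"
    and order: "1 \<le> m"
    and coeff_measurable: "\<forall>i\<in>{1..n}. \<forall>j\<in>{1..q}. \<forall>k\<le>m. \<forall>I\<in>multi_indices \<nu> k.
      a i j I \<in> borel_measurable \<mu>"
    and principal_invariant: "\<forall>i\<in>{1..n}. \<forall>j\<in>{1..q}. left_invariant_op G A \<mu> (principal_part \<nu> X m (a i j))"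
    and lower_bounded: "\<forall>i\<in>{1..n}. \<forall>j\<in>{1..q}. \<forall>k<m. \<forall>I\<in>multi_indices \<nu> k. a i j I \<in> L_infty \<mu>"
begin

definition lower_part :: "nat \<Rightarrow> nat \<Rightarrow> ('g \<Rightarrow> real) \<Rightarrow> 'g \<Rightarrow> real" where
  "lower_part i j u x = (\<Sum>k<m. \<Sum>I\<in>multi_indices \<nu> k. a i j I x * word_op X I u x)"

lemma scalar_op_split:
  "scalar_op \<nu> X m (a i j) u x = lower_part i j u x + principal_part \<nu> X m (a i j) u x"
  unfolding scalar_op_def lower_part_def principal_part_def
  by (simp add: atMost_atLeast0[symmetric] lessThan_Suc_atMost[symmetric])

lemma lower_part_bound:
  assumes "\<And>k I. k < m \<Longrightarrow> I \<in> multi_indices \<nu> k \<Longrightarrow> \<bar>a i j I x\<bar> \<le> B"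
  shows "\<bar>lower_part i j u x\<bar> \<le> B * word_sum \<nu> X m u x"
proof -
  have "\<bar>lower_part i j u x\<bar> \<le> (\<Sum>k<m. \<Sum>I\<in>multi_indices \<nu> k. \<bar>a i j I x * word_op X I u x\<bar>)"
    unfolding lower_part_def by (rule order_trans[OF sum_abs sum_mono[OF sum_abs]])
  also have "\<dots> \<le> (\<Sum>k<m. \<Sum>I\<in>multi_indices \<nu> k. B * \<bar>word_op X I u x\<bar>)"
    unfolding abs_mult using assms by (intro sum_mono mult_right_mono) auto
  also have "\<dots> = B * word_sum \<nu> X m u x" by (simp add: word_sum_def sum_distrib_left)
  finally show ?thesis .
qed

lemma lower_coefficients_bounded:
  obtains B where "B \<ge> 0" "AE x in \<mu>. \<forall>i\<in>{1..n}. \<forall>j\<in>{1..q}. \<forall>k<m. \<forall>I\<in>multi_indices \<nu> k. \<bar>a i j I x\<bar> \<le> B"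
proof -
  define T where "T = {1..n} \<times> {1..q} \<times> (\<Union>k<m. multi_indices \<nu> k)"
  have T: "finite T" by (auto simp: T_def)
  have "\<forall>t\<in>T. \<exists>B. AE x in \<mu>. \<bar>a (fst t) (fst (snd t)) (snd (snd t)) x\<bar> \<le> B"
    using lower_bounded by (auto simp: T_def L_infty_def)
  from bchoice[OF this] obtain b where
    b: "\<forall>t\<in>T. AE x in \<mu>. \<bar>a (fst t) (fst (snd t)) (snd (snd t)) x\<bar> \<le> b t" ..
  have "AE x in \<mu>. \<forall>t\<in>T. \<bar>a (fst t) (fst (snd t)) (snd (snd t)) x\<bar> \<le> b t"
    using b T by (simp add: AE_finite_all)
  then have "AE x in \<mu>. \<forall>i\<in>{1..n}. \<forall>j\<in>{1..q}. \<forall>k<m. \<forall>I\<in>multi_indices \<nu> k. \<bar>a i j I x\<bar> \<le> (\<Sum>t\<in>T. \<bar>b t\<bar>)"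
  proof (rule eventually_mono, intro ballI allI impI)
    fix x i j k I
    assume *: "\<forall>t\<in>T. \<bar>a (fst t) (fst (snd t)) (snd (snd t)) x\<bar> \<le> b t" "i \<in> {1..n}" "j \<in> {1..q}" "k < m"
      "I \<in> multi_indices \<nu> k"
    then have t: "(i, j, I) \<in> T" by (auto simp: T_def)
    have "\<bar>a i j I x\<bar> \<le> b (i, j, I)" using bspec[OF *(1) t] by simp
    also have "\<dots> \<le> \<bar>b (i, j, I)\<bar>" by simp
    also have "\<dots> \<le> (\<Sum>t\<in>T. \<bar>b t\<bar>)" using t T by (intro member_le_sum) auto
    finally show "\<bar>a i j I x\<bar> \<le> (\<Sum>t\<in>T. \<bar>b t\<bar>)" .
  qed
  then show ?thesis using that[of "\<Sum>t\<in>T. \<bar>b t\<bar>"] by (simp add: sum_nonneg)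
qed

text \<open>The product bound for \<open>\<phi>\<close> and a left translate of \<open>u\<close>,
  through which the words pass.\<close>

lemma word_op_localized:
  assumes \<phi>: "\<phi> \<in> smooth_functions A" and u: "u \<in> smooth_functions A"
    and I: "I \<in> multi_indices \<nu> k" "k \<le> m"
  shows "\<bar>word_op X I (\<lambda>g. \<phi> g * u (z \<otimes> g)) g - \<phi> g * word_op X I u (z \<otimes> g)\<bar> \<le>
    3 ^ m * word_sum \<nu> X (Suc m) \<phi> g * word_sum \<nu> X k u (z \<otimes> g)"
proof -
  let ?v = "left_transl G (inv z) u"
  have v: "?v \<in> smooth_functions A" by (rule left_transl_smooth[OF u])
  have eq: "word_op X J ?v g = word_op X J u (z \<otimes> g)" if "J \<in> multi_indices \<nu> l" for J l
    using word_op_left_transl[OF fields u, of J "inv z"] that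
    by (simp add: multi_indices_def) (simp add: left_transl_def)
  have vz: "?v = (\<lambda>g. u (z \<otimes> g))" by (simp add: left_transl_def)
  have ws: "word_sum \<nu> X k ?v g = word_sum \<nu> X k u (z \<otimes> g)"
    unfolding word_sum_def by (intro sum.cong refl) (simp add: eq)
  have "\<bar>word_op X I (\<lambda>g. \<phi> g * ?v g) g - \<phi> g * word_op X I ?v g\<bar> \<le>
      3 ^ k * word_sum \<nu> X (Suc k) \<phi> g * word_sum \<nu> X k ?v g"
    by (rule word_op_mult_bound[OF fields I(1) \<phi> v])
  also have "\<dots> \<le> 3 ^ m * word_sum \<nu> X (Suc m) \<phi> g * word_sum \<nu> X k ?v g"
    using I(2) by (intro mult_right_mono mult_mono power_increasing word_sum_mono) auto
  finally show ?thesis unfolding ws eq[OF I(1)] unfolding vz .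
qed

text \<open>
  The commutator of the principal part with the cutoff function is controlled by means of frozen
  coefficients, chosen below the same bound \<open>M\<close> for every \<open>\<alpha>\<close> and \<open>z\<close>.
\<close>

lemma matrix_op_localized:
  assumes \<phi>: "\<phi> \<in> smooth_functions A"
  obtains K where "K > 0" "\<And>\<alpha> z. (\<And>i. i \<in> {1..n} \<Longrightarrow> \<alpha> i \<in> smooth_functions A) \<Longrightarrow>
    AE g in \<mu>. \<forall>j\<in>{1..q}. \<bar>matrix_op \<nu> X m n a (\<lambda>i g. \<phi> g * \<alpha> i (z \<otimes> g)) j g\<bar> \<le>
      K * (word_sum \<nu> X (Suc m) \<phi> g *
        (\<bar>matrix_op \<nu> X m n a \<alpha> j (z \<otimes> g)\<bar> + (\<Sum>i=1..n. word_sum \<nu> X m (\<alpha> i) (z \<otimes> g))))"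
proof -
  obtain B where B: "B \<ge> 0"
    "AE x in \<mu>. \<forall>i\<in>{1..n}. \<forall>j\<in>{1..q}. \<forall>k<m. \<forall>I\<in>multi_indices \<nu> k. \<bar>a i j I x\<bar> \<le> B"
    by (rule lower_coefficients_bounded)
  define T where "T = {1..n} \<times> {1..q} \<times> multi_indices \<nu> m"
  have T: "finite T" by (auto simp: T_def)
  obtain M where M: "M > 0" "\<And>P. AE y in \<mu>. P y \<Longrightarrow>
      \<exists>y. P y \<and> (\<forall>t\<in>T. \<bar>a (fst t) (fst (snd t)) (snd (snd t)) y\<bar> \<le> M)"
    using AE_ex_bounded[OF T, of "\<lambda>t. a (fst t) (fst (snd t)) (snd (snd t))"] by blast
  define W where "W = real (\<Sum>k<m. card (multi_indices \<nu> k))"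
  define N where "N = real (card (multi_indices \<nu> m))"
  define K where "K = 1 + B * (W * (1 + 3 ^ m)) + N * (M * 3 ^ m) + B"
  have W: "W \<ge> 0" and N: "N \<ge> 0" by (simp_all add: W_def N_def sum_nonneg)
  have K: "K > 0" using B M W N by (simp add: K_def add_pos_nonneg)
  show ?thesis
  proof (rule that[OF K])
    fix \<alpha> z assume \<alpha>: "\<And>i. i \<in> {1..n} \<Longrightarrow> \<alpha> i \<in> smooth_functions A"
    define \<beta> where "\<beta> i g = \<phi> g * \<alpha> i (z \<otimes> g)" for i g
    have \<beta>: "\<beta> i \<in> smooth_functions A" if "i \<in> {1..n}" for i
      using smooth_functions_mult[OF \<phi> left_transl_smooth[OF \<alpha>[OF that], of "inv z"]]
      by (simp add: \<beta>_def[abs_def] left_transl_def)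
    define c where "c y i j u w = (\<Sum>I\<in>multi_indices \<nu> m. a i j I y * word_op X I u w)" for y i j u w
    have fr: "AE y in \<mu>. AE w in \<mu>. principal_part \<nu> X m (a i j) u w = c y i j u w"
      if "i \<in> {1..n}" "j \<in> {1..q}" "u \<in> smooth_functions A" for i j u
    proof -
      have "\<forall>I\<in>multi_indices \<nu> m. a i j I \<in> borel_measurable \<mu>"
        using coeff_measurable that(1,2) order_refl[of m] by blast
      moreover have "left_invariant_op G A \<mu> (principal_part \<nu> X m (a i j))"
        using principal_invariant that(1,2) by blast
      ultimately show ?thesis
        unfolding c_def by (rule left_invariant_frozen_coefficients[OF fields _ _ that(3)])
    qed
    \<comment> \<open>The same point \<open>y\<close> has to serve for \<open>\<alpha>\<close> and
      \<open>\<beta>\<close> and for all entries: only then do the principal parts at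
      \<open>g\<close> and at \<open>z \<otimes> g\<close> have the same coefficients, so that their
      difference is a commutator with \<open>\<phi>\<close>.\<close>
    have "AE y in \<mu>. \<forall>i\<in>{1..n}. \<forall>j\<in>{1..q}.
        (AE w in \<mu>. principal_part \<nu> X m (a i j) (\<alpha> i) w = c y i j (\<alpha> i) w) \<and>
        (AE w in \<mu>. principal_part \<nu> X m (a i j) (\<beta> i) w = c y i j (\<beta> i) w)"
      unfolding AE_finite_all[OF finite_atLeastAtMost]
      by (intro ballI AE_conjI fr \<alpha> \<beta>)
    from M(2)[OF this] obtain y where
      y: "\<forall>i\<in>{1..n}. \<forall>j\<in>{1..q}.
        (AE w in \<mu>. principal_part \<nu> X m (a i j) (\<alpha> i) w = c y i j (\<alpha> i) w) \<and>
        (AE w in \<mu>. principal_part \<nu> X m (a i j) (\<beta> i) w = c y i j (\<beta> i) w)"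
      "\<forall>t\<in>T. \<bar>a (fst t) (fst (snd t)) (snd (snd t)) y\<bar> \<le> M" by blast
    have ay: "\<bar>a i j I y\<bar> \<le> M" if "i \<in> {1..n}" "j \<in> {1..q}" "I \<in> multi_indices \<nu> m" for i j I
      using bspec[OF y(2), of "(i, j, I)"] that by (simp add: T_def)
    have 1: "AE g in \<mu>. \<forall>i\<in>{1..n}. \<forall>j\<in>{1..q}.
        principal_part \<nu> X m (a i j) (\<alpha> i) (z \<otimes> g) = c y i j (\<alpha> i) (z \<otimes> g)"
      unfolding AE_finite_all[OF finite_atLeastAtMost]
      by (intro ballI AE_transl) (use y(1) in blast)
    have 2: "AE g in \<mu>. \<forall>i\<in>{1..n}. \<forall>j\<in>{1..q}. principal_part \<nu> X m (a i j) (\<beta> i) g = c y i j (\<beta> i) g"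
      unfolding AE_finite_all[OF finite_atLeastAtMost] using y(1) by blast
    show "AE g in \<mu>. \<forall>j\<in>{1..q}. \<bar>matrix_op \<nu> X m n a (\<lambda>i g. \<phi> g * \<alpha> i (z \<otimes> g)) j g\<bar> \<le>
      K * (word_sum \<nu> X (Suc m) \<phi> g *
        (\<bar>matrix_op \<nu> X m n a \<alpha> j (z \<otimes> g)\<bar> + (\<Sum>i=1..n. word_sum \<nu> X m (\<alpha> i) (z \<otimes> g))))"
      using 1 2 B(2) AE_transl[OF B(2), of z]
    proof (eventually_elim, intro ballI)
      fix g j
      assume e1: "\<forall>i\<in>{1..n}. \<forall>j\<in>{1..q}.
          principal_part \<nu> X m (a i j) (\<alpha> i) (z \<otimes> g) = c y i j (\<alpha> i) (z \<otimes> g)"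
        and e2: "\<forall>i\<in>{1..n}. \<forall>j\<in>{1..q}. principal_part \<nu> X m (a i j) (\<beta> i) g = c y i j (\<beta> i) g"
        and b1: "\<forall>i\<in>{1..n}. \<forall>j\<in>{1..q}. \<forall>k<m. \<forall>I\<in>multi_indices \<nu> k. \<bar>a i j I g\<bar> \<le> B"
        and b2: "\<forall>i\<in>{1..n}. \<forall>j\<in>{1..q}. \<forall>k<m. \<forall>I\<in>multi_indices \<nu> k. \<bar>a i j I (z \<otimes> g)\<bar> \<le> B"
        and j: "j \<in> {1..q}"
      define \<psi> where "\<psi> = word_sum \<nu> X (Suc m) \<phi> g"
      define s where "s i = word_sum \<nu> X m (\<alpha> i) (z \<otimes> g)" for i
      define S where "S = (\<Sum>i=1..n. s i)"
      define f where "f = matrix_op \<nu> X m n a \<alpha> j (z \<otimes> g)"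
      have \<psi>: "\<psi> \<ge> 0" and s: "s i \<ge> 0" for i by (simp_all add: \<psi>_def s_def)
      have S: "S \<ge> 0" using s by (simp add: S_def sum_nonneg)
      have \<phi>\<psi>: "\<bar>\<phi> g\<bar> \<le> \<psi>"
        using word_le_word_sum[of "[]" \<nu> 0 "Suc m" X \<phi> g] by (simp add: \<psi>_def)
      have loc: "\<bar>word_op X I (\<beta> i) g - \<phi> g * word_op X I (\<alpha> i) (z \<otimes> g)\<bar> \<le> 3 ^ m * \<psi> * s i"
        if "i \<in> {1..n}" "I \<in> multi_indices \<nu> k" "k \<le> m" for i I k
      proof -
        have "\<bar>word_op X I (\<beta> i) g - \<phi> g * word_op X I (\<alpha> i) (z \<otimes> g)\<bar> \<le>
            3 ^ m * \<psi> * word_sum \<nu> X k (\<alpha> i) (z \<otimes> g)"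
          unfolding \<psi>_def \<beta>_def by (rule word_op_localized[OF \<phi> \<alpha>[OF that(1)] that(2,3)])
        also have "\<dots> \<le> 3 ^ m * \<psi> * s i"
          unfolding s_def using \<psi> that by (intro mult_left_mono word_sum_mono) auto
        finally show ?thesis .
      qed
      have low1: "\<bar>lower_part i j (\<beta> i) g\<bar> \<le> B * (W * (1 + 3 ^ m)) * (\<psi> * s i)" if i: "i \<in> {1..n}" for i
      proof -
        have "word_sum \<nu> X m (\<beta> i) g \<le> (\<Sum>k<m. \<Sum>I\<in>multi_indices \<nu> k. (1 + 3 ^ m) * (\<psi> * s i))"
          unfolding word_sum_def
        proof (intro sum_mono)
          fix k I assume k: "k \<in> {..<m}" and I: "I \<in> multi_indices \<nu> k"
          have "\<bar>\<phi> g * word_op X I (\<alpha> i) (z \<otimes> g)\<bar> \<le> \<psi> * s i"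
            unfolding abs_mult s_def using k \<phi>\<psi> \<psi> word_le_word_sum[OF I, of m X "\<alpha> i"]
            by (intro mult_mono) auto
          then show "\<bar>word_op X I (\<beta> i) g\<bar> \<le> (1 + 3 ^ m) * (\<psi> * s i)"
            using loc[OF i I] k by (simp add: algebra_simps)
        qed
        also have "\<dots> = W * (1 + 3 ^ m) * (\<psi> * s i)" by (simp add: W_def sum_distrib_right mult.assoc)
        finally have "B * word_sum \<nu> X m (\<beta> i) g \<le> B * (W * (1 + 3 ^ m) * (\<psi> * s i))"
          using B by (intro mult_left_mono)
        moreover have "\<bar>lower_part i j (\<beta> i) g\<bar> \<le> B * word_sum \<nu> X m (\<beta> i) g"
          using b1 i j by (intro lower_part_bound) auto
        ultimately show ?thesis by (simp add: mult.assoc)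
      qed
      have low2: "\<bar>\<phi> g * lower_part i j (\<alpha> i) (z \<otimes> g)\<bar> \<le> B * (\<psi> * s i)" if i: "i \<in> {1..n}" for i
      proof -
        have "\<bar>lower_part i j (\<alpha> i) (z \<otimes> g)\<bar> \<le> B * s i"
          unfolding s_def using b2 i j by (intro lower_part_bound) auto
        then have "\<bar>\<phi> g\<bar> * \<bar>lower_part i j (\<alpha> i) (z \<otimes> g)\<bar> \<le> \<psi> * (B * s i)"
          using \<phi>\<psi> \<psi> by (intro mult_mono) auto
        then show ?thesis by (simp add: abs_mult mult_ac)
      qed
      have err: "\<bar>c y i j (\<beta> i) g - \<phi> g * c y i j (\<alpha> i) (z \<otimes> g)\<bar> \<le> N * (M * 3 ^ m) * (\<psi> * s i)"
        if i: "i \<in> {1..n}" for i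
      proof -
        have "c y i j (\<beta> i) g - \<phi> g * c y i j (\<alpha> i) (z \<otimes> g) =
            (\<Sum>I\<in>multi_indices \<nu> m. a i j I y * (word_op X I (\<beta> i) g - \<phi> g * word_op X I (\<alpha> i) (z \<otimes> g)))"
          by (simp add: c_def sum_distrib_left sum_subtractf right_diff_distrib mult_ac)
        also have "\<bar>\<dots>\<bar> \<le> (\<Sum>I\<in>multi_indices \<nu> m. M * (3 ^ m * \<psi> * s i))"
          unfolding abs_mult
          by (rule order_trans[OF sum_abs], unfold abs_mult, intro sum_mono mult_mono ay[OF i j] loc[OF i])
            (use M in auto)
        also have "\<dots> = N * (M * 3 ^ m) * (\<psi> * s i)" by (simp add: N_def mult_ac)
        finally show ?thesis .
      qed
      have "matrix_op \<nu> X m n a \<beta> j g = (\<Sum>i=1..n. lower_part i j (\<beta> i) g + c y i j (\<beta> i) g)"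
        unfolding matrix_op_def scalar_op_split using e2 j by (intro sum.cong) auto
      \<comment> \<open>Add and subtract \<open>\<phi> g\<close> times the value of the operator on
        \<open>\<alpha>\<close> at \<open>z \<otimes> g\<close>.\<close>
      also have "\<dots> = (\<Sum>i=1..n. lower_part i j (\<beta> i) g
          + (c y i j (\<beta> i) g - \<phi> g * c y i j (\<alpha> i) (z \<otimes> g))
          - \<phi> g * lower_part i j (\<alpha> i) (z \<otimes> g)
          + \<phi> g * (lower_part i j (\<alpha> i) (z \<otimes> g) + c y i j (\<alpha> i) (z \<otimes> g)))"
        by (intro sum.cong refl) (simp add: algebra_simps)
      also have "\<dots> = (\<Sum>i=1..n. lower_part i j (\<beta> i) g
          + (c y i j (\<beta> i) g - \<phi> g * c y i j (\<alpha> i) (z \<otimes> g))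
          - \<phi> g * lower_part i j (\<alpha> i) (z \<otimes> g)) + \<phi> g * f"
      proof -
        have "f = (\<Sum>i=1..n. lower_part i j (\<alpha> i) (z \<otimes> g) + c y i j (\<alpha> i) (z \<otimes> g))"
          unfolding f_def matrix_op_def scalar_op_split using e1 j by (intro sum.cong) auto
        then show ?thesis by (simp only: sum_distrib_left sum.distrib[symmetric])
      qed
      finally have eq: "matrix_op \<nu> X m n a \<beta> j g = \<dots>" .
      have "\<bar>\<Sum>i=1..n. lower_part i j (\<beta> i) g
          + (c y i j (\<beta> i) g - \<phi> g * c y i j (\<alpha> i) (z \<otimes> g))
          - \<phi> g * lower_part i j (\<alpha> i) (z \<otimes> g)\<bar> \<le> (\<Sum>i=1..n. (K - 1) * (\<psi> * s i))"
      proof (rule order_trans[OF sum_abs], rule sum_mono)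
        fix i assume i: "i \<in> {1..n}"
        have "(K - 1) * (\<psi> * s i) = B * (W * (1 + 3 ^ m)) * (\<psi> * s i) + N * (M * 3 ^ m) * (\<psi> * s i) + B * (\<psi> * s i)"
          by (simp add: K_def distrib_right)
        then show "\<bar>lower_part i j (\<beta> i) g + (c y i j (\<beta> i) g - \<phi> g * c y i j (\<alpha> i) (z \<otimes> g))
          - \<phi> g * lower_part i j (\<alpha> i) (z \<otimes> g)\<bar> \<le> (K - 1) * (\<psi> * s i)"
          using low1[OF i] low2[OF i] err[OF i] by linarith
      qed
      also have "\<dots> = (K - 1) * (\<psi> * S)" by (simp add: S_def sum_distrib_left)
      also have "\<dots> \<le> K * (\<psi> * S)" using \<psi> S by (intro mult_right_mono) auto
      finally have A: "\<bar>\<Sum>i=1..n. lower_part i j (\<beta> i) g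
          + (c y i j (\<beta> i) g - \<phi> g * c y i j (\<alpha> i) (z \<otimes> g))
          - \<phi> g * lower_part i j (\<alpha> i) (z \<otimes> g)\<bar> \<le> K * (\<psi> * S)" .
      have "1 \<le> K" using B M W N by (simp add: K_def)
      then have "1 * (\<psi> * \<bar>f\<bar>) \<le> K * (\<psi> * \<bar>f\<bar>)" using \<psi> by (intro mult_right_mono) auto
      moreover have "\<bar>\<phi> g * f\<bar> \<le> \<psi> * \<bar>f\<bar>" using \<phi>\<psi> by (simp add: abs_mult mult_right_mono)
      ultimately have "\<bar>matrix_op \<nu> X m n a \<beta> j g\<bar> \<le> K * (\<psi> * S) + K * (\<psi> * \<bar>f\<bar>)"
        using A unfolding eq by linarith
      then show "\<bar>matrix_op \<nu> X m n a (\<lambda>i g. \<phi> g * \<alpha> i (z \<otimes> g)) j g\<bar> \<le>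
        K * (word_sum \<nu> X (Suc m) \<phi> g *
          (\<bar>matrix_op \<nu> X m n a \<alpha> j (z \<otimes> g)\<bar> + (\<Sum>i=1..n. word_sum \<nu> X m (\<alpha> i) (z \<otimes> g))))"
        unfolding \<beta>_def[abs_def] \<psi>_def S_def s_def f_def by (simp add: algebra_simps)
    qed
  qed
qed

end

lemma (in haar_lie_grp) word_sum_continuous_support:
  assumes X: "\<forall>i\<in>{1..\<nu>}. X i \<in> lie_algebra G A" and u: "u \<in> test_functions A \<Omega>"
  shows "continuous_on UNIV (word_sum \<nu> X l u)"
    "x \<notin> closure {x. u x \<noteq> 0} \<Longrightarrow> word_sum \<nu> X l u x = 0"
proof -
  have "u \<in> test_functions A (closure {x. u x \<noteq> 0})" using u by (simp add: test_functions_def)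
  then have w: "word_op X I u \<in> test_functions A (closure {x. u x \<noteq> 0})" if "I \<in> multi_indices \<nu> k" for I k
    using word_op_test[OF X] that by (simp add: multi_indices_def)
  show "continuous_on UNIV (word_sum \<nu> X l u)"
    unfolding word_sum_def[abs_def] by (intro continuous_on_sum continuous_on_rabs test_functions_cont[OF w])
  assume x: "x \<notin> closure {x. u x \<noteq> 0}"
  have "word_op X I u x = 0" if "I \<in> multi_indices \<nu> k" for I k
    using w[OF that] x closure_subset[of "{x. word_op X I u x \<noteq> 0}"] unfolding test_functions_def by blast
  then show "word_sum \<nu> X l u x = 0" unfolding word_sum_def by (simp add: sum.neutral)
qed

context matrix_diff_op
begin

lemma matrix_op_measurable:
  assumes "\<And>i. i \<in> {1..n} \<Longrightarrow> \<alpha> i \<in> smooth_functions A" "j \<in> {1..q}"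
  shows "matrix_op \<nu> X m n a \<alpha> j \<in> borel_measurable borel"
  unfolding matrix_op_def scalar_op_def
proof (intro borel_measurable_sum borel_measurable_times)
  fix i k I assume *: "i \<in> {1..n}" "k \<in> {0..m}" "I \<in> multi_indices \<nu> k"
  then have "a i j I \<in> borel_measurable \<mu>" using coeff_measurable assms(2) by (meson atLeastAtMost_iff)
  then show "a i j I \<in> borel_measurable borel" unfolding measurable_haar .
  show "word_op X I (\<alpha> i) \<in> borel_measurable borel"
    using * word_op_smooth[OF fields assms(1)[OF *(1)], of I] smooth_functions_measurable
    by (simp add: multi_indices_def)
qed

text \<open>The error terms carry the weight \<open>\<psi>\<close>, which dominates
  \<open>\<phi>\<close> and its derivatives, while the left-hand side carries \<open>\<phi>\<close>
  itself. Averaging turns the two weights into the constants \<open>k\<psi>\<close> and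
  \<open>k\<phi>\<close>, whose ratio enters \<open>K\<close>.\<close>

lemma top_order_estimate:
  assumes p: "1 \<le> p" and \<Omega>: "open \<Omega>" "\<Omega> \<noteq> {}" and hyp: "maximal_hypoelliptic A \<mu> p \<nu> X m n q a \<Omega>"
  obtains K where "K > 0" "\<And>\<alpha> i I. (\<And>i. i \<in> {1..n} \<Longrightarrow> \<alpha> i \<in> test_functions A UNIV) \<Longrightarrow> i \<in> {1..n} \<Longrightarrow>
    I \<in> multi_indices \<nu> m \<Longrightarrow> Lp_pow \<mu> p (word_op X I (\<alpha> i)) \<le>
      ennreal K * ((\<Sum>j=1..q. Lp_pow \<mu> p (matrix_op \<nu> X m n a \<alpha> j)) +
        Lp_pow \<mu> p (\<lambda>x. \<Sum>i=1..n. word_sum \<nu> X m (\<alpha> i) x))"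
proof -
  obtain x0 where "x0 \<in> \<Omega>" using \<Omega> by blast
  then obtain \<phi> where \<phi>: "\<phi> \<in> test_functions A \<Omega>" "\<phi> x0 = 1" "\<And>y. \<phi> y \<ge> 0"
    using bump_function[OF \<Omega>(1)] by blast
  have \<phi>s: "\<phi> \<in> smooth_functions A" by (rule test_functions_smooth[OF \<phi>(1)])
  define \<psi> where "\<psi> = word_sum \<nu> X (Suc m) \<phi>"
  let ?S = "closure {x. \<phi> x \<noteq> 0}"
  have Sc: "compact ?S" by (rule test_functions_support[OF \<phi>(1)])
  have \<psi>c: "continuous_on UNIV \<psi>" and \<psi>0: "\<And>x. x \<notin> ?S \<Longrightarrow> \<psi> x = 0"
    unfolding \<psi>_def using word_sum_continuous_support[OF fields \<phi>(1)] by blast+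
  have \<psi>pos: "\<psi> x \<ge> 0" for x by (simp add: \<psi>_def)
  have \<phi>\<psi>: "\<phi> x \<le> \<psi> x" for x
    using word_le_word_sum[of "[]" \<nu> 0 "Suc m" X \<phi> x] \<phi>(3)[of x] by (simp add: \<psi>_def)
  define h\<psi> where "h\<psi> x = \<psi> x powr p" for x
  define h\<phi> where "h\<phi> x = \<phi> x powr p" for x
  have hc: "continuous_on UNIV h\<psi>" "continuous_on UNIV h\<phi>"
    unfolding h\<psi>_def h\<phi>_def using \<psi>pos \<phi>(3) p
    by (intro continuous_on_powr' \<psi>c test_functions_cont[OF \<phi>(1)] continuous_on_const; simp)+
  have h0: "h\<psi> x = 0" "h\<phi> x = 0" if "x \<notin> ?S" for x
    using \<psi>0[OF that] test_functions_support(2)[OF \<phi>(1) that] by (simp_all add: h\<psi>_def h\<phi>_def)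
  have hpos: "h\<psi> x \<ge> 0" "h\<phi> x \<ge> 0" for x by (simp_all add: h\<psi>_def h\<phi>_def)
  note [measurable] = borel_measurable_continuous_onI[OF hc(1)] borel_measurable_continuous_onI[OF hc(2)]
  define \<kappa>\<psi> where "\<kappa>\<psi> = (\<integral>\<^sup>+z. ennreal (h\<psi> (inv z)) \<partial>\<mu>)"
  define \<kappa>\<phi> where "\<kappa>\<phi> = (\<integral>\<^sup>+z. ennreal (h\<phi> (inv z)) \<partial>\<mu>)"
  have "\<kappa>\<psi> < \<infinity>" using nn_integral_inv_finite[OF hc(1) Sc] h0 hpos by (simp add: \<kappa>\<psi>_def)
  then obtain k\<psi> where k\<psi>: "\<kappa>\<psi> = ennreal k\<psi>" "k\<psi> \<ge> 0" by (cases \<kappa>\<psi>) auto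
  have "\<kappa>\<phi> < \<infinity>" using nn_integral_inv_finite[OF hc(2) Sc] h0 hpos by (simp add: \<kappa>\<phi>_def)
  then obtain k\<phi> where k\<phi>: "\<kappa>\<phi> = ennreal k\<phi>" "k\<phi> \<ge> 0" by (cases \<kappa>\<phi>) auto
  have "\<kappa>\<phi> > 0" using nn_integral_inv_pos[OF hc(2), of x0] \<phi>(2) hpos by (simp add: \<kappa>\<phi>_def h\<phi>_def)
  then have k\<phi>0: "k\<phi> > 0" using k\<phi> by simp
  obtain C where C: "C > 0" "\<And>\<beta>. (\<forall>i\<in>{1..n}. \<beta> i \<in> test_functions A \<Omega>) \<Longrightarrow>
      (\<Sum>l=0..m. seminorm_vec \<mu> p \<nu> X n l \<beta>)
        \<le> ennreal C * (Lp_norm_vec \<mu> p q (matrix_op \<nu> X m n a \<beta>) + Lp_norm_vec \<mu> p n \<beta>)"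
    using hyp unfolding maximal_hypoelliptic_def by blast
  obtain K1 where K1: "K1 > 0" "\<And>\<alpha> z. (\<And>i. i \<in> {1..n} \<Longrightarrow> \<alpha> i \<in> smooth_functions A) \<Longrightarrow>
    AE g in \<mu>. \<forall>j\<in>{1..q}. \<bar>matrix_op \<nu> X m n a (\<lambda>i g. \<phi> g * \<alpha> i (z \<otimes> g)) j g\<bar> \<le>
      K1 * (\<psi> g * (\<bar>matrix_op \<nu> X m n a \<alpha> j (z \<otimes> g)\<bar> + (\<Sum>i=1..n. word_sum \<nu> X m (\<alpha> i) (z \<otimes> g))))"
    unfolding \<psi>_def using matrix_op_localized[OF \<phi>s] by blast
  \<comment> \<open>The disjoint sum indexes the components of \<open>\<P>\<beta>\<close> and those
    of \<open>\<beta>\<close> together, so that the right-hand side is a single finite sum.\<close>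
  let ?P = "{1..q} <+> {1..n}"
  define C1 where "C1 = (C * real (card ?P)) powr p"
  define c where "c = (2 * K1) powr p"
  define C2 where "C2 = 2 powr p * (C1 * (real q * c + real n) + (3 ^ m) powr p)"
  have C1: "C1 \<ge> 0" and c: "c \<ge> 0" by (simp_all add: C1_def c_def)
  have C2: "C2 \<ge> 0" unfolding C2_def using C1 c by (intro mult_nonneg_nonneg add_nonneg_nonneg) auto
  \<comment> \<open>The \<open>+ 1\<close> secures positivity in case \<open>C2 * k\<psi>\<close> is
    0.\<close>
  define K where "K = C2 * k\<psi> / k\<phi> + 1"
  have K: "K > 0" using C2 k\<psi> k\<phi>0 by (simp add: K_def add_nonneg_pos)
  show ?thesis
  proof (rule that[OF K])
    fix \<alpha> i0 I
    assume \<alpha>: "\<And>i. i \<in> {1..n} \<Longrightarrow> \<alpha> i \<in> test_functions A UNIV"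
      and i0: "i0 \<in> {1..n}" and I: "I \<in> multi_indices \<nu> m"
    have \<alpha>s: "\<alpha> i \<in> smooth_functions A" if "i \<in> {1..n}" for i by (rule test_functions_smooth[OF \<alpha>[OF that]])
    define f where "f j = matrix_op \<nu> X m n a \<alpha> j" for j
    define S where "S x = (\<Sum>i=1..n. word_sum \<nu> X m (\<alpha> i) x)" for x
    define v where "v = word_op X I (\<alpha> i0)"
    have fm: "f j \<in> borel_measurable borel" if "j \<in> {1..q}" for j
      unfolding f_def by (rule matrix_op_measurable[OF \<alpha>s that])
    have Sm [measurable]: "S \<in> borel_measurable borel"
      unfolding S_def[abs_def]
      by (intro borel_measurable_continuous_onI continuous_on_sum
          word_sum_continuous_support(1)[OF fields \<alpha>])
    have vm [measurable]: "v \<in> borel_measurable borel"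
      unfolding v_def using I word_op_smooth[OF fields \<alpha>s[OF i0], of I] smooth_functions_measurable
      by (simp add: multi_indices_def)
    have S0: "S x \<ge> 0" for x by (simp add: S_def sum_nonneg)
    have wS: "word_sum \<nu> X m (\<alpha> i) x \<le> S x" if "i \<in> {1..n}" for i x
      unfolding S_def using that by (intro member_le_sum[where f = "\<lambda>i. word_sum \<nu> X m (\<alpha> i) x"]) auto
    define R where "R h z = (\<integral>\<^sup>+g. ennreal (h\<psi> g) * ennreal (\<bar>h (z \<otimes> g)\<bar> powr p) \<partial>\<mu>)" for h :: "'g \<Rightarrow> real" and z
    have Rm: "R h \<in> borel_measurable borel" if [measurable]: "h \<in> borel_measurable borel" for h
      unfolding R_def[abs_def] by measurable
    have intR: "(\<integral>\<^sup>+z. R h z \<partial>\<mu>) = \<kappa>\<psi> * Lp_pow \<mu> p h" if [measurable]: "h \<in> borel_measurable borel" for h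
      unfolding R_def \<kappa>\<psi>_def Lp_pow_def by (rule nn_integral_average) measurable
    define T where "T z = (\<Sum>j=1..q. R (f j) z) + R S z" for z
    have RT: "R (f j) z + R S z \<le> T z" if "j \<in> {1..q}" for j z
    proof -
      have "R (f j) z \<le> (\<Sum>j=1..q. R (f j) z)" using that by (intro member_le_sum) auto
      then show "R (f j) z + R S z \<le> T z" unfolding T_def by (intro add_mono) auto
    qed
    have RST: "R S z \<le> T z" for z by (simp add: T_def)
    have bound: "(\<integral>\<^sup>+g. ennreal (h\<phi> g) * ennreal (\<bar>v (z \<otimes> g)\<bar> powr p) \<partial>\<mu>) \<le> ennreal C2 * T z" for z
    proof -
      define \<beta> where "\<beta> i g = \<phi> g * \<alpha> i (z \<otimes> g)" for i g
      have \<beta>: "\<beta> i \<in> test_functions A \<Omega>" if "i \<in> {1..n}" for i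
        using test_functions_mult[OF \<phi>(1) left_transl_smooth[OF \<alpha>s[OF that], of "inv z"]]
        by (simp add: \<beta>_def[abs_def] left_transl_def)
      have \<beta>eq: "\<beta> = (\<lambda>i g. \<phi> g * \<alpha> i (z \<otimes> g))" by (intro ext) (simp add: \<beta>_def)
      define y where "y = word_op X I (\<beta> i0)"
      have ym [measurable]: "y \<in> borel_measurable borel"
        unfolding y_def using I word_op_smooth[OF fields test_functions_smooth[OF \<beta>[OF i0]], of I]
          smooth_functions_measurable by (simp add: multi_indices_def)
      define F where "F = case_sum (\<lambda>j. matrix_op \<nu> X m n a \<beta> j) \<beta>"
      have 1: "Lp_norm \<mu> p y \<le> ennreal C * (\<Sum>k\<in>?P. Lp_norm \<mu> p (F k))"
      proof -
        have "Lp_norm \<mu> p y \<le> seminorm \<mu> p \<nu> X m (\<beta> i0)"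
          unfolding seminorm_def y_def using I
          by (intro member_le_sum[where f = "\<lambda>I. Lp_norm \<mu> p (word_op X I (\<beta> i0))"]) auto
        also have "\<dots> \<le> seminorm_vec \<mu> p \<nu> X n m \<beta>"
          unfolding seminorm_vec_def using i0
          by (intro member_le_sum[where f = "\<lambda>i. seminorm \<mu> p \<nu> X m (\<beta> i)"]) auto
        also have "\<dots> \<le> (\<Sum>l=0..m. seminorm_vec \<mu> p \<nu> X n l \<beta>)"
          by (intro member_le_sum[where f = "\<lambda>l. seminorm_vec \<mu> p \<nu> X n l \<beta>"]) auto
        also have "\<dots> \<le> ennreal C * (Lp_norm_vec \<mu> p q (matrix_op \<nu> X m n a \<beta>) + Lp_norm_vec \<mu> p n \<beta>)"
          by (rule C(2)) (use \<beta> in blast)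
        also have "Lp_norm_vec \<mu> p q (matrix_op \<nu> X m n a \<beta>) + Lp_norm_vec \<mu> p n \<beta> = (\<Sum>k\<in>?P. Lp_norm \<mu> p (F k))"
          by (subst sum.Plus) (simp_all add: Lp_norm_vec_def F_def)
        finally show ?thesis .
      qed
      have "Lp_pow \<mu> p y \<le> ennreal C1 * (\<Sum>k\<in>?P. Lp_pow \<mu> p (F k))"
        unfolding C1_def by (rule Lp_pow_le_of_Lp_norm_le[OF _ p C(1) 1]) simp
      also have "(\<Sum>k\<in>?P. Lp_pow \<mu> p (F k)) =
          (\<Sum>j=1..q. Lp_pow \<mu> p (matrix_op \<nu> X m n a \<beta> j)) + (\<Sum>i=1..n. Lp_pow \<mu> p (\<beta> i))"
        by (subst sum.Plus) (simp_all add: F_def)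
      also have "\<dots> \<le> (\<Sum>j=1..q. ennreal c * T z) + (\<Sum>i=1..n. T z)"
      proof (intro add_mono sum_mono)
        fix j assume j: "j \<in> {1..q}"
        note [measurable] = fm[OF j]
        have "Lp_pow \<mu> p (matrix_op \<nu> X m n a \<beta> j) \<le>
            (\<integral>\<^sup>+g. ennreal c * (ennreal (h\<psi> g) * ennreal (\<bar>f j (z \<otimes> g)\<bar> powr p) +
              ennreal (h\<psi> g) * ennreal (\<bar>S (z \<otimes> g)\<bar> powr p)) \<partial>\<mu>)"
          unfolding Lp_pow_def
        proof (rule nn_integral_mono_AE)
          show "AE g in \<mu>. ennreal (\<bar>matrix_op \<nu> X m n a \<beta> j g\<bar> powr p) \<le>
            ennreal c * (ennreal (h\<psi> g) * ennreal (\<bar>f j (z \<otimes> g)\<bar> powr p) +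
              ennreal (h\<psi> g) * ennreal (\<bar>S (z \<otimes> g)\<bar> powr p))"
            using K1(2)[OF \<alpha>s, where z = z]
          proof (rule eventually_mono)
            fix g assume "\<forall>j\<in>{1..q}. \<bar>matrix_op \<nu> X m n a (\<lambda>i g. \<phi> g * \<alpha> i (z \<otimes> g)) j g\<bar> \<le>
              K1 * (\<psi> g * (\<bar>matrix_op \<nu> X m n a \<alpha> j (z \<otimes> g)\<bar> + (\<Sum>i=1..n. word_sum \<nu> X m (\<alpha> i) (z \<otimes> g))))"
            from bspec[OF this j] have "\<bar>matrix_op \<nu> X m n a \<beta> j g\<bar> \<le> K1 * (\<psi> g * (\<bar>f j (z \<otimes> g)\<bar> + S (z \<otimes> g)))"
              unfolding \<beta>eq f_def S_def .
            then have "\<bar>matrix_op \<nu> X m n a \<beta> j g\<bar> powr p \<le> (K1 * (\<psi> g * (\<bar>f j (z \<otimes> g)\<bar> + S (z \<otimes> g)))) powr p"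
              using p by (intro powr_mono2) auto
            also have "\<dots> = K1 powr p * h\<psi> g * (\<bar>f j (z \<otimes> g)\<bar> + S (z \<otimes> g)) powr p"
              using K1(1) \<psi>pos S0 by (simp add: powr_mult h\<psi>_def)
            also have "\<dots> \<le> K1 powr p * h\<psi> g * (2 powr p * (\<bar>f j (z \<otimes> g)\<bar> powr p + S (z \<otimes> g) powr p))"
              using S0 p hpos by (intro mult_left_mono powr_add_le) auto
            also have "\<dots> = c * (h\<psi> g * \<bar>f j (z \<otimes> g)\<bar> powr p + h\<psi> g * \<bar>S (z \<otimes> g)\<bar> powr p)"
              using K1(1) S0 by (simp add: c_def powr_mult algebra_simps)
            finally show "ennreal (\<bar>matrix_op \<nu> X m n a \<beta> j g\<bar> powr p) \<le>
              ennreal c * (ennreal (h\<psi> g) * ennreal (\<bar>f j (z \<otimes> g)\<bar> powr p) +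
                ennreal (h\<psi> g) * ennreal (\<bar>S (z \<otimes> g)\<bar> powr p))"
              using c hpos by (simp add: ennreal_leI flip: ennreal_mult ennreal_plus)
          qed
        qed
        also have "\<dots> = ennreal c * (R (f j) z + R S z)"
          unfolding R_def by (subst nn_integral_cmult, measurable) (subst nn_integral_add, measurable)
        also have "\<dots> \<le> ennreal c * T z" by (intro mult_left_mono RT[OF j]) simp
        finally show "Lp_pow \<mu> p (matrix_op \<nu> X m n a \<beta> j) \<le> ennreal c * T z" .
      next
        fix i assume i: "i \<in> {1..n}"
        have "Lp_pow \<mu> p (\<beta> i) \<le> R S z" unfolding Lp_pow_def R_def
        proof (rule nn_integral_mono)
          fix g
          \<comment> \<open>The function itself counts among the derivatives of order less than
            \<open>m\<close>, as \<open>m \<ge> 1\<close>; hence the norm of \<open>\<beta>\<close>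
            is controlled by \<open>S\<close> too.\<close>
          have "\<bar>\<alpha> i (z \<otimes> g)\<bar> \<le> S (z \<otimes> g)"
            using word_le_word_sum[of "[]" \<nu> 0 m X "\<alpha> i" "z \<otimes> g"] order wS[OF i, of "z \<otimes> g"] by simp
          then have "\<bar>\<beta> i g\<bar> \<le> \<psi> g * S (z \<otimes> g)"
            unfolding \<beta>_def abs_mult using \<phi>\<psi> \<phi>(3) \<psi>pos by (intro mult_mono) auto
          then have "\<bar>\<beta> i g\<bar> powr p \<le> (\<psi> g * S (z \<otimes> g)) powr p" using p by (intro powr_mono2) auto
          also have "\<dots> = h\<psi> g * \<bar>S (z \<otimes> g)\<bar> powr p" using \<psi>pos S0 by (simp add: powr_mult h\<psi>_def)
          finally show "ennreal (\<bar>\<beta> i g\<bar> powr p) \<le> ennreal (h\<psi> g) * ennreal (\<bar>S (z \<otimes> g)\<bar> powr p)"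
            using hpos by (simp add: ennreal_leI flip: ennreal_mult)
        qed
        then show "Lp_pow \<mu> p (\<beta> i) \<le> T z" using RST by (rule order_trans)
      qed
      also have "\<dots> = ennreal (real q * c + real n) * T z"
        using c by (simp add: ennreal_of_nat_eq_real_of_nat ennreal_mult distrib_right mult.assoc)
      finally have y: "Lp_pow \<mu> p y \<le> ennreal C1 * (ennreal (real q * c + real n) * T z)"
        by (simp add: mult_left_mono)
      have "(\<integral>\<^sup>+g. ennreal (h\<phi> g) * ennreal (\<bar>v (z \<otimes> g)\<bar> powr p) \<partial>\<mu>) \<le>
          (\<integral>\<^sup>+g. ennreal (2 powr p) * (ennreal (\<bar>y g\<bar> powr p) +
            ennreal ((3 ^ m) powr p) * (ennreal (h\<psi> g) * ennreal (\<bar>S (z \<otimes> g)\<bar> powr p))) \<partial>\<mu>)"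
      proof (rule nn_integral_mono)
        fix g
        \<comment> \<open>Back from the derivative \<open>y\<close> of \<open>\<beta>\<close> to
          \<open>\<phi>\<close> times the derivative of \<open>\<alpha>\<close>, at the price of
          another commutator.\<close>
        have "\<bar>y g - \<phi> g * v (z \<otimes> g)\<bar> \<le> 3 ^ m * \<psi> g * word_sum \<nu> X m (\<alpha> i0) (z \<otimes> g)"
          unfolding y_def v_def \<psi>_def \<beta>_def by (rule word_op_localized[OF \<phi>s \<alpha>s[OF i0] I order_refl])
        also have "\<dots> \<le> 3 ^ m * \<psi> g * S (z \<otimes> g)" using \<psi>pos wS[OF i0] by (intro mult_left_mono) auto
        finally have "\<bar>\<phi> g * v (z \<otimes> g)\<bar> \<le> \<bar>y g\<bar> + 3 ^ m * \<psi> g * S (z \<otimes> g)" by linarith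
        then have "\<bar>\<phi> g * v (z \<otimes> g)\<bar> powr p \<le> (\<bar>y g\<bar> + 3 ^ m * \<psi> g * S (z \<otimes> g)) powr p"
          using p by (intro powr_mono2) auto
        also have "\<dots> \<le> 2 powr p * (\<bar>y g\<bar> powr p + (3 ^ m * \<psi> g * S (z \<otimes> g)) powr p)"
          using p \<psi>pos S0 by (intro powr_add_le) auto
        also have "(3 ^ m * \<psi> g * S (z \<otimes> g)) powr p = (3 ^ m) powr p * (h\<psi> g * \<bar>S (z \<otimes> g)\<bar> powr p)"
          using \<psi>pos S0 by (simp add: powr_mult h\<psi>_def)
        also have "\<bar>\<phi> g * v (z \<otimes> g)\<bar> powr p = h\<phi> g * \<bar>v (z \<otimes> g)\<bar> powr p"
          using \<phi>(3) by (simp add: abs_mult powr_mult h\<phi>_def)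
        finally have "ennreal (h\<phi> g * \<bar>v (z \<otimes> g)\<bar> powr p) \<le>
            ennreal (2 powr p * (\<bar>y g\<bar> powr p + (3 ^ m) powr p * (h\<psi> g * \<bar>S (z \<otimes> g)\<bar> powr p)))"
          by (rule ennreal_leI)
        then show "ennreal (h\<phi> g) * ennreal (\<bar>v (z \<otimes> g)\<bar> powr p) \<le> ennreal (2 powr p) * (ennreal (\<bar>y g\<bar> powr p) +
            ennreal ((3 ^ m) powr p) * (ennreal (h\<psi> g) * ennreal (\<bar>S (z \<otimes> g)\<bar> powr p)))"
          using hpos by (simp add: ennreal_mult ennreal_plus)
      qed
      also have "\<dots> = ennreal (2 powr p) * (Lp_pow \<mu> p y + ennreal ((3 ^ m) powr p) * R S z)"
        unfolding R_def Lp_pow_def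
        by (subst nn_integral_cmult, measurable) (subst nn_integral_add, measurable, subst nn_integral_cmult, measurable)
      also have "\<dots> \<le> ennreal (2 powr p) * (ennreal C1 * (ennreal (real q * c + real n) * T z) + ennreal ((3 ^ m) powr p) * T z)"
        by (intro mult_left_mono add_mono y RST) auto
      also have "\<dots> = ennreal C2 * T z"
        unfolding C2_def using C1 c by (simp add: ennreal_mult ennreal_plus distrib_right distrib_left mult.assoc)
      finally show ?thesis .
    qed
    have "\<kappa>\<phi> * Lp_pow \<mu> p v = (\<integral>\<^sup>+z. (\<integral>\<^sup>+g. ennreal (h\<phi> g) * ennreal (\<bar>v (z \<otimes> g)\<bar> powr p) \<partial>\<mu>) \<partial>\<mu>)"
      unfolding \<kappa>\<phi>_def Lp_pow_def by (rule nn_integral_average[symmetric]) measurable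
    also have "\<dots> \<le> (\<integral>\<^sup>+z. ennreal C2 * T z \<partial>\<mu>)" by (rule nn_integral_mono) (rule bound)
    also have "\<dots> = ennreal C2 * (\<integral>\<^sup>+z. T z \<partial>\<mu>)"
      unfolding T_def using Rm fm Sm
      by (intro nn_integral_cmult) (simp add: measurable_haar)
    also have "(\<integral>\<^sup>+z. T z \<partial>\<mu>) = (\<Sum>j=1..q. \<integral>\<^sup>+z. R (f j) z \<partial>\<mu>) + (\<integral>\<^sup>+z. R S z \<partial>\<mu>)"
    proof -
      have meas: "R (f j) \<in> borel_measurable \<mu>" if "j \<in> {1..q}" for j
        using Rm[OF fm[OF that]] unfolding measurable_haar .
      then have "(\<integral>\<^sup>+z. (\<Sum>j=1..q. R (f j) z) \<partial>\<mu>) = (\<Sum>j=1..q. \<integral>\<^sup>+z. R (f j) z \<partial>\<mu>)"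
        by (rule nn_integral_sum)
      moreover have "(\<lambda>z. \<Sum>j=1..q. R (f j) z) \<in> borel_measurable \<mu>" using meas by (rule borel_measurable_sum)
      moreover have "R S \<in> borel_measurable \<mu>" using Rm[OF Sm] unfolding measurable_haar .
      ultimately show ?thesis unfolding T_def by (subst nn_integral_add) simp_all
    qed
    also have "\<dots> = \<kappa>\<psi> * ((\<Sum>j=1..q. Lp_pow \<mu> p (f j)) + Lp_pow \<mu> p S)"
      using intR fm Sm by (simp add: sum_distrib_left distrib_left)
    finally have "ennreal k\<phi> * Lp_pow \<mu> p v \<le> ennreal (C2 * k\<psi>) * ((\<Sum>j=1..q. Lp_pow \<mu> p (f j)) + Lp_pow \<mu> p S)"
      using C2 k\<psi> by (simp add: k\<phi>(1) ennreal_mult mult.assoc)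
    then have "ennreal (1 / k\<phi>) * (ennreal k\<phi> * Lp_pow \<mu> p v) \<le>
        ennreal (1 / k\<phi>) * (ennreal (C2 * k\<psi>) * ((\<Sum>j=1..q. Lp_pow \<mu> p (f j)) + Lp_pow \<mu> p S))"
      by (intro mult_left_mono) auto
    moreover have "ennreal (1 / k\<phi>) * (ennreal k\<phi> * Lp_pow \<mu> p v) = Lp_pow \<mu> p v"
      using k\<phi>0 by (subst mult.assoc[symmetric], subst ennreal_mult[symmetric]) auto
    moreover have "ennreal (1 / k\<phi>) * (ennreal (C2 * k\<psi>) * Y) \<le> ennreal K * Y" for Y
      unfolding K_def using k\<phi>0 C2 k\<psi>
      by (subst mult.assoc[symmetric], subst ennreal_mult[symmetric])
        (auto intro!: mult_right_mono ennreal_leI)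
    ultimately show "Lp_pow \<mu> p (word_op X I (\<alpha> i0)) \<le>
      ennreal K * ((\<Sum>j=1..q. Lp_pow \<mu> p (matrix_op \<nu> X m n a \<alpha> j)) +
        Lp_pow \<mu> p (\<lambda>x. \<Sum>i=1..n. word_sum \<nu> X m (\<alpha> i) x))"
      unfolding v_def[symmetric] f_def[symmetric] S_def[symmetric] by (metis order_trans)
  qed
qed

end

section \<open>Absorption of the lower order terms\<close>

text \<open>By induction, \<open>N u l\<close> is at most a small multiple of
  \<open>N u (Suc l)\<close> plus a multiple of \<open>N u 0\<close>. Inserted into the three-term
  inequality this puts half of \<open>N u (Suc l)\<close> on the right, where it is
  absorbed.\<close>

lemma interpolation_chain_step:
  fixes N :: "'u \<Rightarrow> nat \<Rightarrow> real"
  assumes nonneg: "\<And>u l. u \<in> F \<Longrightarrow> N u l \<ge> 0"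
    and step: "\<And>\<epsilon>. \<epsilon> > 0 \<Longrightarrow> \<exists>C\<ge>0. \<forall>u\<in>F. \<forall>l. N u (Suc l) \<le> \<epsilon> * N u (Suc (Suc l)) + C * N u l"
  shows "\<epsilon> > 0 \<Longrightarrow> \<exists>C\<ge>0. \<forall>u\<in>F. N u l \<le> \<epsilon> * N u (Suc l) + C * N u 0"
proof (induction l arbitrary: \<epsilon>)
  case 0
  then show ?case using nonneg by (intro exI[of _ 1]) auto
next
  case (Suc l)
  obtain C where C: "C \<ge> 0" "\<forall>u\<in>F. \<forall>l. N u (Suc l) \<le> \<epsilon> / 2 * N u (Suc (Suc l)) + C * N u l"
    using step[of "\<epsilon> / 2"] Suc.prems by auto
  \<comment> \<open>Small enough that multiplication by \<open>C\<close> leaves a coefficient of at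
    most 1/2.\<close>
  have e': "1 / (2 * (C + 1)) > 0" using C by simp
  obtain C' where C': "C' \<ge> 0" "\<forall>u\<in>F. N u l \<le> 1 / (2 * (C + 1)) * N u (Suc l) + C' * N u 0"
    using Suc.IH[OF e'] by blast
  have "N u (Suc l) \<le> \<epsilon> * N u (Suc (Suc l)) + 2 * C * C' * N u 0" if u: "u \<in> F" for u
  proof -
    have "C * N u l \<le> C * (1 / (2 * (C + 1)) * N u (Suc l) + C' * N u 0)"
      using C C' u by (intro mult_left_mono) auto
    also have "\<dots> = C / (2 * (C + 1)) * N u (Suc l) + C * C' * N u 0" by (simp add: algebra_simps)
    also have "C / (2 * (C + 1)) \<le> 1 / 2" using C by (simp add: field_simps)
    finally have "C * N u l \<le> 1 / 2 * N u (Suc l) + C * C' * N u 0"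
      using nonneg[OF u, of "Suc l"] by (simp add: mult_right_mono)
    moreover have "N u (Suc l) \<le> \<epsilon> / 2 * N u (Suc (Suc l)) + C * N u l" using C u by blast
    ultimately show ?thesis by simp
  qed
  then show ?case using C C' by (intro exI[of _ "2 * C * C'"]) auto
qed

text \<open>The sum over \<open>k < l\<close> is at most \<open>N u l\<close> plus a multiple of
  \<open>N u 0\<close>; so the longer sum contains \<open>N u l\<close> at most twice, and the
  preceding lemma with \<open>\<epsilon> / 2\<close> disposes of it.\<close>

lemma interpolation_chain:
  fixes N :: "'u \<Rightarrow> nat \<Rightarrow> real"
  assumes nonneg: "\<And>u l. u \<in> F \<Longrightarrow> N u l \<ge> 0"
    and step: "\<And>\<epsilon>. \<epsilon> > 0 \<Longrightarrow> \<exists>C\<ge>0. \<forall>u\<in>F. \<forall>l. N u (Suc l) \<le> \<epsilon> * N u (Suc (Suc l)) + C * N u l"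
  shows "\<epsilon> > 0 \<Longrightarrow> \<exists>C\<ge>0. \<forall>u\<in>F. (\<Sum>k<l. N u k) \<le> \<epsilon> * N u l + C * N u 0"
proof (induction l arbitrary: \<epsilon>)
  case 0
  then show ?case using nonneg by (intro exI[of _ 0]) auto
next
  case (Suc l)
  obtain C where C: "C \<ge> 0" "\<forall>u\<in>F. (\<Sum>k<l. N u k) \<le> 1 * N u l + C * N u 0"
    using Suc.IH[of 1] by auto
  have "\<epsilon> / 2 > 0" using Suc.prems by simp
  from interpolation_chain_step[of F N, OF nonneg step this]
  obtain C' where C': "C' \<ge> 0" "\<forall>u\<in>F. N u l \<le> \<epsilon> / 2 * N u (Suc l) + C' * N u 0" by blast
  have "(\<Sum>k<Suc l. N u k) \<le> \<epsilon> * N u (Suc l) + (2 * C' + C) * N u 0" if u: "u \<in> F" for u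
    using bspec[OF C(2) u] bspec[OF C'(2) u] by (simp add: algebra_simps)
  then show ?case using C C' by (intro exI[of _ "2 * C' + C"]) auto
qed

text \<open>The one-field inequality is applied to the outermost letter of the word
  \<open>i # I\<close>, with \<open>word_op X I u\<close> as the function. The words
  \<open>i # i # I\<close> that appear are pairwise distinct, so their sum is part of the sum over
  all words of that length.\<close>

lemma (in haar_lie_grp) word_interpolation:
  assumes X: "\<forall>i\<in>{1..\<nu>}. X i \<in> lie_algebra G A" and p: "1 \<le> p" and \<epsilon>: "\<epsilon> > 0"
  shows "\<exists>C\<ge>0. \<forall>u\<in>test_functions A UNIV. \<forall>l. (\<Sum>I\<in>multi_indices \<nu> (Suc l). \<integral>x. \<bar>word_op X I u x\<bar> powr p \<partial>\<mu>) \<le>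
    \<epsilon> * (\<Sum>I\<in>multi_indices \<nu> (Suc (Suc l)). \<integral>x. \<bar>word_op X I u x\<bar> powr p \<partial>\<mu>) +
    C * (\<Sum>I\<in>multi_indices \<nu> l. \<integral>x. \<bar>word_op X I u x\<bar> powr p \<partial>\<mu>)"
proof -
  have "\<forall>i\<in>{1..\<nu>}. \<exists>C\<ge>0. \<forall>u\<in>test_functions A UNIV.
    (\<integral>x. \<bar>X i u x\<bar> powr p \<partial>\<mu>) \<le> \<epsilon> * (\<integral>x. \<bar>X i (X i u) x\<bar> powr p \<partial>\<mu>) + C * (\<integral>x. \<bar>u x\<bar> powr p \<partial>\<mu>)"
  proof
    fix i assume "i \<in> {1..\<nu>}"
    then have Xi: "X i \<in> lie_algebra G A" using X by blast
    show "\<exists>C\<ge>0. \<forall>u\<in>test_functions A UNIV.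
      (\<integral>x. \<bar>X i u x\<bar> powr p \<partial>\<mu>) \<le> \<epsilon> * (\<integral>x. \<bar>X i (X i u) x\<bar> powr p \<partial>\<mu>) + C * (\<integral>x. \<bar>u x\<bar> powr p \<partial>\<mu>)"
    proof (rule lie_algebra_interpolation[OF Xi p \<epsilon>], goal_cases)
      case (1 C)
      then show ?case by (intro exI[of _ C] conjI ballI)
    qed
  qed
  from bchoice[OF this] obtain C where C: "\<forall>i\<in>{1..\<nu>}. C i \<ge> 0 \<and> (\<forall>u\<in>test_functions A UNIV.
    (\<integral>x. \<bar>X i u x\<bar> powr p \<partial>\<mu>) \<le> \<epsilon> * (\<integral>x. \<bar>X i (X i u) x\<bar> powr p \<partial>\<mu>) + C i * (\<integral>x. \<bar>u x\<bar> powr p \<partial>\<mu>))" ..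
  have "(\<Sum>I\<in>multi_indices \<nu> (Suc l). \<integral>x. \<bar>word_op X I u x\<bar> powr p \<partial>\<mu>) \<le>
    \<epsilon> * (\<Sum>I\<in>multi_indices \<nu> (Suc (Suc l)). \<integral>x. \<bar>word_op X I u x\<bar> powr p \<partial>\<mu>) +
    (\<Sum>i=1..\<nu>. C i) * (\<Sum>I\<in>multi_indices \<nu> l. \<integral>x. \<bar>word_op X I u x\<bar> powr p \<partial>\<mu>)"
    if u: "u \<in> test_functions A UNIV" for u l
  proof -
    define J where "J I = (\<integral>x. \<bar>word_op X I u x\<bar> powr p \<partial>\<mu>)" for I
    have J0: "J I \<ge> 0" for I by (simp add: J_def)
    let ?P = "{1..\<nu>} \<times> multi_indices \<nu> l"
    have "(\<Sum>I\<in>multi_indices \<nu> (Suc l). J I) = (\<Sum>(i, I)\<in>?P. J (i # I))"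
      unfolding multi_indices_Suc by (subst sum.reindex) (auto simp: inj_on_def case_prod_beta)
    also have "\<dots> \<le> (\<Sum>(i, I)\<in>?P. \<epsilon> * J (i # i # I) + C i * J I)"
    proof (rule sum_mono, clarify)
      fix i I assume i: "i \<in> {1..\<nu>}" and I: "I \<in> multi_indices \<nu> l"
      have "word_op X I u \<in> test_functions A UNIV"
        using word_op_test[OF X u] I by (simp add: multi_indices_def)
      then show "J (i # I) \<le> \<epsilon> * J (i # i # I) + C i * J I"
        using bspec[OF C i] by (simp add: J_def)
    qed
    also have "\<dots> = \<epsilon> * (\<Sum>(i, I)\<in>?P. J (i # i # I)) + (\<Sum>(i, I)\<in>?P. C i * J I)"
      by (simp add: case_prod_beta sum.distrib sum_distrib_left)
    also have "(\<Sum>(i, I)\<in>?P. C i * J I) = (\<Sum>i=1..\<nu>. C i) * (\<Sum>I\<in>multi_indices \<nu> l. J I)"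
      by (simp add: sum_product sum.cartesian_product)
    also have "(\<Sum>(i, I)\<in>?P. J (i # i # I)) = (\<Sum>I\<in>(\<lambda>(i, I). i # i # I) ` ?P. J I)"
      by (subst sum.reindex) (auto simp: inj_on_def case_prod_beta)
    also have "\<dots> \<le> (\<Sum>I\<in>multi_indices \<nu> (Suc (Suc l)). J I)"
      using J0 by (intro sum_mono2 finite_multi_indices) (auto simp: multi_indices_def)
    finally show ?thesis using \<epsilon> by (simp add: J_def mult_left_mono)
  qed
  moreover have "(\<Sum>i=1..\<nu>. C i) \<ge> 0" using C by (intro sum_nonneg) auto
  ultimately show ?thesis by blast
qed

context matrix_diff_op
begin

lemma word_sum_Lp_pow:
  assumes p: "1 \<le> p" and \<alpha>: "\<And>i. i \<in> {1..n} \<Longrightarrow> \<alpha> i \<in> test_functions A UNIV"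
  shows "Lp_pow \<mu> p (\<lambda>x. \<Sum>i=1..n. word_sum \<nu> X m (\<alpha> i) x) \<le>
    ennreal (real (card ({1..n} \<times> (SIGMA k:{..<m}. multi_indices \<nu> k))) powr p) *
      (\<Sum>k<m. \<Sum>i=1..n. \<Sum>I\<in>multi_indices \<nu> k. Lp_pow \<mu> p (word_op X I (\<alpha> i)))"
proof -
  let ?T = "{1..n} \<times> (SIGMA k:{..<m}. multi_indices \<nu> k)"
  define w where "w t x = word_op X (snd (snd t)) (\<alpha> (fst t)) x" for t :: "nat \<times> nat \<times> nat list" and x
  have T: "finite ?T" by auto
  have eq: "(\<Sum>i=1..n. word_sum \<nu> X m (\<alpha> i) x) = (\<Sum>t\<in>?T. \<bar>w t x\<bar>)" for x
    unfolding word_sum_def w_def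
    by (subst sum.Sigma) (simp_all add: sum.cartesian_product case_prod_beta)
  have wm: "w t \<in> borel_measurable \<mu>" if t: "t \<in> ?T" for t
  proof -
    obtain i k I where t': "t = (i, k, I)" "i \<in> {1..n}" "I \<in> multi_indices \<nu> k" using t by auto
    have "word_op X I (\<alpha> i) \<in> smooth_functions A"
      using word_op_smooth[OF fields test_functions_smooth[OF \<alpha>[OF t'(2)]]] t'(3)
      by (simp add: multi_indices_def)
    then show ?thesis
      using smooth_functions_measurable t'(1) unfolding measurable_haar w_def[abs_def] by simp
  qed
  have "Lp_pow \<mu> p (\<lambda>x. \<Sum>i=1..n. word_sum \<nu> X m (\<alpha> i) x) \<le>
      (\<integral>\<^sup>+x. ennreal (real (card ?T) powr p) * (\<Sum>t\<in>?T. ennreal (\<bar>w t x\<bar> powr p)) \<partial>\<mu>)"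
    unfolding Lp_pow_def eq
  proof (rule nn_integral_mono)
    fix x
    have "\<bar>\<Sum>t\<in>?T. \<bar>w t x\<bar>\<bar> powr p = (\<Sum>t\<in>?T. \<bar>w t x\<bar>) powr p" by (simp add: sum_nonneg)
    also have "\<dots> \<le> real (card ?T) powr p * (\<Sum>t\<in>?T. \<bar>w t x\<bar> powr p)"
      using p by (intro sum_powr_le_card T) auto
    finally have "ennreal (\<bar>\<Sum>t\<in>?T. \<bar>w t x\<bar>\<bar> powr p) \<le> ennreal (real (card ?T) powr p * (\<Sum>t\<in>?T. \<bar>w t x\<bar> powr p))"
      by (rule ennreal_leI)
    then show "ennreal (\<bar>\<Sum>t\<in>?T. \<bar>w t x\<bar>\<bar> powr p) \<le>
        ennreal (real (card ?T) powr p) * (\<Sum>t\<in>?T. ennreal (\<bar>w t x\<bar> powr p))"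
      by (simp only: ennreal_mult[OF powr_ge_zero sum_nonneg[OF powr_ge_zero]] sum_ennreal[OF powr_ge_zero])
  qed
  also have "\<dots> = ennreal (real (card ?T) powr p) * (\<Sum>t\<in>?T. Lp_pow \<mu> p (w t))"
    unfolding Lp_pow_def
  proof (subst nn_integral_cmult)
    have pm: "(\<lambda>x. ennreal (\<bar>w t x\<bar> powr p)) \<in> borel_measurable \<mu>" if "t \<in> ?T" for t
      using wm[OF that] by measurable
    then show "(\<lambda>x. \<Sum>t\<in>?T. ennreal (\<bar>w t x\<bar> powr p)) \<in> borel_measurable \<mu>" by (rule borel_measurable_sum)
    have "(\<integral>\<^sup>+x. (\<Sum>t\<in>?T. ennreal (\<bar>w t x\<bar> powr p)) \<partial>\<mu>) = (\<Sum>t\<in>?T. \<integral>\<^sup>+x. ennreal (\<bar>w t x\<bar> powr p) \<partial>\<mu>)"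
      by (rule nn_integral_sum) (rule pm)
    then show "ennreal (real (card ?T) powr p) * (\<integral>\<^sup>+x. (\<Sum>t\<in>?T. ennreal (\<bar>w t x\<bar> powr p)) \<partial>\<mu>) =
      ennreal (real (card ?T) powr p) * (\<Sum>t\<in>?T. \<integral>\<^sup>+x. ennreal (\<bar>w t x\<bar> powr p) \<partial>\<mu>)"
      by (simp only:)
  qed
  also have "(\<Sum>t\<in>?T. Lp_pow \<mu> p (w t)) =
      (\<Sum>k<m. \<Sum>i=1..n. \<Sum>I\<in>multi_indices \<nu> k. Lp_pow \<mu> p (word_op X I (\<alpha> i)))"
  proof -
    have "(\<Sum>t\<in>?T. Lp_pow \<mu> p (w t)) =
        (\<Sum>i=1..n. \<Sum>k<m. \<Sum>I\<in>multi_indices \<nu> k. Lp_pow \<mu> p (word_op X I (\<alpha> i)))"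
      unfolding w_def[abs_def]
      by (subst sum.Sigma) (simp_all add: sum.cartesian_product case_prod_beta)
    then show ?thesis by (simp only: sum.swap[of _ "{1..n}"])
  qed
  finally show ?thesis .
qed

lemma maximal_hypoelliptic_UNIV:
  assumes p: "1 \<le> p" and \<Omega>: "open \<Omega>" "\<Omega> \<noteq> {}" and hyp: "maximal_hypoelliptic A \<mu> p \<nu> X m n q a \<Omega>"
  shows "maximal_hypoelliptic A \<mu> p \<nu> X m n q a UNIV"
proof -
  define F where "F = {\<alpha>. \<forall>i\<in>{1..n}. \<alpha> i \<in> test_functions A UNIV}"
  define N where "N \<alpha> k = (\<Sum>i=1..n. \<Sum>I\<in>multi_indices \<nu> k. \<integral>x. \<bar>word_op X I (\<alpha> i) x\<bar> powr p \<partial>\<mu>)"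
    for \<alpha> :: "nat \<Rightarrow> 'g \<Rightarrow> real" and k
  have N0: "N \<alpha> k \<ge> 0" for \<alpha> k unfolding N_def by (intro sum_nonneg) simp
  have Lp_eq: "Lp_pow \<mu> p (word_op X I (\<alpha> i)) = ennreal (\<integral>x. \<bar>word_op X I (\<alpha> i) x\<bar> powr p \<partial>\<mu>)"
    if "\<alpha> \<in> F" "i \<in> {1..n}" "I \<in> multi_indices \<nu> k" for \<alpha> i I k
  proof -
    have "word_op X I (\<alpha> i) \<in> test_functions A UNIV"
      using that word_op_test[OF fields, of "\<alpha> i"] by (simp add: F_def multi_indices_def)
    from test_functions_integrable_powr[OF this p] show ?thesis
      unfolding Lp_pow_def by (intro nn_integral_eq_integral) auto
  qed
  have N_Lp: "(\<Sum>i=1..n. \<Sum>I\<in>multi_indices \<nu> k. Lp_pow \<mu> p (word_op X I (\<alpha> i))) = ennreal (N \<alpha> k)"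
    if "\<alpha> \<in> F" for \<alpha> k
  proof -
    have "(\<Sum>i=1..n. \<Sum>I\<in>multi_indices \<nu> k. Lp_pow \<mu> p (word_op X I (\<alpha> i))) =
        (\<Sum>i=1..n. \<Sum>I\<in>multi_indices \<nu> k. ennreal (\<integral>x. \<bar>word_op X I (\<alpha> i) x\<bar> powr p \<partial>\<mu>))"
      by (intro sum.cong refl Lp_eq that)
    also have "\<dots> = ennreal (N \<alpha> k)" unfolding N_def by (simp add: sum_ennreal sum_nonneg)
    finally show ?thesis .
  qed
  have step: "\<exists>C\<ge>0. \<forall>\<alpha>\<in>F. \<forall>l. N \<alpha> (Suc l) \<le> \<epsilon> * N \<alpha> (Suc (Suc l)) + C * N \<alpha> l" if \<epsilon>: "\<epsilon> > 0" for \<epsilon>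
  proof -
    obtain C where C: "C \<ge> 0" "\<forall>u\<in>test_functions A UNIV. \<forall>l.
      (\<Sum>I\<in>multi_indices \<nu> (Suc l). \<integral>x. \<bar>word_op X I u x\<bar> powr p \<partial>\<mu>) \<le>
      \<epsilon> * (\<Sum>I\<in>multi_indices \<nu> (Suc (Suc l)). \<integral>x. \<bar>word_op X I u x\<bar> powr p \<partial>\<mu>) +
      C * (\<Sum>I\<in>multi_indices \<nu> l. \<integral>x. \<bar>word_op X I u x\<bar> powr p \<partial>\<mu>)"
      using word_interpolation[OF fields p \<epsilon>] by blast
    have "N \<alpha> (Suc l) \<le> \<epsilon> * N \<alpha> (Suc (Suc l)) + C * N \<alpha> l" if \<alpha>: "\<alpha> \<in> F" for \<alpha> l
      unfolding N_def sum_distrib_left[of _ _ "{1..n}"] sum.distrib[symmetric]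
      by (rule sum_mono) (use C(2) \<alpha> in \<open>simp add: F_def\<close>)
    then show ?thesis using C(1) by blast
  qed
  obtain K where K: "K > 0" "\<And>\<alpha> i I. (\<And>i. i \<in> {1..n} \<Longrightarrow> \<alpha> i \<in> test_functions A UNIV) \<Longrightarrow> i \<in> {1..n} \<Longrightarrow>
    I \<in> multi_indices \<nu> m \<Longrightarrow> Lp_pow \<mu> p (word_op X I (\<alpha> i)) \<le>
      ennreal K * ((\<Sum>j=1..q. Lp_pow \<mu> p (matrix_op \<nu> X m n a \<alpha> j)) +
        Lp_pow \<mu> p (\<lambda>x. \<Sum>i=1..n. word_sum \<nu> X m (\<alpha> i) x))"
    using top_order_estimate[OF p \<Omega> hyp] by blast
  define c where "c = real (card ({1..n} \<times> (SIGMA k:{..<m}. multi_indices \<nu> k))) powr p"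
  have c0: "c \<ge> 0" by (simp add: c_def)
  \<comment> \<open>The number of top order terms, each of which obeys the estimate with constant
    \<open>K\<close>.\<close>
  define W where "W = real n * real (card (multi_indices \<nu> m))"
  have W0: "W \<ge> 0" by (simp add: W_def)
  \<comment> \<open>Chosen so that the top order part hidden in the lower order terms returns with
    coefficient \<open>W * K * c * \<epsilon> \<le> 1 / 2\<close>.\<close>
  define \<epsilon> where "\<epsilon> = 1 / (2 * (W * K * c + 1))"
  have WKc: "W * K * c \<ge> 0" using W0 K c0 by simp
  have \<epsilon>: "\<epsilon> > 0" "\<epsilon> \<le> 1" "W * K * c * \<epsilon> \<le> 1 / 2" using WKc by (simp_all add: \<epsilon>_def field_simps)
  obtain C where C: "C \<ge> 0" "\<forall>\<alpha>\<in>F. (\<Sum>k<m. N \<alpha> k) \<le> \<epsilon> * N \<alpha> m + C * N \<alpha> 0"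
    using interpolation_chain[of F N, OF N0 step \<epsilon>(1), of m] by blast
  \<comment> \<open>From \<open>s \<le> N \<alpha> m + C * N \<alpha> 0\<close>, everything up to
    order \<open>m\<close> is at most \<open>2 * N \<alpha> m + C * N \<alpha> 0\<close>; absorption
    contributes a further factor 2 to the bound for \<open>N \<alpha> m\<close>. The 1 secures
    positivity.\<close>
  define D where "D = 1 + 4 * (W * K) + 4 * (W * K * c) * C + C"
  have D: "D > 0" using W0 K(1) WKc C(1) unfolding D_def by (intro add_pos_nonneg) auto
  let ?P = "{1..q} <+> {1..n}"
  have main: "Lp_pow \<mu> p (word_op X I (\<alpha> i)) \<le>
      ennreal D * (\<Sum>k\<in>?P. Lp_pow \<mu> p (case_sum (\<lambda>j. matrix_op \<nu> X m n a \<alpha> j) \<alpha> k))"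
    if \<alpha>: "\<alpha> \<in> F" and i: "i \<in> {1..n}" and k: "k \<le> m" and I: "I \<in> multi_indices \<nu> k" for \<alpha> i I k
  proof -
    define Y where "Y = (\<Sum>j=1..q. Lp_pow \<mu> p (matrix_op \<nu> X m n a \<alpha> j))"
    have "(\<Sum>i=1..n. Lp_pow \<mu> p (\<alpha> i)) = ennreal (N \<alpha> 0)" using N_Lp[OF \<alpha>, of 0] by simp
    then have rhs: "(\<Sum>k\<in>?P. Lp_pow \<mu> p (case_sum (\<lambda>j. matrix_op \<nu> X m n a \<alpha> j) \<alpha> k)) = Y + ennreal (N \<alpha> 0)"
      by (subst sum.Plus) (simp_all add: Y_def)
    show ?thesis unfolding rhs
    proof (cases Y)
      case top
      then show "Lp_pow \<mu> p (word_op X I (\<alpha> i)) \<le> ennreal D * (Y + ennreal (N \<alpha> 0))"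
        using D by (simp add: ennreal_mult_top)
    next
      case (real y)
      define s where "s = (\<Sum>k<m. N \<alpha> k)"
      have s0: "s \<ge> 0" using N0 by (simp add: s_def sum_nonneg)
      have lower: "Lp_pow \<mu> p (\<lambda>x. \<Sum>i=1..n. word_sum \<nu> X m (\<alpha> i) x) \<le> ennreal (c * s)"
      proof -
        have "(\<Sum>k<m. \<Sum>i=1..n. \<Sum>I\<in>multi_indices \<nu> k. Lp_pow \<mu> p (word_op X I (\<alpha> i))) = (\<Sum>k<m. ennreal (N \<alpha> k))"
          by (intro sum.cong refl N_Lp \<alpha>)
        also have "\<dots> = ennreal s" using N0 by (simp add: s_def sum_ennreal)
        finally show ?thesis
          using word_sum_Lp_pow[OF p, of \<alpha>] \<alpha> c0 s0 by (simp add: F_def c_def ennreal_mult)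
      qed
      have top: "(\<integral>x. \<bar>word_op X I (\<alpha> i) x\<bar> powr p \<partial>\<mu>) \<le> K * (y + c * s)"
        if i: "i \<in> {1..n}" and I: "I \<in> multi_indices \<nu> m" for i I
      proof -
        have "ennreal (\<integral>x. \<bar>word_op X I (\<alpha> i) x\<bar> powr p \<partial>\<mu>) = Lp_pow \<mu> p (word_op X I (\<alpha> i))"
          by (rule Lp_eq[OF \<alpha> i I, symmetric])
        also have "\<dots> \<le> ennreal K * (Y + Lp_pow \<mu> p (\<lambda>x. \<Sum>i=1..n. word_sum \<nu> X m (\<alpha> i) x))"
          unfolding Y_def by (rule K(2)[OF _ i I]) (use \<alpha> in \<open>simp add: F_def\<close>)
        also have "\<dots> \<le> ennreal K * (ennreal y + ennreal (c * s))"
          unfolding real(2)[symmetric] by (intro mult_left_mono add_left_mono lower) simp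
        also have "\<dots> = ennreal (K * (y + c * s))"
          using K(1) real(1) c0 s0 by (simp add: ennreal_mult ennreal_plus)
        finally show ?thesis using K(1) real(1) c0 s0 by (simp add: ennreal_le_iff)
      qed
      have "N \<alpha> m \<le> (\<Sum>i=1..n. \<Sum>I\<in>multi_indices \<nu> m. K * (y + c * s))"
        unfolding N_def by (intro sum_mono top)
      also have "\<dots> = W * K * y + W * K * c * s" by (simp add: W_def algebra_simps)
      finally have Nm: "N \<alpha> m \<le> W * K * y + W * K * c * s" .
      have s: "s \<le> \<epsilon> * N \<alpha> m + C * N \<alpha> 0" using C(2) \<alpha> by (simp add: s_def)
      have "W * K * c * s \<le> W * K * c * (\<epsilon> * N \<alpha> m + C * N \<alpha> 0)" using s WKc by (intro mult_left_mono)
      also have "\<dots> = (W * K * c * \<epsilon>) * N \<alpha> m + W * K * c * C * N \<alpha> 0" by (simp add: algebra_simps)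
      also have "(W * K * c * \<epsilon>) * N \<alpha> m \<le> 1 / 2 * N \<alpha> m" using \<epsilon>(3) N0 by (rule mult_right_mono)
      finally have Nm2: "N \<alpha> m \<le> 2 * (W * K * y) + 2 * (W * K * c * C * N \<alpha> 0)" using Nm by linarith
      have "\<epsilon> * N \<alpha> m \<le> 1 * N \<alpha> m" using \<epsilon>(2) N0 by (rule mult_right_mono)
      then have s2: "s \<le> N \<alpha> m + C * N \<alpha> 0" using s by simp
      have "(\<integral>x. \<bar>word_op X I (\<alpha> i) x\<bar> powr p \<partial>\<mu>) \<le> N \<alpha> k"
      proof -
        have "(\<integral>x. \<bar>word_op X I (\<alpha> i) x\<bar> powr p \<partial>\<mu>) \<le>
            (\<Sum>I\<in>multi_indices \<nu> k. \<integral>x. \<bar>word_op X I (\<alpha> i) x\<bar> powr p \<partial>\<mu>)"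
          using I by (intro member_le_sum[where f = "\<lambda>I. \<integral>x. \<bar>word_op X I (\<alpha> i) x\<bar> powr p \<partial>\<mu>"]) auto
        also have "\<dots> \<le> N \<alpha> k" unfolding N_def using i
          by (intro member_le_sum[where f = "\<lambda>i. \<Sum>I\<in>multi_indices \<nu> k. \<integral>x. \<bar>word_op X I (\<alpha> i) x\<bar> powr p \<partial>\<mu>"] sum_nonneg) auto
        finally show ?thesis .
      qed
      also have "N \<alpha> k \<le> s + N \<alpha> m"
      proof -
        have "N \<alpha> k \<le> (\<Sum>k<Suc m. N \<alpha> k)"
          using k N0 by (intro member_le_sum[where f = "N \<alpha>"]) auto
        then show ?thesis by (simp add: s_def)
      qed
      also have "\<dots> \<le> 4 * (W * K) * y + (4 * (W * K * c) * C + C) * N \<alpha> 0"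
        using s2 Nm2 by (simp add: algebra_simps)
      also have "\<dots> \<le> D * y + D * N \<alpha> 0"
        unfolding D_def using real(1) N0 W0 K(1) WKc C(1)
        by (intro add_mono mult_right_mono) auto
      finally have le: "(\<integral>x. \<bar>word_op X I (\<alpha> i) x\<bar> powr p \<partial>\<mu>) \<le> D * (y + N \<alpha> 0)" by (simp add: distrib_left)
      have "Lp_pow \<mu> p (word_op X I (\<alpha> i)) \<le> ennreal (D * (y + N \<alpha> 0))"
        unfolding Lp_eq[OF \<alpha> i I] by (rule ennreal_leI[OF le])
      also have "\<dots> = ennreal D * (Y + ennreal (N \<alpha> 0))"
        using D real N0 by (simp add: ennreal_mult ennreal_plus)
      finally show "Lp_pow \<mu> p (word_op X I (\<alpha> i)) \<le> ennreal D * (Y + ennreal (N \<alpha> 0))" .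
    qed
  qed
  \<comment> \<open>The number of terms on the left-hand side of the claim, each bounded with the
    constant \<open>D powr (1 / p)\<close>.\<close>
  define V where "V = real (\<Sum>l=0..m. n * card (multi_indices \<nu> l))"
  define E where "E = (V + 1) * D powr (1 / p)"
  have V0: "V \<ge> 0" unfolding V_def by (rule of_nat_0_le_iff)
  have E: "E > 0" using V0 D by (simp add: E_def)
  have "(\<Sum>l=0..m. seminorm_vec \<mu> p \<nu> X n l \<alpha>)
      \<le> ennreal E * (Lp_norm_vec \<mu> p q (matrix_op \<nu> X m n a \<alpha>) + Lp_norm_vec \<mu> p n \<alpha>)"
    if \<alpha>: "\<forall>i\<in>{1..n}. \<alpha> i \<in> test_functions A UNIV" for \<alpha>
  proof -
    have F: "\<alpha> \<in> F" using \<alpha> by (simp add: F_def)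
    define Z where "Z = Lp_norm_vec \<mu> p q (matrix_op \<nu> X m n a \<alpha>) + Lp_norm_vec \<mu> p n \<alpha>"
    have Z: "(\<Sum>k\<in>?P. Lp_norm \<mu> p (case_sum (\<lambda>j. matrix_op \<nu> X m n a \<alpha> j) \<alpha> k)) = Z"
      by (subst sum.Plus) (simp_all add: Z_def Lp_norm_vec_def)
    have "(\<Sum>l=0..m. seminorm_vec \<mu> p \<nu> X n l \<alpha>) \<le>
        (\<Sum>l=0..m. \<Sum>i=1..n. \<Sum>I\<in>multi_indices \<nu> l. ennreal (D powr (1 / p)) * Z)"
      unfolding seminorm_vec_def seminorm_def
    proof (intro sum_mono)
      fix l i I assume l: "l \<in> {0..m}" and i: "i \<in> {1..n}" and I: "I \<in> multi_indices \<nu> l"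
      show "Lp_norm \<mu> p (word_op X I (\<alpha> i)) \<le> ennreal (D powr (1 / p)) * Z"
        unfolding Z[symmetric] by (rule Lp_norm_le_of_Lp_pow_le[OF _ p D main[OF F i _ I]]) (use l in auto)
    qed
    also have "\<dots> = ennreal V * (ennreal (D powr (1 / p)) * Z)"
    proof -
      have "(\<Sum>l=0..m. \<Sum>i=1..n. \<Sum>I\<in>multi_indices \<nu> l. ennreal (D powr (1 / p)) * Z) =
          of_nat (\<Sum>l=0..m. n * card (multi_indices \<nu> l)) * (ennreal (D powr (1 / p)) * Z)"
        by (simp add: sum_distrib_right mult.assoc)
      then show ?thesis unfolding V_def by (simp only: ennreal_of_nat_eq_real_of_nat)
    qed
    also have "\<dots> \<le> ennreal (V + 1) * (ennreal (D powr (1 / p)) * Z)"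
      by (intro mult_right_mono ennreal_leI) auto
    also have "\<dots> = ennreal E * Z" using V0 by (simp add: E_def ennreal_mult mult.assoc)
    finally show ?thesis unfolding Z_def .
  qed
  then show ?thesis unfolding maximal_hypoelliptic_def using E by blast
qed

end

theorem theorem1p2:
  fixes G :: "'g::{second_countable_topology, t2_space} monoid"
    and A :: "('g, 'e::euclidean_space) chart set"
    and \<mu> :: "'g measure"
    and p :: real
    and \<nu> m n q :: nat
    and X :: "nat \<Rightarrow> 'g operator"
    and a :: "nat \<Rightarrow> nat \<Rightarrow> nat list \<Rightarrow> 'g \<Rightarrow> real"
    and \<Omega> :: "'g set"
  assumes "lie_group G A"
    and "connected (UNIV :: 'g set)"
    and "\<not> compact (UNIV :: 'g set)"
    and "left_haar_measure G \<mu>"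
    and "1 \<le> p"
    and "\<forall>i\<in>{1..\<nu>}. X i \<in> lie_algebra G A"
    and "lin_indep_fields A \<nu> X"
    and "1 \<le> n" and "1 \<le> q" and "1 \<le> m"
    and "has_degree \<mu> \<nu> m n q a"
    and "\<forall>i\<in>{1..n}. \<forall>j\<in>{1..q}. left_invariant_op G A \<mu> (principal_part \<nu> X m (a i j))"
    and "\<forall>i\<in>{1..n}. \<forall>j\<in>{1..q}. \<forall>k<m. \<forall>I\<in>multi_indices \<nu> k. a i j I \<in> L_infty \<mu>"
    and "open \<Omega>" and "\<Omega> \<noteq> {}"
    and "maximal_hypoelliptic A \<mu> p \<nu> X m n q a \<Omega>"
  shows "maximal_hypoelliptic A \<mu> p \<nu> X m n q a UNIV"
proof -
  interpret haar_lie_grp G A \<mu>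
    using assms(1,4) by unfold_locales
  interpret matrix_diff_op G A \<mu> \<nu> m n q X a
    using assms(6,10-13) by unfold_locales (auto simp: has_degree_def)
  show ?thesis
    by (rule maximal_hypoelliptic_UNIV[OF assms(5,14-16)])
qed

end
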